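(* Let $\alpha$ be a strong composition of $n$, and list $\mathrm{RSCT}_n(\alpha)=\{\Upsilon_1<\cdots<\Upsilon_N\}$ in the total order on row-strict composition tableaux. Put $P_i=P_{\Upsilon_i}$, $w_i=w_{\Upsilon_i}$ and $Q_i=\frac{1}{\phi_{w_i}(P_i)}P_i\in Q(\mathfrak s^* )\otimes_{S(\mathfrak s^* )}\mathcal A$. Suppose $F\in\mathcal A$ and define, for $0\le i\le N$ and $1\le j\le N$, $$a(i,j)=\begin{cases}\phi_{w_j}(F)& i=0,\\ \phi_{w_j}(Q_i)& i>0.\end{cases}$$ Write $F=\sum_{k=1}^N D_kQ_k$ with $D_k\in Q(\mathfrak s^* )$. Then for all $1\le k\le N$, $$D_k=(-1)^{k-1}\det\left[a(i,j+1)\right]_{0\le i,j\le k-1}.$$ In particular, the coefficients $C_k\in S(\mathfrak s^* )$ in the expansion $F=\sum_{k=1}^N C_kP_k$ are $$C_k=\frac{(-1)^{k-1}}{\phi_{w_k}(P_k)}\det\left[a(i,j+1)\right]_{0\le i,j\le k-1}\qquad(1\le k\le N).$$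
   Context: Ring. A strong composition $\alpha=(\alpha_1,\dots,\alpha_r)$ of $n$ is a sequence of positive integers with sum $n$. Let $W=S_n$ and $\mathfrak t=\{(t_1,\dots,t_n)\in\mathbb C^n:\sum t_i=0\}$, with $W$ acting by $(w\cdot t)_{w(i)}=t_i$. Let $\mathfrak s\subseteq\mathfrak t$ be the subspace of vectors $((z_1)^{\alpha_1},\dots,(z_r)^{\alpha_r})$, where $(z_i)^{\alpha_i}$ means $z_i$ repeated $\alpha_i$ times. Thus $S(\mathfrak s^* )=\mathbb C[z_1,\dots,z_r]/\langle\sum\alpha_iz_i\rangle$ and $\mathbb C[\mathfrak s\times\mathfrak t]=\mathbb C[z_1,\dots,z_r;x_1,\dots,x_n]/\langle\sum\alpha_iz_i,\sum x_i\rangle$. Let $Z_\alpha=\{(h,w\cdot h): h\in\mathfrak s,w\in W\}\subseteq\mathfrak s\times\mathfrak t$ (reduced) and let $\mathcal A=\mathbb C[Z_\alpha]$ be its coordinate ring, a quotient of $\mathbb C[\mathfrak s\times\mathfrak t]$ by the vanishing ideal of $Z_\alpha$ and an $S(\mathfrak s^* )$-algebra via projection to the first factor. (By Kumar–Procesi, $\mathcal A$ is the $S$-equivariant cohomology ring of the Springer fiber of Jordan type $\alpha$.) $Q(\mathfrak s^* )$ is the field of fractions of $S(\mathfrak s^* )$. Localization. For $w\in W$, $\phi_w:\mathbb C[\mathfrak s\times\mathfrak t]\to S(\mathfrak s^* )$ is given by $\phi_w(F)(h)=F(h,w\cdot h)$ for $h\in\mathfrak s$; it descends to $\mathcal A$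 and is extended $Q(\mathfrak s^* )$-linearly to $Q(\mathfrak s^* )\otimes_{S(\mathfrak s^* )}\mathcal A$. Tableaux. For a weak composition $\beta$ (nonnegative parts) of $m\le n$, put $\bar m=n-m+1$. $\mathrm{RSCT}_n(\beta)$ is the set of fillings of the diagram with $\beta_i$ left-justified boxes in row $i$ (rows numbered from top to bottom) by $\bar m,\dots,n$, each used once, with entries decreasing from left to right in each row. A pair $(i,j)$ is a Springer inversion of $\Upsilon$ if there is an entry $j'$ in row $j$ with $i<j'$ such that either $j'$ appears above $i$ in the same column, or $j'$ appears in a column strictly to the right of the column containing $i$; $\mathrm{Inv}(\Upsilon)$ is the set of these. $\eta(\Upsilon)$ is the tableau obtained by deleting the box containing $\bar m$. Total order on $\mathrm{RSCT}_n(\beta)$: let $j_\Upsilon,j_\Omega$ be the indices of the rows containing $\bar m$ in $\Upsilon,\Omega$. If $j_\Upsilon\ne j_\Omega$, then $\Omega<\Upsilon$ if $(\bar m,j_\Omega)\in\mathrm{Inv}(\Upsilon)$ and $\Upsilon<\Omega$ if $(\bar m,j_\Upsilon)\in\mathrm{Inv}(\Omega)$; if $j_\Upsilon=j_\Omega$, then inductively $\Omega<\Upsilon$ if $\eta(\Omega)<\eta(\Upsilon)$. For $\Upsilon\in\mathrm{RSCT}_n(\alpha)$ let $P_\Upsilon=\prod_{(i,j)\in\mathrm{Inv}(\Upsilon)}(x_i-z_j)$ (equal to $1$ if there are no inversions), viewed in $\mathcal A$. For $h=((h_1)^{\alpha_1},\dots,(h_r)^{\alpha_r})\in\mathfrak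 s$ with distinct $h_i$, let $h_\Upsilon\in\mathfrak t$ have $i$-th coordinate $h_j$ whenever $i$ lies in row $j$ of $\Upsilon$; $w_\Upsilon$ is the unique minimal length coset representative in $W/W_L$ with $w_\Upsilon\cdot h=h_\Upsilon$, where $W_L=S_{\alpha_1}\times\cdots\times S_{\alpha_r}$. It is known that $\{P_\Upsilon\}$ is an $S(\mathfrak s^* )$-basis of $\mathcal A$ and that $\phi_{w_i}(P_i)\neq0$ for all $i$, so the expansions in the claim make sense. *)

theory Defs
  imports Complex_Main "HOL-Algebra.QuotRing" "HOL-Algebra.Module"
    "HOL-Algebra.Free_Abelian_Groups" "HOL-Combinatorics.Permutations"
begin

section \<open>Algebras, fraction fields, tensor products and determinants over carrier-based rings\<close>

definition algebra_of_hom :: "('a \<Rightarrow> 'b) \<Rightarrow> ('b, 'm) ring_scheme \<Rightarrow> ('a, 'b) module" where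
  "algebra_of_hom f B =
    \<lparr>carrier = carrier B, monoid.mult = monoid.mult B, monoid.one = monoid.one B,
     ring.zero = ring.zero B, ring.add = ring.add B,
     smult = (\<lambda>r b. f r \<otimes>\<^bsub>B\<^esub> b)\<rparr>"

definition frac_rel :: "('a, 'm) ring_scheme \<Rightarrow> (('a \<times> 'a) \<times> ('a \<times> 'a)) set" where
  "frac_rel R = {((a, b), (c, d)).
     a \<in> carrier R \<and> b \<in> carrier R - {\<zero>\<^bsub>R\<^esub>} \<and> c \<in> carrier R \<and> d \<in> carrier R - {\<zero>\<^bsub>R\<^esub>} \<and>
     a \<otimes>\<^bsub>R\<^esub> d = c \<otimes>\<^bsub>R\<^esub> b}"

definition fraction :: "('a, 'm) ring_scheme \<Rightarrow> 'a \<Rightarrow> 'a \<Rightarrow> ('a \<times> 'a) set" where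
  "fraction R a b = frac_rel R `` {(a, b)}"

definition frac_field :: "('a, 'm) ring_scheme \<Rightarrow> ('a \<times> 'a) set ring" where
  "frac_field R =
    \<lparr>carrier = (carrier R \<times> (carrier R - {\<zero>\<^bsub>R\<^esub>})) // frac_rel R,
     monoid.mult = (\<lambda>X Y. \<Union>(a, b)\<in>X. \<Union>(c, d)\<in>Y. fraction R (a \<otimes>\<^bsub>R\<^esub> c) (b \<otimes>\<^bsub>R\<^esub> d)),
     monoid.one = fraction R \<one>\<^bsub>R\<^esub> \<one>\<^bsub>R\<^esub>,
     ring.zero = fraction R \<zero>\<^bsub>R\<^esub> \<one>\<^bsub>R\<^esub>,
     ring.add = (\<lambda>X Y. \<Union>(a, b)\<in>X. \<Union>(c, d)\<in>Y.
              fraction R ((a \<otimes>\<^bsub>R\<^esub> d) \<oplus>\<^bsub>R\<^esub> (c \<otimes>\<^bsub>R\<^esub> b)) (b \<otimes>\<^bsub>R\<^esub> d))\<rparr>"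

definition of_base :: "('a, 'm) ring_scheme \<Rightarrow> 'a \<Rightarrow> ('a \<times> 'a) set" where
  "of_base R a = fraction R a \<one>\<^bsub>R\<^esub>"

text \<open>The tensor product of two algebras over \<open>R\<close>: the free abelian group on pairs modulo the
  subgroup generated by the bilinearity relations. The result is an algebra over the left factor.\<close>

definition tensor_free ::
    "('a, 'b, 'm) module_scheme \<Rightarrow> ('a, 'c, 'k) module_scheme \<Rightarrow> ('b \<times> 'c \<Rightarrow>\<^sub>0 int) monoid" where
  "tensor_free M N = free_Abelian_group (carrier M \<times> carrier N)"

definition tensor_relators ::
    "('a, 'r) ring_scheme \<Rightarrow> ('a, 'b, 'm) module_scheme \<Rightarrow> ('a, 'c, 'k) module_scheme
      \<Rightarrow> ('b \<times> 'c \<Rightarrow>\<^sub>0 int) set" where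
  "tensor_relators R M N =
    {frag_of (m \<oplus>\<^bsub>M\<^esub> m', x) - frag_of (m, x) - frag_of (m', x) | m m' x.
       m \<in> carrier M \<and> m' \<in> carrier M \<and> x \<in> carrier N} \<union>
    {frag_of (m, x \<oplus>\<^bsub>N\<^esub> x') - frag_of (m, x) - frag_of (m, x') | m x x'.
       m \<in> carrier M \<and> x \<in> carrier N \<and> x' \<in> carrier N} \<union>
    {frag_of (r \<odot>\<^bsub>M\<^esub> m, x) - frag_of (m, r \<odot>\<^bsub>N\<^esub> x) | r m x.
       r \<in> carrier R \<and> m \<in> carrier M \<and> x \<in> carrier N}"

definition tensor_null ::
    "('a, 'r) ring_scheme \<Rightarrow> ('a, 'b, 'm) module_scheme \<Rightarrow> ('a, 'c, 'k) module_scheme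
      \<Rightarrow> ('b \<times> 'c \<Rightarrow>\<^sub>0 int) set" where
  "tensor_null R M N = generate (tensor_free M N) (tensor_relators R M N)"

definition tensor_class ::
    "('a, 'r) ring_scheme \<Rightarrow> ('a, 'b, 'm) module_scheme \<Rightarrow> ('a, 'c, 'k) module_scheme
      \<Rightarrow> ('b \<times> 'c \<Rightarrow>\<^sub>0 int) \<Rightarrow> ('b \<times> 'c \<Rightarrow>\<^sub>0 int) set" where
  "tensor_class R M N u = tensor_null R M N #>\<^bsub>tensor_free M N\<^esub> u"

definition pure_tensor ::
    "('a, 'r) ring_scheme \<Rightarrow> ('a, 'b, 'm) module_scheme \<Rightarrow> ('a, 'c, 'k) module_scheme
      \<Rightarrow> 'b \<Rightarrow> 'c \<Rightarrow> ('b \<times> 'c \<Rightarrow>\<^sub>0 int) set" where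
  "pure_tensor R M N m x = tensor_class R M N (frag_of (m, x))"

definition tensor_algebra ::
    "('a, 'r) ring_scheme \<Rightarrow> ('a, 'b, 'm) module_scheme \<Rightarrow> ('a, 'c, 'k) module_scheme
      \<Rightarrow> ('b, ('b \<times> 'c \<Rightarrow>\<^sub>0 int) set) module" where
  "tensor_algebra R M N =
    \<lparr>carrier = carrier (tensor_free M N Mod tensor_null R M N),
     monoid.mult = (\<lambda>X Y. \<Union>u\<in>X. \<Union>v\<in>Y. tensor_class R M N
        (frag_extend (\<lambda>(m, x). frag_extend (\<lambda>(m', x').
            frag_of (m \<otimes>\<^bsub>M\<^esub> m', x \<otimes>\<^bsub>N\<^esub> x')) v) u)),
     monoid.one = pure_tensor R M N \<one>\<^bsub>M\<^esub> \<one>\<^bsub>N\<^esub>,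
     ring.zero = monoid.one (tensor_free M N Mod tensor_null R M N),
     ring.add = monoid.mult (tensor_free M N Mod tensor_null R M N),
     smult = (\<lambda>q X. \<Union>u\<in>X. tensor_class R M N
        (frag_extend (\<lambda>(m, x). frag_of (q \<otimes>\<^bsub>M\<^esub> m, x)) u))\<rparr>"

text \<open>For an \<open>R\<close>-linear map \<open>g\<close> from \<open>N\<close> to \<open>M\<close>, the \<open>M\<close>-linear map on the tensor product sending
  the class of \<open>\<Sum> n\<^sub>i (m\<^sub>i, x\<^sub>i)\<close> to \<open>\<Sum> n\<^sub>i m\<^sub>i g(x\<^sub>i)\<close>, which does not depend on the representative.\<close>

definition linear_extension ::
    "('b, 'm) ring_scheme \<Rightarrow> ('c \<Rightarrow> 'b) \<Rightarrow> ('b \<times> 'c \<Rightarrow>\<^sub>0 int) set \<Rightarrow> 'b" where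
  "linear_extension M g X = the_elem
    ((\<lambda>u. \<Oplus>\<^bsub>M\<^esub>p\<in>Poly_Mapping.keys u.
        add_pow M (Poly_Mapping.lookup u p) (fst p \<otimes>\<^bsub>M\<^esub> g (snd p))) ` X)"

definition ring_det :: "('a, 'm) ring_scheme \<Rightarrow> nat \<Rightarrow> (nat \<Rightarrow> nat \<Rightarrow> 'a) \<Rightarrow> 'a" where
  "ring_det R k M =
    (\<Oplus>\<^bsub>R\<^esub>\<sigma>\<in>{\<sigma>. \<sigma> permutes {0..<k}}.
       (if evenperm \<sigma> then \<one>\<^bsub>R\<^esub> else \<ominus>\<^bsub>R\<^esub> \<one>\<^bsub>R\<^esub>) \<otimes>\<^bsub>R\<^esub> (\<Otimes>\<^bsub>R\<^esub>i\<in>{0..<k}. M i (\<sigma> i)))"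


section \<open>Polynomial functions on subsets of complex affine space\<close>

inductive_set polynomial_maps :: "('v \<Rightarrow> complex) set \<Rightarrow> ('v \<Rightarrow> complex) set"
  for G :: "('v \<Rightarrow> complex) set" where
  const: "(\<lambda>_. c) \<in> polynomial_maps G"
| coord: "f \<in> G \<Longrightarrow> f \<in> polynomial_maps G"
| add: "f \<in> polynomial_maps G \<Longrightarrow> g \<in> polynomial_maps G \<Longrightarrow> (\<lambda>v. f v + g v) \<in> polynomial_maps G"
| mult: "f \<in> polynomial_maps G \<Longrightarrow> g \<in> polynomial_maps G \<Longrightarrow> (\<lambda>v. f v * g v) \<in> polynomial_maps G"

text \<open>The ring \<open>\<complex>[V]\<close> for a linear subspace \<open>V\<close> with coordinate functions \<open>G\<close>. As the ground field
  is infinite, it is the polynomial ring in the coordinates modulo the linear relations on \<open>V\<close>.\<close>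

definition polynomial_ring :: "('v \<Rightarrow> complex) set \<Rightarrow> 'v set \<Rightarrow> ('v \<Rightarrow> complex) ring" where
  "polynomial_ring G V =
    \<lparr>carrier = (\<lambda>f. restrict f V) ` polynomial_maps G,
     monoid.mult = (\<lambda>f g. \<lambda>v\<in>V. f v * g v),
     monoid.one = (\<lambda>v\<in>V. 1),
     ring.zero = (\<lambda>v\<in>V. 0),
     ring.add = (\<lambda>f g. \<lambda>v\<in>V. f v + g v)\<rparr>"


section \<open>The variety and its coordinate ring\<close>

text \<open>A composition is the list of its parts; part \<open>j\<close>, counted from \<open>1\<close>, is \<open>\<alpha> ! (j - 1)\<close>.
  A vector of \<open>\<complex>\<^sup>n\<close> is an extensional function on \<open>{1..n}\<close>.\<close>

definition strong_composition :: "nat \<Rightarrow> nat list \<Rightarrow> bool" where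
  "strong_composition n \<alpha> \<longleftrightarrow> (\<forall>a\<in>set \<alpha>. 0 < a) \<and> sum_list \<alpha> = n"

definition block :: "nat list \<Rightarrow> nat \<Rightarrow> nat set" where
  "block \<alpha> j = {sum_list (take (j - 1) \<alpha>) <.. sum_list (take j \<alpha>)}"

definition t_space :: "nat \<Rightarrow> (nat \<Rightarrow> complex) set" where
  "t_space n = {t \<in> {1..n} \<rightarrow>\<^sub>E UNIV. (\<Sum>i = 1..n. t i) = 0}"

definition s_space :: "nat list \<Rightarrow> (nat \<Rightarrow> complex) set" where
  "s_space \<alpha> = {h \<in> t_space (sum_list \<alpha>).
     \<exists>z. \<forall>j\<in>{1..length \<alpha>}. \<forall>i\<in>block \<alpha> j. h i = z j}"

definition z_coord :: "nat list \<Rightarrow> nat \<Rightarrow> (nat \<Rightarrow> complex) \<Rightarrow> complex" where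
  "z_coord \<alpha> j h = h (Suc (sum_list (take (j - 1) \<alpha>)))"

definition perm_act :: "(nat \<Rightarrow> nat) \<Rightarrow> (nat \<Rightarrow> complex) \<Rightarrow> nat \<Rightarrow> complex" where
  "perm_act w t = (\<lambda>i. t (inv_into UNIV w i))"

definition Z_variety :: "nat list \<Rightarrow> ((nat \<Rightarrow> complex) \<times> (nat \<Rightarrow> complex)) set" where
  "Z_variety \<alpha> = {(h, perm_act w h) | h w. h \<in> s_space \<alpha> \<and> w permutes {1..sum_list \<alpha>}}"

definition S_ring :: "nat list \<Rightarrow> ((nat \<Rightarrow> complex) \<Rightarrow> complex) ring" where
  "S_ring \<alpha> = polynomial_ring {z_coord \<alpha> j | j. j \<in> {1..length \<alpha>}} (s_space \<alpha>)"

definition ST_ring ::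
    "nat list \<Rightarrow> ((nat \<Rightarrow> complex) \<times> (nat \<Rightarrow> complex) \<Rightarrow> complex) ring" where
  "ST_ring \<alpha> = polynomial_ring
     ({\<lambda>(h, t). z_coord \<alpha> j h | j. j \<in> {1..length \<alpha>}} \<union> {\<lambda>(h, t). t i | i. i \<in> {1..sum_list \<alpha>}})
     (s_space \<alpha> \<times> t_space (sum_list \<alpha>))"

definition vanishing_ideal ::
    "nat list \<Rightarrow> ((nat \<Rightarrow> complex) \<times> (nat \<Rightarrow> complex) \<Rightarrow> complex) set" where
  "vanishing_ideal \<alpha> = {F \<in> carrier (ST_ring \<alpha>). \<forall>p\<in>Z_variety \<alpha>. F p = 0}"

type_synonym s_elt = "(nat \<Rightarrow> complex) \<Rightarrow> complex"
type_synonym q_elt = "(s_elt \<times> s_elt) set"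
type_synonym a_elt = "((nat \<Rightarrow> complex) \<times> (nat \<Rightarrow> complex) \<Rightarrow> complex) set"
type_synonym qa_elt = "(q_elt \<times> a_elt \<Rightarrow>\<^sub>0 int) set"

definition A_class ::
    "nat list \<Rightarrow> ((nat \<Rightarrow> complex) \<times> (nat \<Rightarrow> complex) \<Rightarrow> complex) \<Rightarrow> a_elt" where
  "A_class \<alpha> F = vanishing_ideal \<alpha> +>\<^bsub>ST_ring \<alpha>\<^esub> F"

definition A_algebra :: "nat list \<Rightarrow> (s_elt, a_elt) module" where
  "A_algebra \<alpha> = algebra_of_hom
     (\<lambda>f. A_class \<alpha> (\<lambda>(h, t)\<in>s_space \<alpha> \<times> t_space (sum_list \<alpha>). f h))
     (ST_ring \<alpha> Quot vanishing_ideal \<alpha>)"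

definition Q_field :: "nat list \<Rightarrow> q_elt ring" where
  "Q_field \<alpha> = frac_field (S_ring \<alpha>)"

definition Q_algebra :: "nat list \<Rightarrow> (s_elt, q_elt) module" where
  "Q_algebra \<alpha> = algebra_of_hom (of_base (S_ring \<alpha>)) (Q_field \<alpha>)"

definition QA_algebra :: "nat list \<Rightarrow> (q_elt, qa_elt) module" where
  "QA_algebra \<alpha> = tensor_algebra (S_ring \<alpha>) (Q_algebra \<alpha>) (A_algebra \<alpha>)"

definition A_to_QA :: "nat list \<Rightarrow> a_elt \<Rightarrow> qa_elt" where
  "A_to_QA \<alpha> X = pure_tensor (S_ring \<alpha>) (Q_algebra \<alpha>) (A_algebra \<alpha>) \<one>\<^bsub>Q_field \<alpha>\<^esub> X"


section \<open>Localization\<close>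

definition phi :: "nat list \<Rightarrow> (nat \<Rightarrow> nat)
    \<Rightarrow> ((nat \<Rightarrow> complex) \<times> (nat \<Rightarrow> complex) \<Rightarrow> complex) \<Rightarrow> s_elt" where
  "phi \<alpha> w F = (\<lambda>h\<in>s_space \<alpha>. F (h, perm_act w h))"

definition phi_A :: "nat list \<Rightarrow> (nat \<Rightarrow> nat) \<Rightarrow> a_elt \<Rightarrow> s_elt" where
  "phi_A \<alpha> w X = the_elem (phi \<alpha> w ` X)"

definition phi_QA :: "nat list \<Rightarrow> (nat \<Rightarrow> nat) \<Rightarrow> qa_elt \<Rightarrow> q_elt" where
  "phi_QA \<alpha> w = linear_extension (Q_field \<alpha>) (\<lambda>X. of_base (S_ring \<alpha>) (phi_A \<alpha> w X))"


section \<open>Row-strict composition tableaux\<close>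

text \<open>A tableau is the list of its rows; row \<open>j\<close>, counted from \<open>1\<close>, is \<open>T ! (j - 1)\<close>.
  Since \<open>\<beta>\<close> may have zero parts, rows may be empty.\<close>

type_synonym tableau = "nat list list"

definition RSCT :: "nat \<Rightarrow> nat list \<Rightarrow> tableau set" where
  "RSCT n \<beta> = {T. sum_list \<beta> \<le> n \<and> map length T = \<beta> \<and>
     distinct (concat T) \<and> set (concat T) = {n - sum_list \<beta> + 1..n} \<and>
     (\<forall>R\<in>set T. sorted_wrt (>) R)}"

definition has_entry :: "tableau \<Rightarrow> nat \<Rightarrow> nat \<Rightarrow> nat \<Rightarrow> bool" where
  "has_entry T j c i \<longleftrightarrow>
     j \<in> {1..length T} \<and> c \<in> {1..length (T ! (j - 1))} \<and> T ! (j - 1) ! (c - 1) = i"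

definition row_of :: "tableau \<Rightarrow> nat \<Rightarrow> nat" where
  "row_of T i = (THE j. \<exists>c. has_entry T j c i)"

definition springer_Inv :: "tableau \<Rightarrow> (nat \<times> nat) set" where
  "springer_Inv T = {(i, j). \<exists>r c j' c'.
     has_entry T r c i \<and> has_entry T j c' j' \<and> i < j' \<and> (c' = c \<and> j < r \<or> c < c')}"

definition min_entry :: "nat \<Rightarrow> nat list \<Rightarrow> nat" where
  "min_entry n \<beta> = n - sum_list \<beta> + 1"

definition eta :: "nat \<Rightarrow> tableau \<Rightarrow> tableau" where
  "eta n T = map (removeAll (min_entry n (map length T))) T"

text \<open>\<open>rsct_less n \<beta> U T\<close> is the order \<open>U < T\<close> on \<open>RSCT n \<beta>\<close>. When the rows of the minimal entry
  agree, \<open>eta\<close> yields two tableaux of a common shape.\<close>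

inductive rsct_less :: "nat \<Rightarrow> nat list \<Rightarrow> tableau \<Rightarrow> tableau \<Rightarrow> bool" for n :: nat where
  diff_row:
    "\<lbrakk>T \<in> RSCT n \<beta>; U \<in> RSCT n \<beta>; 0 < sum_list \<beta>;
      row_of T (min_entry n \<beta>) \<noteq> row_of U (min_entry n \<beta>);
      (min_entry n \<beta>, row_of U (min_entry n \<beta>)) \<in> springer_Inv T\<rbrakk>
     \<Longrightarrow> rsct_less n \<beta> U T"
| same_row:
    "\<lbrakk>T \<in> RSCT n \<beta>; U \<in> RSCT n \<beta>; 0 < sum_list \<beta>;
      row_of T (min_entry n \<beta>) = row_of U (min_entry n \<beta>);
      rsct_less n (map length (eta n T)) (eta n U) (eta n T)\<rbrakk>
     \<Longrightarrow> rsct_less n \<beta> U T"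


section \<open>The elements attached to a tableau\<close>

definition P_elt :: "nat list \<Rightarrow> tableau \<Rightarrow> a_elt" where
  "P_elt \<alpha> T = A_class \<alpha> (\<lambda>(h, t)\<in>s_space \<alpha> \<times> t_space (sum_list \<alpha>).
     \<Prod>(i, j)\<in>springer_Inv T. t i - z_coord \<alpha> j h)"

definition h_tab :: "nat list \<Rightarrow> tableau \<Rightarrow> (nat \<Rightarrow> complex) \<Rightarrow> nat \<Rightarrow> complex" where
  "h_tab \<alpha> T h = (\<lambda>i\<in>{1..sum_list \<alpha>}. z_coord \<alpha> (row_of T i) h)"

text \<open>The Coxeter length of a permutation of \<open>{1..n}\<close> is its number of inversions.\<close>

definition perm_length :: "nat \<Rightarrow> (nat \<Rightarrow> nat) \<Rightarrow> nat" where
  "perm_length n w = card {(i, j). i \<in> {1..n} \<and> j \<in> {1..n} \<and> i < j \<and> w j < w i}"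

definition young_subgroup :: "nat list \<Rightarrow> (nat \<Rightarrow> nat) set" where
  "young_subgroup \<alpha> = {v. v permutes {1..sum_list \<alpha>} \<and>
     (\<forall>j\<in>{1..length \<alpha>}. v ` block \<alpha> j = block \<alpha> j)}"

definition min_coset_rep :: "nat list \<Rightarrow> (nat \<Rightarrow> nat) \<Rightarrow> bool" where
  "min_coset_rep \<alpha> w \<longleftrightarrow> w permutes {1..sum_list \<alpha>} \<and>
     (\<forall>v\<in>young_subgroup \<alpha>. perm_length (sum_list \<alpha>) w \<le> perm_length (sum_list \<alpha>) (w \<circ> v))"

definition w_tab :: "nat list \<Rightarrow> tableau \<Rightarrow> nat \<Rightarrow> nat" where
  "w_tab \<alpha> T = (THE w. min_coset_rep \<alpha> w \<and>
     (\<forall>h\<in>s_space \<alpha>. inj_on (\<lambda>j. z_coord \<alpha> j h) {1..length \<alpha>} \<longrightarrow> perm_act w h = h_tab \<alpha> T h))"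

definition Q_elt :: "nat list \<Rightarrow> tableau \<Rightarrow> qa_elt" where
  "Q_elt \<alpha> T =
     m_inv (Q_field \<alpha>) (of_base (S_ring \<alpha>) (phi_A \<alpha> (w_tab \<alpha> T) (P_elt \<alpha> T)))
       \<odot>\<^bsub>QA_algebra \<alpha>\<^esub> A_to_QA \<alpha> (P_elt \<alpha> T)"

definition a_mat :: "nat list \<Rightarrow> (nat \<Rightarrow> tableau) \<Rightarrow> a_elt \<Rightarrow> nat \<Rightarrow> nat \<Rightarrow> q_elt" where
  "a_mat \<alpha> \<Upsilon> F i j =
     (if i = 0 then of_base (S_ring \<alpha>) (phi_A \<alpha> (w_tab \<alpha> (\<Upsilon> j)) F)
      else phi_QA \<alpha> (w_tab \<alpha> (\<Upsilon> j)) (Q_elt \<alpha> (\<Upsilon> i)))"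

end

theory Submission
  imports Defs "HOL-Computational_Algebra.Polynomial"
begin

text \<open>
  Order the tableaux as \<open>\<Upsilon>\<^sub>1 < \<dots> < \<Upsilon>\<^sub>N\<close>. The matrix of all localizations
  \<open>\<phi>\<^bsub>w\<^sub>j\<^esub>(Q\<^sub>i)\<close> is upper triangular with \<open>1\<close> on the diagonal, and the determinant formula is Cramer's
  rule for this triangular system: applying the \<open>Q(s\<^sup>*)\<close>-linear maps \<open>\<phi>\<^bsub>w\<^sub>j\<^esub>\<close> to
  \<open>F = \<Sum>\<^sub>m D\<^sub>m Q\<^sub>m\<close> gives \<open>a(0,j) = \<Sum>\<^sub>m D\<^sub>m a(m,j)\<close>, so in the \<open>k \<times> k\<close> determinant the first row
  is a combination of the rows of \<open>Q\<^sub>1, \<dots>, Q\<^sub>N\<close>. The rows of \<open>Q\<^sub>m\<close> with \<open>m < k\<close> occur further down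
  and contribute nothing, those with \<open>m > k\<close> vanish in the columns considered, and the row of \<open>Q\<^sub>k\<close>
  is the last unit vector; what remains is \<open>D\<^sub>k\<close> times the sign of a \<open>k\<close>-cycle
  (\<open>triangular_expansion_coefficient\<close>).

  Triangularity is combinatorial. The permutation \<open>w\<^sub>\<Omega>\<close> carries block \<open>j\<close> of positions to the
  entries of row \<open>j\<close> of \<open>\<Omega>\<close> (\<open>w_tab_adapted\<close>), hence
  \<open>\<phi>\<^bsub>w\<^sub>\<Omega>\<^esub>(P\<^sub>\<Upsilon>) = \<Prod>\<^bsub>(i,j) \<in> Inv \<Upsilon>\<^esub> (z\<^bsub>row\<^sub>\<Omega>(i)\<^esub> - z\<^sub>j)\<close> (\<open>phi_P\<close>). If \<open>\<Omega> < \<Upsilon>\<close>, some inversion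
  \<open>(i, j)\<close> of \<open>\<Upsilon>\<close> has \<open>i\<close> in row \<open>j\<close> of \<open>\<Omega>\<close> (\<open>rsct_less_inversion\<close>), and the product contains
  the factor \<open>0\<close>. If \<open>\<Omega> = \<Upsilon>\<close>, no inversion \<open>(i, j)\<close> has \<open>i\<close> in row \<open>j\<close>, because rows decrease; the
  product is then nonzero at every point of \<open>s\<close> whose coordinates \<open>z\<^sub>j\<close> are distinct.

  The remaining work makes these computations meaningful: \<open>\<complex>[s]\<close> is a domain and so has a field of
  fractions; \<open>\<phi>\<^sub>w\<close> descends to the coordinate ring and, being \<open>S(s\<^sup>*)\<close>-linear there, extends to the
  tensor product with \<open>Q(s\<^sup>*)\<close>; and a shortest permutation \<open>w\<^sub>\<Upsilon>\<close> with \<open>w\<^sub>\<Upsilon> \<cdot> h = h\<^sub>\<Upsilon>\<close> exists and is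
  unique.
\<close>

section \<open>The field of fractions of a domain\<close>

context "domain"
begin

lemma frac_rel_equiv: "equiv (carrier R \<times> (carrier R - {\<zero>})) (frac_rel R)"
proof (rule equivI)
  show "frac_rel R \<subseteq> (carrier R \<times> (carrier R - {\<zero>})) \<times> (carrier R \<times> (carrier R - {\<zero>}))"
    by (auto simp: frac_rel_def)
  show "refl_on (carrier R \<times> (carrier R - {\<zero>})) (frac_rel R)"
    by (auto simp: refl_on_def frac_rel_def)
  show "sym (frac_rel R)"
    by (auto simp: sym_def frac_rel_def)
  show "trans (frac_rel R)"
  proof (rule transI, clarsimp simp: frac_rel_def)
    fix a b c d e f
    assume c: "a \<in> carrier R" "b \<in> carrier R" "c \<in> carrier R" "d \<in> carrier R"
        "e \<in> carrier R" "f \<in> carrier R" and nz: "d \<noteq> \<zero>"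
      and ad: "a \<otimes> d = c \<otimes> b" and cf: "c \<otimes> f = e \<otimes> d"
    have "d \<otimes> (a \<otimes> f) = (a \<otimes> d) \<otimes> f"
      using c by (simp add: m_ac)
    also have "\<dots> = b \<otimes> (c \<otimes> f)"
      unfolding ad using c by (simp add: m_ac)
    also have "\<dots> = d \<otimes> (e \<otimes> b)"
      unfolding cf using c by (simp add: m_ac)
    finally show "a \<otimes> f = e \<otimes> b"
      using c nz by (simp add: m_lcancel)
  qed
qed

lemma fraction_eq_iff:
  assumes "a \<in> carrier R" "b \<in> carrier R" "b \<noteq> \<zero>" "c \<in> carrier R" "d \<in> carrier R" "d \<noteq> \<zero>"
  shows "fraction R a b = fraction R c d \<longleftrightarrow> a \<otimes> d = c \<otimes> b"
proof -
  have "fraction R a b = fraction R c d \<longleftrightarrow> ((a, b), (c, d)) \<in> frac_rel R"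
    unfolding fraction_def using assms by (intro eq_equiv_class_iff[OF frac_rel_equiv]) auto
  then show ?thesis
    using assms by (simp add: frac_rel_def)
qed

lemma fraction_members:
  assumes "a \<in> carrier R" "b \<in> carrier R" "b \<noteq> \<zero>"
  shows "(c, d) \<in> fraction R a b \<longleftrightarrow>
    c \<in> carrier R \<and> d \<in> carrier R \<and> d \<noteq> \<zero> \<and> fraction R c d = fraction R a b"
proof -
  have "(c, d) \<in> fraction R a b \<longleftrightarrow> c \<in> carrier R \<and> d \<in> carrier R \<and> d \<noteq> \<zero> \<and> a \<otimes> d = c \<otimes> b"
    using assms by (auto simp: fraction_def frac_rel_def)
  also have "\<dots> \<longleftrightarrow> c \<in> carrier R \<and> d \<in> carrier R \<and> d \<noteq> \<zero> \<and> fraction R c d = fraction R a b"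
    using assms by (metis fraction_eq_iff)
  finally show ?thesis .
qed

lemma fraction_closed:
  assumes "a \<in> carrier R" "b \<in> carrier R" "b \<noteq> \<zero>"
  shows "fraction R a b \<in> carrier (frac_field R)"
  using assms by (auto simp: frac_field_def fraction_def intro!: quotientI)

lemma frac_field_cases:
  assumes "X \<in> carrier (frac_field R)"
  obtains a b where "a \<in> carrier R" "b \<in> carrier R" "b \<noteq> \<zero>" "X = fraction R a b"
  using assms by (auto simp: frac_field_def fraction_def elim!: quotientE)

text \<open>The operations of the fraction field are unions over all pairs of representatives; such a union
  collapses to one value as soon as the body does not depend on the representatives.\<close>

lemma UN_fraction2:
  assumes ab: "a \<in> carrier R" "b \<in> carrier R" "b \<noteq> \<zero>"
    and cd: "c \<in> carrier R" "d \<in> carrier R" "d \<noteq> \<zero>"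
    and const: "\<And>a' b' c' d'. \<lbrakk>a' \<in> carrier R; b' \<in> carrier R; b' \<noteq> \<zero>;
        c' \<in> carrier R; d' \<in> carrier R; d' \<noteq> \<zero>; a' \<otimes> b = a \<otimes> b'; c' \<otimes> d = c \<otimes> d'\<rbrakk>
      \<Longrightarrow> f a' b' c' d' = f a b c d"
  shows "(\<Union>(a', b')\<in>fraction R a b. \<Union>(c', d')\<in>fraction R c d. f a' b' c' d') = f a b c d"
proof -
  have "(a, b) \<in> fraction R a b" "(c, d) \<in> fraction R c d"
    using ab cd by (simp_all add: fraction_members)
  moreover have "f a' b' c' d' = f a b c d"
    if "(a', b') \<in> fraction R a b" "(c', d') \<in> fraction R c d" for a' b' c' d'
    using that ab cd by (intro const) (auto simp: fraction_members fraction_eq_iff)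
  ultimately show ?thesis
    by fast
qed

lemma fraction_mult:
  assumes ab: "a \<in> carrier R" "b \<in> carrier R" "b \<noteq> \<zero>"
    and cd: "c \<in> carrier R" "d \<in> carrier R" "d \<noteq> \<zero>"
  shows "fraction R a b \<otimes>\<^bsub>frac_field R\<^esub> fraction R c d = fraction R (a \<otimes> c) (b \<otimes> d)"
proof -
  have "fraction R (a' \<otimes> c') (b' \<otimes> d') = fraction R (a \<otimes> c) (b \<otimes> d)"
    if c: "a' \<in> carrier R" "b' \<in> carrier R" "b' \<noteq> \<zero>"
        "c' \<in> carrier R" "d' \<in> carrier R" "d' \<noteq> \<zero>"
      and e: "a' \<otimes> b = a \<otimes> b'" "c' \<otimes> d = c \<otimes> d'"
    for a' b' c' d'
  proof -
    have "(a' \<otimes> c') \<otimes> (b \<otimes> d) = (a' \<otimes> b) \<otimes> (c' \<otimes> d)"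
      using c ab cd by (simp add: m_ac)
    also have "\<dots> = (a \<otimes> c) \<otimes> (b' \<otimes> d')"
      unfolding e using c ab cd by (simp add: m_ac)
    finally show ?thesis
      using c ab cd by (subst fraction_eq_iff) (auto simp: integral_iff)
  qed
  then show ?thesis
    unfolding frac_field_def using UN_fraction2[OF ab cd,
      where f = "\<lambda>a b c d. fraction R (a \<otimes> c) (b \<otimes> d)"] by simp
qed

lemma fraction_add:
  assumes ab: "a \<in> carrier R" "b \<in> carrier R" "b \<noteq> \<zero>"
    and cd: "c \<in> carrier R" "d \<in> carrier R" "d \<noteq> \<zero>"
  shows "fraction R a b \<oplus>\<^bsub>frac_field R\<^esub> fraction R c d
    = fraction R ((a \<otimes> d) \<oplus> (c \<otimes> b)) (b \<otimes> d)"
proof -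
  have "fraction R ((a' \<otimes> d') \<oplus> (c' \<otimes> b')) (b' \<otimes> d') = fraction R ((a \<otimes> d) \<oplus> (c \<otimes> b)) (b \<otimes> d)"
    if c: "a' \<in> carrier R" "b' \<in> carrier R" "b' \<noteq> \<zero>"
        "c' \<in> carrier R" "d' \<in> carrier R" "d' \<noteq> \<zero>"
      and e: "a' \<otimes> b = a \<otimes> b'" "c' \<otimes> d = c \<otimes> d'"
    for a' b' c' d'
  proof -
    have "((a' \<otimes> d') \<oplus> (c' \<otimes> b')) \<otimes> (b \<otimes> d)
        = (a' \<otimes> b) \<otimes> (d' \<otimes> d) \<oplus> (c' \<otimes> d) \<otimes> (b' \<otimes> b)"
      using c ab cd by (simp add: m_ac l_distr r_distr)
    also have "\<dots> = ((a \<otimes> d) \<oplus> (c \<otimes> b)) \<otimes> (b' \<otimes> d')"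
      unfolding e using c ab cd by (simp add: m_ac l_distr r_distr)
    finally show ?thesis
      using c ab cd by (subst fraction_eq_iff) (auto simp: integral_iff)
  qed
  then show ?thesis
    unfolding frac_field_def using UN_fraction2[OF ab cd,
      where f = "\<lambda>a b c d. fraction R ((a \<otimes> d) \<oplus> (c \<otimes> b)) (b \<otimes> d)"] by simp
qed

lemma frac_field_zero: "\<zero>\<^bsub>frac_field R\<^esub> = fraction R \<zero> \<one>"
  and frac_field_one: "\<one>\<^bsub>frac_field R\<^esub> = fraction R \<one> \<one>"
  by (simp_all add: frac_field_def)

lemma fraction_eq_zero_iff:
  assumes "a \<in> carrier R" "b \<in> carrier R" "b \<noteq> \<zero>"
  shows "fraction R a b = \<zero>\<^bsub>frac_field R\<^esub> \<longleftrightarrow> a = \<zero>"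
  using assms by (simp add: frac_field_zero fraction_eq_iff)

theorem field_frac_field: "field (frac_field R)"
proof -
  let ?Q = "frac_field R"
  note frac = frac_field_zero frac_field_one fraction_add fraction_mult fraction_closed
    integral_iff fraction_eq_iff
  have "abelian_group ?Q"
  proof (rule abelian_groupI)
    fix X Y assume "X \<in> carrier ?Q" "Y \<in> carrier ?Q"
    then show "X \<oplus>\<^bsub>?Q\<^esub> Y \<in> carrier ?Q" "X \<oplus>\<^bsub>?Q\<^esub> Y = Y \<oplus>\<^bsub>?Q\<^esub> X"
      by (auto elim!: frac_field_cases simp: frac m_ac a_ac)
  next
    fix X Y Z assume XYZ: "X \<in> carrier ?Q" "Y \<in> carrier ?Q" "Z \<in> carrier ?Q"
    obtain a b where ab: "a \<in> carrier R" "b \<in> carrier R" "b \<noteq> \<zero>" "X = fraction R a b"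
      using XYZ(1) by (rule frac_field_cases)
    obtain c d where cd: "c \<in> carrier R" "d \<in> carrier R" "d \<noteq> \<zero>" "Y = fraction R c d"
      using XYZ(2) by (rule frac_field_cases)
    obtain e f where ef: "e \<in> carrier R" "f \<in> carrier R" "f \<noteq> \<zero>" "Z = fraction R e f"
      using XYZ(3) by (rule frac_field_cases)
    note abc = ab cd ef
    have "(a \<otimes> d \<oplus> c \<otimes> b) \<otimes> f \<oplus> e \<otimes> (b \<otimes> d) = a \<otimes> (d \<otimes> f) \<oplus> (c \<otimes> f \<oplus> e \<otimes> d) \<otimes> b"
      using abc by (simp add: l_distr a_assoc) (simp add: m_ac)
    then show "(X \<oplus>\<^bsub>?Q\<^esub> Y) \<oplus>\<^bsub>?Q\<^esub> Z = X \<oplus>\<^bsub>?Q\<^esub> (Y \<oplus>\<^bsub>?Q\<^esub> Z)"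
      using abc by (simp add: fraction_add integral_iff m_assoc)
  next
    fix X assume "X \<in> carrier ?Q"
    then obtain a b where X: "a \<in> carrier R" "b \<in> carrier R" "b \<noteq> \<zero>" "X = fraction R a b"
      by (rule frac_field_cases)
    then show "\<zero>\<^bsub>?Q\<^esub> \<oplus>\<^bsub>?Q\<^esub> X = X"
      by (simp add: frac)
    have "(\<ominus> a) \<otimes> b \<oplus> a \<otimes> b = \<zero>"
      using X by (simp add: l_minus l_neg)
    then show "\<exists>Y\<in>carrier ?Q. Y \<oplus>\<^bsub>?Q\<^esub> X = \<zero>\<^bsub>?Q\<^esub>"
      using X by (intro bexI[of _ "fraction R (\<ominus> a) b"]) (auto simp: frac)
  qed (simp add: frac)
  moreover have "comm_monoid ?Q"
    by (rule comm_monoidI) (auto elim!: frac_field_cases simp: frac m_ac)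
  moreover have "(X \<oplus>\<^bsub>?Q\<^esub> Y) \<otimes>\<^bsub>?Q\<^esub> Z = X \<otimes>\<^bsub>?Q\<^esub> Z \<oplus>\<^bsub>?Q\<^esub> Y \<otimes>\<^bsub>?Q\<^esub> Z"
    if XYZ: "X \<in> carrier ?Q" "Y \<in> carrier ?Q" "Z \<in> carrier ?Q" for X Y Z
  proof -
    obtain a b where ab: "a \<in> carrier R" "b \<in> carrier R" "b \<noteq> \<zero>" "X = fraction R a b"
      using XYZ(1) by (rule frac_field_cases)
    obtain c d where cd: "c \<in> carrier R" "d \<in> carrier R" "d \<noteq> \<zero>" "Y = fraction R c d"
      using XYZ(2) by (rule frac_field_cases)
    obtain e f where ef: "e \<in> carrier R" "f \<in> carrier R" "f \<noteq> \<zero>" "Z = fraction R e f"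
      using XYZ(3) by (rule frac_field_cases)
    note abc = ab cd ef
    have "((a \<otimes> d \<oplus> c \<otimes> b) \<otimes> e) \<otimes> ((b \<otimes> f) \<otimes> (d \<otimes> f))
        = ((a \<otimes> e) \<otimes> (d \<otimes> f) \<oplus> (c \<otimes> e) \<otimes> (b \<otimes> f)) \<otimes> ((b \<otimes> d) \<otimes> f)"
      using abc by (simp add: l_distr) (simp add: m_ac)
    then show ?thesis
      using abc by (simp add: frac_field_zero fraction_add fraction_mult integral_iff fraction_eq_iff)
  qed
  ultimately interpret Q: cring ?Q
    by (intro cringI)
  show ?thesis
  proof (rule Q.cring_fieldI2)
    show "\<zero>\<^bsub>?Q\<^esub> \<noteq> \<one>\<^bsub>?Q\<^esub>"
      by (simp add: frac)
    fix X assume X: "X \<in> carrier ?Q" "X \<noteq> \<zero>\<^bsub>?Q\<^esub>"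
    then obtain a b where ab: "a \<in> carrier R" "b \<in> carrier R" "b \<noteq> \<zero>" "X = fraction R a b"
      by (elim frac_field_cases)
    with X have "a \<noteq> \<zero>"
      by (simp add: fraction_eq_zero_iff)
    with ab show "\<exists>Y\<in>carrier ?Q. X \<otimes>\<^bsub>?Q\<^esub> Y = \<one>\<^bsub>?Q\<^esub>"
      by (intro bexI[of _ "fraction R b a"]) (auto simp: frac m_ac)
  qed
qed

lemma of_base_ring_hom: "of_base R \<in> ring_hom R (frac_field R)"
  by (rule ring_hom_memI)
    (simp_all add: of_base_def fraction_closed fraction_mult fraction_add frac_field_one)

lemma of_base_eq_zero_iff:
  "a \<in> carrier R \<Longrightarrow> of_base R a = \<zero>\<^bsub>frac_field R\<^esub> \<longleftrightarrow> a = \<zero>"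
  by (simp add: of_base_def fraction_eq_zero_iff)

end

section \<open>Determinants and triangular expansions over a commutative ring\<close>

context cring
begin

lemma ring_det_closed:
  assumes "\<And>i j. i < k \<Longrightarrow> j < k \<Longrightarrow> M i j \<in> carrier R"
  shows "ring_det R k M \<in> carrier R"
proof -
  have "(\<Otimes>i\<in>{0..<k}. M i (\<sigma> i)) \<in> carrier R" if "\<sigma> permutes {0..<k}" for \<sigma>
    using permutes_in_image[OF that] assms by (intro finprod_closed) auto
  then show ?thesis
    unfolding ring_det_def by (intro finsum_closed) auto
qed

lemma ring_det_cong:
  assumes "\<And>i j. i < k \<Longrightarrow> j < k \<Longrightarrow> M i j = M' i j"
    and "\<And>i j. i < k \<Longrightarrow> j < k \<Longrightarrow> M' i j \<in> carrier R"
  shows "ring_det R k M = ring_det R k M'"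
proof -
  have "(\<Otimes>i\<in>{0..<k}. M i (\<sigma> i)) = (\<Otimes>i\<in>{0..<k}. M' i (\<sigma> i))" if "\<sigma> permutes {0..<k}" for \<sigma>
    using that permutes_in_image[OF that] assms by (intro finprod_cong') (auto)
  moreover have "(\<Otimes>i\<in>{0..<k}. M' i (\<sigma> i)) \<in> carrier R" if "\<sigma> permutes {0..<k}" for \<sigma>
    using that permutes_in_image[OF that] assms by (intro finprod_closed) (auto)
  ultimately show ?thesis
    unfolding ring_det_def by (intro finsum_cong') auto
qed

text \<open>Exchanging the two equal rows pairs every even permutation with an odd one that has the same
  product, so the terms cancel in pairs. This holds in every characteristic, where deducing it from
  \<open>det = - det\<close> would not.\<close>

lemma ring_det_equal_rows:
  assumes pq: "p < k" "q < k" "p \<noteq> q"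
    and eq: "\<And>j. j < k \<Longrightarrow> M p j = M q j"
    and M: "\<And>i j. i < k \<Longrightarrow> j < k \<Longrightarrow> M i j \<in> carrier R"
  shows "ring_det R k M = \<zero>"
proof -
  define \<tau> where "\<tau> = transpose p q"
  define P where "P \<sigma> = (\<Otimes>i\<in>{0..<k}. M i (\<sigma> i))" for \<sigma>
  define E where "E = {\<sigma>. \<sigma> permutes {0..<k} \<and> evenperm \<sigma>}"
  define T where "T \<sigma> = (if evenperm \<sigma> then \<one> else \<ominus> \<one>) \<otimes> P \<sigma>" for \<sigma>
  have \<tau>: "\<tau> permutes {0..<k}" "permutation \<tau>" "\<not> evenperm \<tau>"
    using pq by (auto simp: \<tau>_def permutes_swap_id permutation_swap_id evenperm_swap)
  have \<tau>\<tau>: "\<sigma> \<circ> \<tau> \<circ> \<tau> = \<sigma>" for \<sigma> :: "nat \<Rightarrow> nat"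
    by (simp add: \<tau>_def comp_assoc)
  have fin: "finite {\<sigma>. \<sigma> permutes {0..<k}}"
    by (simp add: finite_permutations)
  have Pc: "P \<sigma> \<in> carrier R" if "\<sigma> permutes {0..<k}" for \<sigma>
    unfolding P_def using that permutes_in_image[OF that] M by (intro finprod_closed) auto
  have Tc: "T \<sigma> \<in> carrier R" if "\<sigma> permutes {0..<k}" for \<sigma>
    using Pc[OF that] by (simp add: T_def)
  have odd_iff: "evenperm (\<sigma> \<circ> \<tau>) \<longleftrightarrow> \<not> evenperm \<sigma>" if "\<sigma> permutes {0..<k}" for \<sigma>
    using that \<tau> evenperm_comp[of \<sigma> \<tau>] permutation_permutes by blast
  have P\<tau>: "P (\<sigma> \<circ> \<tau>) = P \<sigma>" if \<sigma>: "\<sigma> permutes {0..<k}" for \<sigma>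
  proof -
    have M\<tau>: "M (\<tau> i) j = M i j" if "j < k" for i j
      using eq[OF that] by (simp add: \<tau>_def transpose_def)
    have \<sigma>k: "\<sigma> i < k" if "i < k" for i
      using permutes_in_image[OF \<sigma>, of i] that by simp
    have \<tau>k: "\<tau> i < k" if "i < k" for i
      using permutes_in_image[OF \<tau>(1), of i] that by simp
    have "P \<sigma> = (\<Otimes>i\<in>\<tau> ` {0..<k}. M i (\<sigma> i))"
      unfolding P_def using permutes_image[OF \<tau>(1)] by simp
    also have "\<dots> = (\<Otimes>i\<in>{0..<k}. M (\<tau> i) (\<sigma> (\<tau> i)))"
      by (rule finprod_reindex)
        (use M \<sigma>k \<tau>k permutes_inj_on[OF \<tau>(1)] in auto)
    also have "\<dots> = P (\<sigma> \<circ> \<tau>)"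
      unfolding P_def by (rule finprod_cong') (use M M\<tau> \<sigma>k \<tau>k in auto)
    finally show ?thesis ..
  qed
  have split: "{\<sigma>. \<sigma> permutes {0..<k}} = E \<union> (\<lambda>\<sigma>. \<sigma> \<circ> \<tau>) ` E" (is "?L = ?R")
  proof
    show "?R \<subseteq> ?L"
      using \<tau> by (auto simp: E_def permutes_compose)
    show "?L \<subseteq> ?R"
    proof
      fix \<sigma> assume "\<sigma> \<in> ?L"
      then have \<sigma>: "\<sigma> permutes {0..<k}" by simp
      show "\<sigma> \<in> ?R"
      proof (cases "evenperm \<sigma>")
        case False
        have "\<sigma> \<circ> \<tau> \<in> E"
          using \<sigma> \<tau> False odd_iff by (simp add: E_def permutes_compose)
        then show ?thesis
          using \<tau>\<tau>[of \<sigma>] by (metis UnI2 imageI)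
      qed (use \<sigma> in \<open>simp add: E_def\<close>)
    qed
  qed
  have inj: "inj_on (\<lambda>\<sigma>. \<sigma> \<circ> \<tau>) E"
    by (rule inj_onI) (metis \<tau>\<tau>)
  have disj: "E \<inter> (\<lambda>\<sigma>. \<sigma> \<circ> \<tau>) ` E = {}"
    using odd_iff by (auto simp: E_def)
  have Ep: "\<sigma> permutes {0..<k}" "\<sigma> \<circ> \<tau> permutes {0..<k}" if "\<sigma> \<in> E" for \<sigma>
    using that \<tau> by (auto simp: E_def permutes_compose)
  have "ring_det R k M = finsum R T {\<sigma>. \<sigma> permutes {0..<k}}"
    unfolding ring_det_def T_def P_def by simp
  also have "\<dots> = finsum R T E \<oplus> finsum R T ((\<lambda>\<sigma>. \<sigma> \<circ> \<tau>) ` E)"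
    unfolding split using disj Tc Ep fin split
    by (intro finsum_Un_disjoint) auto
  also have "finsum R T ((\<lambda>\<sigma>. \<sigma> \<circ> \<tau>) ` E) = (\<Oplus>\<sigma>\<in>E. T (\<sigma> \<circ> \<tau>))"
    using inj Tc Ep by (intro finsum_reindex) auto
  also have "finsum R T E \<oplus> (\<Oplus>\<sigma>\<in>E. T (\<sigma> \<circ> \<tau>)) = (\<Oplus>\<sigma>\<in>E. T \<sigma> \<oplus> T (\<sigma> \<circ> \<tau>))"
    using Tc Ep by (intro finsum_addf[symmetric]) auto
  also have "\<dots> = (\<Oplus>\<sigma>\<in>E. \<zero>)"
  proof (rule finsum_cong')
    fix \<sigma> assume \<sigma>: "\<sigma> \<in> E"
    then show "T \<sigma> \<oplus> T (\<sigma> \<circ> \<tau>) = \<zero>"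
      using Ep[OF \<sigma>] Pc odd_iff P\<tau> by (simp add: T_def E_def l_minus r_neg)
  qed auto
  finally show ?thesis
    by simp
qed

text \<open>Linearity in the first row, which is where the expansion of \<open>F\<close> enters.\<close>

lemma ring_det_row0_combination:
  assumes k: "0 < k" and fin: "finite A"
    and D: "\<And>m. m \<in> A \<Longrightarrow> D m \<in> carrier R"
    and B: "\<And>m j. m \<in> A \<Longrightarrow> j < k \<Longrightarrow> B m j \<in> carrier R"
    and M: "\<And>i j. 0 < i \<Longrightarrow> i < k \<Longrightarrow> j < k \<Longrightarrow> M i j \<in> carrier R"
  shows "ring_det R k (\<lambda>i j. if i = 0 then (\<Oplus>m\<in>A. D m \<otimes> B m j) else M i j)
    = (\<Oplus>m\<in>A. D m \<otimes> ring_det R k (\<lambda>i j. if i = 0 then B m j else M i j))"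
proof -
  define S where "S = {\<sigma>. \<sigma> permutes {0..<k}}"
  define s where "s \<sigma> = (if evenperm \<sigma> then \<one> else \<ominus> \<one>)" for \<sigma> :: "nat \<Rightarrow> nat"
  define W where "W \<sigma> = (\<Otimes>i\<in>{1..<k}. M i (\<sigma> i))" for \<sigma>
  have S: "\<sigma> i < k" if "\<sigma> \<in> S" "i < k" for \<sigma> i
    using that permutes_in_image[of \<sigma> "{0..<k}" i] by (simp add: S_def)
  have sc: "s \<sigma> \<in> carrier R" for \<sigma>
    by (simp add: s_def)
  have W: "W \<sigma> \<in> carrier R" if "\<sigma> \<in> S" for \<sigma>
    unfolding W_def using that S M by (intro finprod_closed) auto
  have det: "ring_det R k (\<lambda>i j. if i = 0 then b j else M i j)
      = (\<Oplus>\<sigma>\<in>S. (s \<sigma> \<otimes> W \<sigma>) \<otimes> b (\<sigma> 0))"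
    if b: "\<And>j. j < k \<Longrightarrow> b j \<in> carrier R" for b
  proof -
    have "(\<Otimes>i\<in>{0..<k}. if i = 0 then b (\<sigma> i) else M i (\<sigma> i)) = b (\<sigma> 0) \<otimes> W \<sigma>"
      if \<sigma>: "\<sigma> \<in> S" for \<sigma>
    proof -
      have "{0..<k} = insert 0 {1..<k}"
        using k by auto
      moreover have "(\<Otimes>i\<in>{1..<k}. if i = 0 then b (\<sigma> i) else M i (\<sigma> i)) = W \<sigma>"
        unfolding W_def using S[OF \<sigma>] M by (intro finprod_cong') auto
      ultimately show ?thesis
        using S[OF \<sigma>] b M k by (simp add: Pi_def)
    qed
    then show ?thesis
      unfolding ring_det_def S_def[symmetric] s_def[symmetric]
      using b S[OF _ k] W sc by (intro finsum_cong') (auto simp: m_ac)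
  qed
  have row: "(\<Oplus>m\<in>A. D m \<otimes> B m j) \<in> carrier R" if "j < k" for j
    using that D B by (intro finsum_closed) auto
  have swap: "(\<Oplus>\<sigma>\<in>S. (s \<sigma> \<otimes> W \<sigma>) \<otimes> (\<Oplus>m\<in>A. D m \<otimes> B m (\<sigma> 0)))
      = (\<Oplus>m\<in>A. D m \<otimes> (\<Oplus>\<sigma>\<in>S. (s \<sigma> \<otimes> W \<sigma>) \<otimes> B m (\<sigma> 0)))"
    using fin D B
  proof (induction A rule: finite_induct)
    case empty
    then show ?case
      using W sc by (auto intro!: add.finprod_one_eqI)
  next
    case (insert a A)
    have inA: "(\<Oplus>m\<in>A. D m \<otimes> B m (\<sigma> 0)) \<in> carrier R" if "\<sigma> \<in> S" for \<sigma>
      using insert that S[OF _ k] by (intro finsum_closed) auto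
    have fS: "finite S"
      by (simp add: S_def finite_permutations)
    have da: "D a \<in> carrier R" and ba: "\<And>\<sigma>. \<sigma> \<in> S \<Longrightarrow> B a (\<sigma> 0) \<in> carrier R"
      using insert.prems S[OF _ k] by auto
    have "(\<Oplus>\<sigma>\<in>S. (s \<sigma> \<otimes> W \<sigma>) \<otimes> (\<Oplus>m\<in>insert a A. D m \<otimes> B m (\<sigma> 0)))
      = (\<Oplus>\<sigma>\<in>S. D a \<otimes> ((s \<sigma> \<otimes> W \<sigma>) \<otimes> B a (\<sigma> 0)) \<oplus>
              (s \<sigma> \<otimes> W \<sigma>) \<otimes> (\<Oplus>m\<in>A. D m \<otimes> B m (\<sigma> 0)))"
    proof (rule finsum_cong')
      fix \<sigma> assume \<sigma>: "\<sigma> \<in> S"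
      have "(\<Oplus>m\<in>insert a A. D m \<otimes> B m (\<sigma> 0)) = D a \<otimes> B a (\<sigma> 0) \<oplus> (\<Oplus>m\<in>A. D m \<otimes> B m (\<sigma> 0))"
        using insert \<sigma> S[OF _ k] by (intro finsum_insert) auto
      then show "(s \<sigma> \<otimes> W \<sigma>) \<otimes> (\<Oplus>m\<in>insert a A. D m \<otimes> B m (\<sigma> 0)) =
          D a \<otimes> ((s \<sigma> \<otimes> W \<sigma>) \<otimes> B a (\<sigma> 0)) \<oplus> (s \<sigma> \<otimes> W \<sigma>) \<otimes> (\<Oplus>m\<in>A. D m \<otimes> B m (\<sigma> 0))"
        using da ba[OF \<sigma>] W[OF \<sigma>] sc[of \<sigma>] inA[OF \<sigma>] by (simp add: r_distr m_ac)
    qed (use da ba W sc inA in auto)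
    also have "\<dots> = (\<Oplus>\<sigma>\<in>S. D a \<otimes> ((s \<sigma> \<otimes> W \<sigma>) \<otimes> B a (\<sigma> 0))) \<oplus>
        (\<Oplus>\<sigma>\<in>S. (s \<sigma> \<otimes> W \<sigma>) \<otimes> (\<Oplus>m\<in>A. D m \<otimes> B m (\<sigma> 0)))"
      using da ba W sc inA by (intro finsum_addf) auto
    also have "(\<Oplus>\<sigma>\<in>S. D a \<otimes> ((s \<sigma> \<otimes> W \<sigma>) \<otimes> B a (\<sigma> 0)))
        = D a \<otimes> (\<Oplus>\<sigma>\<in>S. (s \<sigma> \<otimes> W \<sigma>) \<otimes> B a (\<sigma> 0))"
      using da ba W sc fS by (intro finsum_rdistr[symmetric]) auto
    also have "(\<Oplus>\<sigma>\<in>S. (s \<sigma> \<otimes> W \<sigma>) \<otimes> (\<Oplus>m\<in>A. D m \<otimes> B m (\<sigma> 0)))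
        = (\<Oplus>m\<in>A. D m \<otimes> (\<Oplus>\<sigma>\<in>S. (s \<sigma> \<otimes> W \<sigma>) \<otimes> B m (\<sigma> 0)))"
      by (rule insert.IH) (use insert.prems in auto)
    also have "D a \<otimes> (\<Oplus>\<sigma>\<in>S. (s \<sigma> \<otimes> W \<sigma>) \<otimes> B a (\<sigma> 0)) \<oplus> \<dots>
        = (\<Oplus>m\<in>insert a A. D m \<otimes> (\<Oplus>\<sigma>\<in>S. (s \<sigma> \<otimes> W \<sigma>) \<otimes> B m (\<sigma> 0)))"
      using insert.hyps insert.prems W sc S[OF _ k]
      by (intro finsum_insert[symmetric]) (auto intro!: m_closed finsum_closed)
    finally show ?case .
  qed
  have "(\<Oplus>m\<in>A. D m \<otimes> (\<Oplus>\<sigma>\<in>S. (s \<sigma> \<otimes> W \<sigma>) \<otimes> B m (\<sigma> 0)))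
    = (\<Oplus>m\<in>A. D m \<otimes> ring_det R k (\<lambda>i j. if i = 0 then B m j else M i j))"
    using D B W sc S[OF _ k]
    by (intro finsum_cong') (auto simp: det[OF B] intro!: m_closed finsum_closed)
  then show ?thesis
    using det[of "\<lambda>j. \<Oplus>m\<in>A. D m \<otimes> B m j", OF row] swap by simp
qed

end

text \<open>The cycle \<open>0 \<mapsto> k - 1\<close>, \<open>i \<mapsto> i - 1\<close>, built from transpositions so that its parity can be
  computed by recursion.\<close>

fun step_down_cycle :: "nat \<Rightarrow> nat \<Rightarrow> nat" where
  "step_down_cycle 0 = id"
| "step_down_cycle (Suc k) = transpose (k - 1) k \<circ> step_down_cycle k"

lemma step_down_cycle_apply:
  assumes "0 < k"
  shows "step_down_cycle k i = (if i = 0 then k - 1 else if i < k then i - 1 else i)"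
  using assms
proof (induction k)
  case (Suc k)
  then show ?case
    by (cases "k = 0") (auto simp: transpose_def)
qed simp

lemma step_down_cycle_permutes: "step_down_cycle k permutes {0..<k}"
proof (induction k)
  case (Suc k)
  have "step_down_cycle k permutes {0..<Suc k}"
    using Suc by (rule permutes_subset) auto
  then show ?case
    unfolding step_down_cycle.simps by (rule permutes_compose) (auto intro!: permutes_swap_id)
qed (simp add: permutes_id id_def[symmetric])

lemma evenperm_step_down_cycle: "0 < k \<Longrightarrow> evenperm (step_down_cycle k) \<longleftrightarrow> odd k"
proof (induction k)
  case (Suc k)
  have "permutation (step_down_cycle k)"
    using step_down_cycle_permutes permutation_permutes by blast
  then have "evenperm (step_down_cycle (Suc k)) \<longleftrightarrow>
      evenperm (transpose (k - 1) k) = evenperm (step_down_cycle k)"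
    unfolding step_down_cycle.simps by (simp add: evenperm_comp permutation_swap_id del: o_apply)
  with Suc show ?case
    by (cases "k = 0") (auto simp add: evenperm_swap simp del: step_down_cycle.simps, simp)
qed simp

text \<open>Going down from \<open>k - 1\<close>, each value \<open>\<sigma> i \<ge> i - 1\<close> is forced to be \<open>i - 1\<close>: all larger values
  are already taken by \<open>0\<close> and by the larger arguments.\<close>

lemma eq_step_down_cycle:
  assumes \<sigma>: "\<sigma> permutes {0..<k}" and k: "0 < k" and last: "\<sigma> 0 = k - 1"
    and ge: "\<And>i. 0 < i \<Longrightarrow> i < k \<Longrightarrow> i - 1 \<le> \<sigma> i"
  shows "\<sigma> = step_down_cycle k"
proof -
  have down: "\<sigma> (k - d) = k - d - 1" if "0 < d" "d < k" for d
    using that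
  proof (induction d rule: less_induct)
    case (less d)
    let ?i = "k - d"
    have "\<sigma> ?i < k"
      using permutes_in_image[OF \<sigma>, of ?i] less.prems by simp
    moreover have lower: "?i - 1 \<le> \<sigma> ?i"
      using less.prems by (intro ge) auto
    moreover have "\<sigma> ?i \<noteq> v" if v: "k - d \<le> v" "v < k" for v
    proof
      assume eq: "\<sigma> ?i = v"
      have "\<exists>i. i \<noteq> ?i \<and> \<sigma> i = v"
      proof (cases "v = k - 1")
        case True
        then show ?thesis
          using last less.prems by (intro exI[of _ 0]) auto
      next
        case False
        then have "\<sigma> (k - (k - 1 - v)) = k - (k - 1 - v) - 1"
          using v less.prems by (intro less.IH) auto
        then show ?thesis
          using False v less.prems by (intro exI[of _ "Suc v"]) auto
      qed
      then show False
        using eq permutes_inj[OF \<sigma>] by (metis injD)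
    qed
    ultimately have "\<not> k - d \<le> \<sigma> ?i"
      by blast
    with lower show ?case
      by linarith
  qed
  show ?thesis
  proof
    fix i
    consider "i = 0" | "0 < i" "i < k" | "k \<le> i"
      by linarith
    then show "\<sigma> i = step_down_cycle k i"
    proof cases
      case 2
      then show ?thesis
        using down[of "k - i"] k by (simp add: step_down_cycle_apply)
    next
      case 3
      then show ?thesis
        using permutes_not_in[OF \<sigma>, of i] k by (simp add: step_down_cycle_apply)
    qed (use k last in \<open>simp add: step_down_cycle_apply\<close>)
  qed
qed

context cring
begin

text \<open>A term of the determinant survives only if its permutation avoids all entries known to vanish,
  and the step-down cycle is the only such permutation. Its product is \<open>\<one>\<close>.\<close>

lemma ring_det_subdiagonal_one:
  assumes k: "0 < k"
    and row0: "\<And>j. j < k \<Longrightarrow> M 0 j = (if j = k - 1 then \<one> else \<zero>)"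
    and diag: "\<And>i. 0 < i \<Longrightarrow> i < k \<Longrightarrow> M i (i - 1) = \<one>"
    and low: "\<And>i j. 0 < i \<Longrightarrow> i < k \<Longrightarrow> j < i - 1 \<Longrightarrow> M i j = \<zero>"
    and M: "\<And>i j. i < k \<Longrightarrow> j < k \<Longrightarrow> M i j \<in> carrier R"
  shows "ring_det R k M = (\<ominus> \<one>) [^] (k - 1)"
proof -
  let ?c = "step_down_cycle k"
  define S where "S = {\<sigma>. \<sigma> permutes {0..<k}}"
  define s where "s \<sigma> = (if evenperm \<sigma> then \<one> else \<ominus> \<one>)" for \<sigma> :: "nat \<Rightarrow> nat"
  define P where "P \<sigma> = (\<Otimes>i\<in>{0..<k}. M i (\<sigma> i))" for \<sigma>
  have S: "\<sigma> i < k" if "\<sigma> \<in> S" "i < k" for \<sigma> i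
    using that permutes_in_image[of \<sigma> "{0..<k}" i] by (simp add: S_def)
  have sc: "s \<sigma> \<in> carrier R" for \<sigma>
    by (simp add: s_def)
  have Pc: "P \<sigma> \<in> carrier R" if "\<sigma> \<in> S" for \<sigma>
    unfolding P_def using that S M by (intro finprod_closed) auto
  have P0: "P \<sigma> = \<zero>" if \<sigma>: "\<sigma> \<in> S" "\<sigma> \<noteq> ?c" for \<sigma>
  proof -
    have "\<exists>i<k. M i (\<sigma> i) = \<zero>"
    proof (rule ccontr)
      assume "\<not> (\<exists>i<k. M i (\<sigma> i) = \<zero>)"
      then have nz: "M i (\<sigma> i) \<noteq> \<zero>" if "i < k" for i
        using that by blast
      have "\<sigma> 0 = k - 1"
        using nz[OF k] row0 S[OF \<sigma>(1) k] by metis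
      moreover have "i - 1 \<le> \<sigma> i" if "0 < i" "i < k" for i
        using nz[OF that(2)] low[OF that] not_less by metis
      ultimately show False
        using eq_step_down_cycle[of \<sigma> k] \<sigma> k by (simp add: S_def)
    qed
    then obtain i where i: "i < k" "M i (\<sigma> i) = \<zero>"
      by blast
    have "P \<sigma> = (\<Otimes>i\<in>insert i ({0..<k} - {i}). M i (\<sigma> i))"
      unfolding P_def using i by (intro arg_cong[of _ _ "finprod R (\<lambda>i. M i (\<sigma> i))"]) auto
    also have "\<dots> = M i (\<sigma> i) \<otimes> (\<Otimes>i\<in>{0..<k} - {i}. M i (\<sigma> i))"
      using M S[OF \<sigma>(1)] i by (intro finprod_insert) auto
    finally have "P \<sigma> = M i (\<sigma> i) \<otimes> (\<Otimes>i\<in>{0..<k} - {i}. M i (\<sigma> i))" .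
    moreover have "(\<Otimes>i\<in>{0..<k} - {i}. M i (\<sigma> i)) \<in> carrier R"
      using M S[OF \<sigma>(1)] by (intro finprod_closed) auto
    ultimately show ?thesis
      using i by simp
  qed
  have cS: "?c \<in> S"
    by (simp add: S_def step_down_cycle_permutes)
  have Pc1: "P ?c = \<one>"
    unfolding P_def
  proof (rule finprod_one_eqI)
    fix i assume "i \<in> {0..<k}"
    then show "M i (?c i) = \<one>"
      using k row0[of "k - 1"] diag by (auto simp: step_down_cycle_apply)
  qed
  have "ring_det R k M = (\<Oplus>\<sigma>\<in>S. if ?c = \<sigma> then s \<sigma> \<otimes> P \<sigma> else \<zero>)"
    unfolding ring_det_def S_def[symmetric] s_def[symmetric] P_def[symmetric]
    using P0 Pc sc by (intro finsum_cong') auto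
  also have "\<dots> = s ?c \<otimes> P ?c"
    using cS Pc sc by (intro finsum_singleton) (auto simp: S_def finite_permutations)
  also have "\<dots> = s ?c"
    using Pc1 sc by simp
  also have "\<dots> = (\<ominus> \<one>) [^] (k - 1)"
  proof -
    have "(\<ominus> \<one>) [^] m = (if even m then \<one> else \<ominus> \<one>)" for m :: nat
      by (induction m) (auto simp: l_minus)
    then show ?thesis
      using k by (simp add: s_def evenperm_step_down_cycle)
  qed
  finally show ?thesis .
qed

text \<open>Cramer's rule for a system with upper unitriangular matrix. Row \<open>0\<close> of \<open>a\<close> is the right-hand side
  and is expanded linearly in the rows \<open>1, \<dots>, N\<close>; the determinant is shifted by one column because
  columns are counted from \<open>1\<close> in \<open>a\<close> and from \<open>0\<close> in \<open>ring_det\<close>.\<close>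

lemma triangular_expansion_coefficient:
  assumes k: "k \<in> {1..N}"
    and D: "D \<in> {1..N} \<rightarrow> carrier R"
    and a: "\<And>i j. i \<in> {1..N} \<Longrightarrow> j \<in> {1..N} \<Longrightarrow> a i j \<in> carrier R"
    and upper: "\<And>i j. i \<in> {1..N} \<Longrightarrow> j \<in> {1..N} \<Longrightarrow> j < i \<Longrightarrow> a i j = \<zero>"
    and diag: "\<And>i. i \<in> {1..N} \<Longrightarrow> a i i = \<one>"
    and f: "\<And>j. j \<in> {1..N} \<Longrightarrow> a 0 j = (\<Oplus>m\<in>{1..N}. D m \<otimes> a m j)"
  shows "D k = (\<ominus> \<one>) [^] (k - 1) \<otimes> ring_det R k (\<lambda>i j. a i (j + 1))"
proof -
  define d where "d m = ring_det R k (\<lambda>i j. if i = 0 then a m (j + 1) else a i (j + 1))" for m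
  have Dc: "D m \<in> carrier R" if "m \<in> {1..N}" for m
    using D that by auto
  have dc: "d m \<in> carrier R" if "m \<in> {1..N}" for m
    unfolding d_def using that k a by (intro ring_det_closed) auto
  have k0: "0 < k" "k \<le> N"
    using k by auto
  have "ring_det R k (\<lambda>i j. a i (j + 1)) =
      ring_det R k (\<lambda>i j. if i = 0 then (\<Oplus>m\<in>{1..N}. D m \<otimes> a m (j + 1)) else a i (j + 1))"
    using k f a Dc by (intro ring_det_cong) (auto intro!: finsum_closed)
  also have "\<dots> = (\<Oplus>m\<in>{1..N}. D m \<otimes> d m)"
    unfolding d_def using k a Dc by (intro ring_det_row0_combination) auto
  also have "\<dots> = (\<Oplus>m\<in>{1..N}. if k = m then D m \<otimes> d m else \<zero>)"
  proof (rule finsum_cong')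
    fix m assume m: "m \<in> {1..N}"
    show "D m \<otimes> d m = (if k = m then D m \<otimes> d m else \<zero>)"
    proof (cases m k rule: linorder_cases)
      case less
      have "d m = \<zero>"
        unfolding d_def using less m k a by (intro ring_det_equal_rows[of 0 k m]) auto
      then show ?thesis
        using less Dc[OF m] by simp
    next
      case greater
      \<comment> \<open>The row of \<open>m > k\<close> vanishes in the first \<open>k\<close> columns: it is the empty combination.\<close>
      have "d m = ring_det R k (\<lambda>i j. if i = 0 then (\<Oplus>m\<in>({} :: nat set). \<one> \<otimes> \<one>) else a i (j + 1))"
        unfolding d_def using greater m k a upper
        by (intro ring_det_cong) (auto)
      also have "\<dots> = \<zero>"
        using k a by (subst ring_det_row0_combination) auto
      finally show ?thesis
        using greater Dc[OF m] by simp
    qed auto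
  qed (use Dc dc in auto)
  also have "\<dots> = D k \<otimes> d k"
    using k Dc dc by (intro finsum_singleton) auto
  also have "d k = (\<ominus> \<one>) [^] (k - 1)"
    unfolding d_def using k0 a diag upper
    by (intro ring_det_subdiagonal_one) (auto simp: le_less_Suc_eq)
  finally have "ring_det R k (\<lambda>i j. a i (j + 1)) = D k \<otimes> (\<ominus> \<one>) [^] (k - 1)" .
  moreover have "(\<ominus> \<one>) [^] (k - 1) \<otimes> (\<ominus> \<one>) [^] (k - 1) = \<one>"
    using nat_pow_distrib[of "\<ominus> \<one>" "\<ominus> \<one>" "k - 1"] by (simp add: l_minus)
  ultimately show ?thesis
    using Dc[OF k] by (metis add.inv_closed m_comm m_assoc nat_pow_closed one_closed r_one)
qed

end

section \<open>Extension of scalars and linear extensions\<close>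

lemma module_algebra_of_hom:
  assumes "ring_hom_cring R B f"
  shows "module R (algebra_of_hom f B)"
proof -
  interpret ring_hom_cring R B f by fact
  show ?thesis
  proof (rule moduleI)
    show "cring R"
      by (rule R.is_cring)
    show "abelian_group (algebra_of_hom f B)"
      by (rule abelian_groupI)
        (auto simp: algebra_of_hom_def S.a_ac S.l_neg intro: bexI[of _ "\<ominus>\<^bsub>B\<^esub> _"])
  qed (auto simp: algebra_of_hom_def S.l_distr S.r_distr S.m_assoc)
qed

text \<open>The tensor product \<open>K \<otimes>\<^sub>R N\<close> of an \<open>R\<close>-module \<open>N\<close> with an \<open>R\<close>-algebra \<open>\<rho> : R \<rightarrow> K\<close>, viewed as a
  \<open>K\<close>-module: an abelian group of cosets on which \<open>K\<close> acts through the left factor.\<close>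

locale base_change =
  base: ring_hom_cring R K \<rho> + N: module R N
  for R (structure) and K (structure) and \<rho> and N (structure)
begin

abbreviation M where "M \<equiv> algebra_of_hom \<rho> K"
abbreviation free where "free \<equiv> tensor_free M N"
abbreviation null where "null \<equiv> tensor_null R M N"
abbreviation cls where "cls \<equiv> tensor_class R M N"
abbreviation T where "T \<equiv> tensor_algebra R M N"

lemma carrier_free: "u \<in> carrier free \<longleftrightarrow> Poly_Mapping.keys u \<subseteq> carrier K \<times> carrier N"
  by (simp add: tensor_free_def algebra_of_hom_def)

lemma mult_free: "u \<otimes>\<^bsub>free\<^esub> v = u + v"
  by (simp add: tensor_free_def)

lemma comm_group_free: "comm_group free"
  by (simp add: tensor_free_def abelian_free_Abelian_group)

lemma group_free: "group free"
  using comm_group_free by (simp add: comm_group_def)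

lemma add_in_free: "u \<in> carrier free \<Longrightarrow> v \<in> carrier free \<Longrightarrow> u + v \<in> carrier free"
  using keys_add[of u v] unfolding carrier_free by blast

lemma diff_in_free: "u \<in> carrier free \<Longrightarrow> v \<in> carrier free \<Longrightarrow> u - v \<in> carrier free"
  using keys_diff[of u v] unfolding carrier_free by blast

lemma frag_of_in_free: "q \<in> carrier K \<Longrightarrow> x \<in> carrier N \<Longrightarrow> frag_of (q, x) \<in> carrier free"
  by (simp add: carrier_free)

lemma M_simps: "carrier M = carrier K" "a \<oplus>\<^bsub>M\<^esub> b = a \<oplus>\<^bsub>K\<^esub> b" "a \<otimes>\<^bsub>M\<^esub> b = a \<otimes>\<^bsub>K\<^esub> b"
    "r \<odot>\<^bsub>M\<^esub> a = \<rho> r \<otimes>\<^bsub>K\<^esub> a"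
  by (simp_all add: algebra_of_hom_def)

lemma relator_cases:
  assumes "u \<in> tensor_relators R M N"
  obtains (add_left) m m' x where "m \<in> carrier K" "m' \<in> carrier K" "x \<in> carrier N"
      "u = frag_of (m \<oplus>\<^bsub>K\<^esub> m', x) - frag_of (m, x) - frag_of (m', x)"
    | (add_right) m x x' where "m \<in> carrier K" "x \<in> carrier N" "x' \<in> carrier N"
      "u = frag_of (m, x \<oplus>\<^bsub>N\<^esub> x') - frag_of (m, x) - frag_of (m, x')"
    | (balance) r m x where "r \<in> carrier R" "m \<in> carrier K" "x \<in> carrier N"
      "u = frag_of (\<rho> r \<otimes>\<^bsub>K\<^esub> m, x) - frag_of (m, r \<odot>\<^bsub>N\<^esub> x)"
  using assms unfolding tensor_relators_def M_simps
proof (elim UnE CollectE exE conjE)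
  fix m m' x
  assume "u = frag_of (m \<oplus>\<^bsub>K\<^esub> m', x) - frag_of (m, x) - frag_of (m', x)"
    "m \<in> carrier K" "m' \<in> carrier K" "x \<in> carrier N"
  then show thesis
    by (intro add_left[of m m' x])
next
  fix m x x'
  assume "u = frag_of (m, x \<oplus>\<^bsub>N\<^esub> x') - frag_of (m, x) - frag_of (m, x')"
    "m \<in> carrier K" "x \<in> carrier N" "x' \<in> carrier N"
  then show thesis
    by (intro add_right[of m x x'])
next
  fix r m x
  assume "u = frag_of (\<rho> r \<otimes>\<^bsub>K\<^esub> m, x) - frag_of (m, r \<odot>\<^bsub>N\<^esub> x)"
    "r \<in> carrier R" "m \<in> carrier K" "x \<in> carrier N"
  then show thesis
    by (intro balance[of r m x])
qed

lemma relatorI: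
  shows "\<lbrakk>m \<in> carrier K; m' \<in> carrier K; x \<in> carrier N\<rbrakk>
      \<Longrightarrow> frag_of (m \<oplus>\<^bsub>K\<^esub> m', x) - frag_of (m, x) - frag_of (m', x) \<in> tensor_relators R M N"
    and "\<lbrakk>m \<in> carrier K; x \<in> carrier N; x' \<in> carrier N\<rbrakk>
      \<Longrightarrow> frag_of (m, x \<oplus>\<^bsub>N\<^esub> x') - frag_of (m, x) - frag_of (m, x') \<in> tensor_relators R M N"
    and "\<lbrakk>r \<in> carrier R; m \<in> carrier K; x \<in> carrier N\<rbrakk>
      \<Longrightarrow> frag_of (\<rho> r \<otimes>\<^bsub>K\<^esub> m, x) - frag_of (m, r \<odot>\<^bsub>N\<^esub> x) \<in> tensor_relators R M N"
  unfolding tensor_relators_def M_simps by blast+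

lemma relators_in_free: "tensor_relators R M N \<subseteq> carrier free"
  by (rule subsetI, erule relator_cases) (auto intro!: diff_in_free frag_of_in_free)

lemma subgroup_null: "subgroup null free"
  unfolding tensor_null_def
  by (rule group.generate_is_subgroup[OF group_free relators_in_free])

lemma normal_null: "null \<lhd> free"
  by (rule comm_group.subgroup_imp_normal[OF comm_group_free subgroup_null])

text \<open>Membership in the subgroup generated by the relators, with all intermediate elements known to lie
  in the free group, so that additive maps can be followed through the generation.\<close>

lemma null_induct [consumes 1, case_names relator zero minus add]:
  assumes "u \<in> null"
    and rel: "\<And>u. u \<in> tensor_relators R M N \<Longrightarrow> P u"
    and "P 0"
    and minus: "\<And>u. u \<in> carrier free \<Longrightarrow> P u \<Longrightarrow> P (- u)"
    and add: "\<And>u v. \<lbrakk>u \<in> carrier free; v \<in> carrier free; P u; P v\<rbrakk> \<Longrightarrow> P (u + v)"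
  shows "P u"
proof -
  have "u \<in> carrier free \<and> P u"
    using assms(1) unfolding tensor_null_def
  proof (induction u rule: generate.induct)
    case one
    then show ?case
      using \<open>P 0\<close> by (simp add: tensor_free_def)
  next
    case (incl h)
    then show ?case
      using relators_in_free rel by blast
  next
    case (inv h)
    then have "h \<in> carrier free" "P h"
      using relators_in_free rel by blast+
    then show ?case
      using minus by (simp add: tensor_free_def)
  next
    case (eng u v)
    then show ?case
      using add add_in_free by (simp add: mult_free)
  qed
  then show ?thesis ..
qed

lemma class_add:
  assumes "u \<in> carrier free" "v \<in> carrier free"
  shows "cls u \<oplus>\<^bsub>T\<^esub> cls v = cls (u + v)"
  using normal.rcos_sum[OF normal_null assms]
  by (simp add: tensor_algebra_def tensor_class_def mult_free)

lemma mem_class: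
  assumes "u \<in> carrier free" "v \<in> cls u"
  obtains z where "z \<in> null" "v = z + u"
  using assms by (auto simp: tensor_class_def r_coset_def mult_free)

lemma in_class_self: "u \<in> carrier free \<Longrightarrow> u \<in> cls u"
  unfolding tensor_class_def
  by (rule group.rcos_self[OF group_free _ subgroup_null])

lemma class_eqI:
  assumes "u \<in> carrier free" "z \<in> null"
  shows "cls (z + u) = cls u"
proof -
  have "z + u \<in> cls u"
    using assms by (auto simp: tensor_class_def r_coset_def mult_free)
  then show ?thesis
    unfolding tensor_class_def
    using group.repr_independence[OF group_free _ assms(1) subgroup_null]
    by metis
qed

lemma class_closed: "u \<in> carrier free \<Longrightarrow> cls u \<in> carrier T"
  by (auto simp: tensor_algebra_def FactGroup_def RCOSETS_def tensor_class_def)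

lemma class_cases:
  assumes "X \<in> carrier T"
  obtains u where "u \<in> carrier free" "X = cls u"
  using assms by (auto simp: tensor_algebra_def FactGroup_def RCOSETS_def tensor_class_def)

lemma abelian_group_T: "abelian_group T"
proof -
  interpret Q: comm_group "free Mod null"
    by (rule comm_group.abelian_FactGroup[OF comm_group_free subgroup_null])
  show ?thesis
    by (rule abelian_groupI)
      (use Q.m_closed Q.m_assoc Q.m_comm Q.l_inv Q.inv_closed Q.l_one Q.one_closed in
        \<open>auto simp: tensor_algebra_def simp del: mult_FactGroup one_FactGroup intro: Q.m_comm\<close>)
qed

text \<open>The lift of multiplication by the scalar \<open>q\<close> to formal sums of pairs.\<close>

definition scale where
  "scale q u = frag_extend (\<lambda>(m, x). frag_of (q \<otimes>\<^bsub>K\<^esub> m, x)) u"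

lemma scale_simps: "scale q (u + v) = scale q u + scale q v" "scale q (u - v) = scale q u - scale q v"
  "scale q (- u) = - scale q u"  "scale q 0 = 0" "scale q (frag_of (m, x)) = frag_of (q \<otimes>\<^bsub>K\<^esub> m, x)"
  by (simp_all add: scale_def frag_extend_add frag_extend_diff frag_extend_minus)

lemma scale_closed:
  assumes q: "q \<in> carrier K" and "u \<in> carrier free"
  shows "scale q u \<in> carrier free"
  using assms(2) unfolding carrier_free
proof (induction u rule: frag_induction)
  case (one p)
  then show ?case
    using q by (cases p) (auto simp: scale_simps)
next
  case (diff a b)
  then show ?case
    using keys_diff[of "scale q a" "scale q b"] unfolding scale_simps by blast
qed (simp add: scale_simps)

text \<open>Multiplication by a scalar of \<open>K\<close> maps each relator to a relator, hence acts on the quotient.\<close>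

lemma scale_null:
  assumes q: "q \<in> carrier K" and "u \<in> null"
  shows "scale q u \<in> null"
  using assms(2)
proof (induction u rule: null_induct)
  case (relator u)
  then have "scale q u \<in> tensor_relators R M N"
  proof (cases rule: relator_cases)
    case (add_left m m' x)
    then show ?thesis
      using q relatorI(1)[of "q \<otimes>\<^bsub>K\<^esub> m" "q \<otimes>\<^bsub>K\<^esub> m'" x] by (simp add: scale_simps base.S.r_distr)
  next
    case (add_right m x x')
    then show ?thesis
      using q relatorI(2)[of "q \<otimes>\<^bsub>K\<^esub> m" x x'] by (simp add: scale_simps)
  next
    case (balance r m x)
    then show ?thesis
      using q relatorI(3)[of r "q \<otimes>\<^bsub>K\<^esub> m" x] by (simp add: scale_simps base.S.m_lcomm)
  qed
  then show ?case
    unfolding tensor_null_def by (rule generate.incl)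
next
  case zero
  then show ?case
    using subgroup.one_closed[OF subgroup_null] by (simp add: scale_simps tensor_free_def)
next
  case (minus u)
  then show ?case
    using subgroup.m_inv_closed[OF subgroup_null minus(2)] subgroup.mem_carrier[OF subgroup_null minus(2)]
    by (simp add: scale_simps tensor_free_def)
next
  case (add u v)
  then show ?case
    using subgroup.m_closed[OF subgroup_null] by (simp add: scale_simps mult_free)
qed

lemma smult_class:
  assumes q: "q \<in> carrier K" and u: "u \<in> carrier free"
  shows "q \<odot>\<^bsub>T\<^esub> cls u = cls (scale q u)"
proof -
  have "cls (scale q v) = cls (scale q u)" if "v \<in> cls u" for v
    using mem_class[OF u that] scale_null[OF q] scale_closed[OF q u] class_eqI
    by (metis scale_simps(1))
  then have "(\<Union>v\<in>cls u. cls (scale q v)) = cls (scale q u)"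
    using in_class_self[OF u] by blast
  then show ?thesis
    by (simp add: tensor_algebra_def scale_def algebra_of_hom_def)
qed

lemma smult_closed:
  assumes "q \<in> carrier K" "X \<in> carrier T"
  shows "q \<odot>\<^bsub>T\<^esub> X \<in> carrier T"
  using assms by (elim class_cases) (simp add: smult_class class_closed scale_closed)

lemma pure_tensor_closed:
  "q \<in> carrier K \<Longrightarrow> x \<in> carrier N \<Longrightarrow> pure_tensor R M N q x \<in> carrier T"
  by (simp add: pure_tensor_def class_closed frag_of_in_free)

end

text \<open>An \<open>R\<close>-linear map \<open>g\<close> from \<open>N\<close> to \<open>K\<close>, whose \<open>K\<close>-linear extension to \<open>K \<otimes>\<^sub>R N\<close> is
  \<open>linear_extension K g\<close>.\<close>

locale base_change_map = base_change +
  fixes g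
  assumes g_closed: "x \<in> carrier N \<Longrightarrow> g x \<in> carrier K"
    and g_add: "x \<in> carrier N \<Longrightarrow> y \<in> carrier N \<Longrightarrow> g (x \<oplus>\<^bsub>N\<^esub> y) = g x \<oplus>\<^bsub>K\<^esub> g y"
    and g_smult: "r \<in> carrier R \<Longrightarrow> x \<in> carrier N \<Longrightarrow> g (r \<odot>\<^bsub>N\<^esub> x) = \<rho> r \<otimes>\<^bsub>K\<^esub> g x"
begin

definition ev where
  "ev (u :: _ \<Rightarrow>\<^sub>0 int) = (\<Oplus>\<^bsub>K\<^esub>p\<in>Poly_Mapping.keys u.
     add_pow K (Poly_Mapping.lookup u p) (fst p \<otimes>\<^bsub>K\<^esub> g (snd p)))"

text \<open>Summing over any larger finite set makes sums of formal combinations comparable, whose supports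
  differ because of cancellation.\<close>

lemma ev_superset:
  assumes "finite A" "Poly_Mapping.keys u \<subseteq> A" "A \<subseteq> carrier K \<times> carrier N"
  shows "ev u = (\<Oplus>\<^bsub>K\<^esub>p\<in>A. add_pow K (Poly_Mapping.lookup u p) (fst p \<otimes>\<^bsub>K\<^esub> g (snd p)))"
  unfolding ev_def
proof (rule base.S.add.finprod_mono_neutral_cong_left)
  fix p assume "p \<in> A - Poly_Mapping.keys u"
  then show "add_pow K (Poly_Mapping.lookup u p) (fst p \<otimes>\<^bsub>K\<^esub> g (snd p)) = \<zero>\<^bsub>K\<^esub>"
    by (simp add: in_keys_iff add_pow_def)
qed (use assms g_closed in auto)

lemma ev_closed: "u \<in> carrier free \<Longrightarrow> ev u \<in> carrier K"
  unfolding ev_def carrier_free using g_closed by (intro base.S.finsum_closed) auto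

lemma ev_add:
  assumes "u \<in> carrier free" "v \<in> carrier free"
  shows "ev (u + v) = ev u \<oplus>\<^bsub>K\<^esub> ev v"
proof -
  let ?A = "Poly_Mapping.keys u \<union> Poly_Mapping.keys v"
  have A: "finite ?A" "?A \<subseteq> carrier K \<times> carrier N"
    using assms by (auto simp: carrier_free)
  have "ev (u + v) = (\<Oplus>\<^bsub>K\<^esub>p\<in>?A. add_pow K (Poly_Mapping.lookup (u + v) p) (fst p \<otimes>\<^bsub>K\<^esub> g (snd p)))"
    using A keys_add[of u v] by (intro ev_superset) auto
  also have "\<dots> = (\<Oplus>\<^bsub>K\<^esub>p\<in>?A. add_pow K (Poly_Mapping.lookup u p) (fst p \<otimes>\<^bsub>K\<^esub> g (snd p)) \<oplus>\<^bsub>K\<^esub>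
      add_pow K (Poly_Mapping.lookup v p) (fst p \<otimes>\<^bsub>K\<^esub> g (snd p)))"
    using A(2) g_closed
    by (intro base.S.finsum_cong') (auto simp: lookup_add base.S.add.int_pow_mult)
  also have "\<dots> = ev u \<oplus>\<^bsub>K\<^esub> ev v"
    using A g_closed by (subst base.S.finsum_addf) (auto simp: ev_superset[of ?A])
  finally show ?thesis .
qed

lemma ev_zero: "ev 0 = \<zero>\<^bsub>K\<^esub>"
  by (simp add: ev_def)

lemma ev_minus:
  assumes "u \<in> carrier free"
  shows "ev (- u) = \<ominus>\<^bsub>K\<^esub> ev u"
proof -
  have "- u \<in> carrier free"
    using assms by (simp add: carrier_free)
  moreover from this have "ev (- u) \<oplus>\<^bsub>K\<^esub> ev u = \<zero>\<^bsub>K\<^esub>"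
    using assms ev_add[of "- u" u] by (simp add: ev_zero)
  ultimately show ?thesis
    using assms ev_closed by (metis base.S.minus_equality)
qed

lemma ev_diff:
  assumes "u \<in> carrier free" "v \<in> carrier free"
  shows "ev (u - v) = ev u \<ominus>\<^bsub>K\<^esub> ev v"
  using ev_add[of u "- v"] ev_minus[of v] assms by (simp add: carrier_free base.S.minus_eq)

lemma ev_frag_of:
  assumes "m \<in> carrier K" "x \<in> carrier N"
  shows "ev (frag_of (m, x)) = m \<otimes>\<^bsub>K\<^esub> g x"
  using assms g_closed by (simp add: ev_def)

text \<open>The evaluation kills each relator: the first two kinds by additivity, the third by \<open>R\<close>-linearity
  of \<open>g\<close>.\<close>

lemma ev_null:
  assumes "u \<in> null"
  shows "ev u = \<zero>\<^bsub>K\<^esub>"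
  using assms
proof (induction u rule: null_induct)
  case (relator u)
  then show ?case
  proof (cases rule: relator_cases)
    case (add_left m m' x)
    then show ?thesis
      using g_closed[of x]
      by (simp add: ev_diff ev_frag_of frag_of_in_free diff_in_free base.S.l_distr base.S.minus_eq
          base.S.a_assoc base.S.a_lcomm[of "m \<otimes>\<^bsub>K\<^esub> g x"] base.S.r_neg base.S.minus_add)
  next
    case (add_right m x x')
    then show ?thesis
      using g_closed[of x] g_closed[of x'] g_add[of x x']
      by (simp add: ev_diff ev_frag_of frag_of_in_free diff_in_free base.S.r_distr base.S.minus_eq
          base.S.a_assoc base.S.a_lcomm[of "m \<otimes>\<^bsub>K\<^esub> g x"] base.S.r_neg base.S.minus_add)
  next
    case (balance r m x)
    then show ?thesis
      using g_closed[of x] g_smult[of r x]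
      by (simp add: ev_diff ev_frag_of frag_of_in_free base.S.minus_eq base.S.m_ac base.S.r_neg)
  qed
qed (simp_all add: ev_zero ev_minus ev_add)

lemma linear_extension_class:
  assumes u: "u \<in> carrier free"
  shows "linear_extension K g (cls u) = ev u"
proof -
  have "ev v = ev u" if "v \<in> cls u" for v
    using mem_class[OF u that] ev_null u ev_add ev_closed subgroup.mem_carrier[OF subgroup_null]
    by (metis base.S.l_zero)
  then have "ev ` cls u = (\<lambda>_. ev u) ` cls u"
    by (rule image_cong[OF refl])
  also have "\<dots> = {ev u}"
    by (rule image_constant[OF in_class_self[OF u]])
  finally have "ev ` cls u = {ev u}" .
  then show ?thesis
    unfolding linear_extension_def ev_def[abs_def, symmetric] by simp
qed

lemma linear_extension_closed: "X \<in> carrier T \<Longrightarrow> linear_extension K g X \<in> carrier K"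
  by (elim class_cases) (simp add: linear_extension_class ev_closed)

lemma linear_extension_add:
  assumes "X \<in> carrier T" "Y \<in> carrier T"
  shows "linear_extension K g (X \<oplus>\<^bsub>T\<^esub> Y) = linear_extension K g X \<oplus>\<^bsub>K\<^esub> linear_extension K g Y"
  using assms by (elim class_cases) (simp add: class_add linear_extension_class add_in_free ev_add)

lemma linear_extension_smult:
  assumes q: "q \<in> carrier K" and "X \<in> carrier T"
  shows "linear_extension K g (q \<odot>\<^bsub>T\<^esub> X) = q \<otimes>\<^bsub>K\<^esub> linear_extension K g X"
proof -
  have "ev (scale q u) = q \<otimes>\<^bsub>K\<^esub> ev u" if "u \<in> carrier free" for u
  proof -
    have "u \<in> carrier free \<and> ev (scale q u) = q \<otimes>\<^bsub>K\<^esub> ev u"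
      using that[unfolded carrier_free]
    proof (induction u rule: frag_induction)
      case zero
      then show ?case
        using q by (simp add: scale_simps ev_zero carrier_free)
    next
      case (one p)
      then show ?case
        using q g_closed
        by (cases p) (auto simp: scale_simps ev_frag_of base.S.m_assoc intro: frag_of_in_free)
    next
      case (diff a b)
      then show ?case
        using q by (simp add: scale_simps ev_diff scale_closed diff_in_free ev_closed
            base.S.minus_eq base.S.r_distr base.S.r_minus)
    qed
    then show ?thesis ..
  qed
  then show ?thesis
    using assms by (elim class_cases) (simp add: smult_class linear_extension_class scale_closed)
qed

lemma linear_extension_pure_tensor:
  assumes "q \<in> carrier K" "x \<in> carrier N"
  shows "linear_extension K g (pure_tensor R M N q x) = q \<otimes>\<^bsub>K\<^esub> g x"
  using assms by (simp add: pure_tensor_def linear_extension_class frag_of_in_free ev_frag_of)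

lemma linear_extension_finsum:
  assumes "finite A" "X \<in> A \<rightarrow> carrier T"
  shows "linear_extension K g (\<Oplus>\<^bsub>T\<^esub>k\<in>A. X k) = (\<Oplus>\<^bsub>K\<^esub>k\<in>A. linear_extension K g (X k))"
proof -
  interpret T: abelian_group T
    by (rule abelian_group_T)
  have zero: "linear_extension K g \<zero>\<^bsub>T\<^esub> = \<zero>\<^bsub>K\<^esub>"
    using linear_extension_add[of "\<zero>\<^bsub>T\<^esub>" "\<zero>\<^bsub>T\<^esub>"] linear_extension_closed[of "\<zero>\<^bsub>T\<^esub>"]
    by (metis T.l_zero T.zero_closed base.S.add.l_cancel_one')
  show ?thesis
    using assms
  proof (induction A rule: finite_induct)
    case (insert a A)
    then show ?case
      by (simp add: linear_extension_add linear_extension_closed Pi_def)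
  qed (simp add: zero)
qed

lemma g_finsum:
  assumes "finite A" "r \<in> A \<rightarrow> carrier R" "X \<in> A \<rightarrow> carrier N"
  shows "g (\<Oplus>\<^bsub>N\<^esub>k\<in>A. r k \<odot>\<^bsub>N\<^esub> X k) = (\<Oplus>\<^bsub>K\<^esub>k\<in>A. \<rho> (r k) \<otimes>\<^bsub>K\<^esub> g (X k))"
  using assms
proof (induction A rule: finite_induct)
  case empty
  have "g \<zero>\<^bsub>N\<^esub> \<oplus>\<^bsub>K\<^esub> g \<zero>\<^bsub>N\<^esub> = g \<zero>\<^bsub>N\<^esub>"
    using g_add[OF N.M.zero_closed N.M.zero_closed] by simp
  then show ?case
    using g_closed[OF N.M.zero_closed] by (simp add: base.S.add.l_cancel_one)
next
  case (insert a A)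
  then have "(\<Oplus>\<^bsub>N\<^esub>k\<in>A. r k \<odot>\<^bsub>N\<^esub> X k) \<in> carrier N"
    by (intro N.M.finsum_closed) auto
  with insert show ?case
    by (simp add: g_add g_smult g_closed Pi_def)
qed

end

section \<open>Rings of polynomial functions\<close>

lemma polynomial_maps_diff:
  assumes "f \<in> polynomial_maps G" "g \<in> polynomial_maps G"
  shows "(\<lambda>v. f v - g v) \<in> polynomial_maps G"
proof -
  have "(\<lambda>v. f v + (-1) * g v) \<in> polynomial_maps G"
    by (intro polynomial_maps.add polynomial_maps.mult polynomial_maps.const assms)
  then show ?thesis
    by simp
qed

lemma polynomial_maps_prod:
  assumes "\<And>i. i \<in> A \<Longrightarrow> f i \<in> polynomial_maps G"
  shows "(\<lambda>v. \<Prod>i\<in>A. f i v) \<in> polynomial_maps G"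
  using assms
proof (induction A rule: infinite_finite_induct)
  case (insert i A)
  then show ?case
    using polynomial_maps.mult[of "f i" G "\<lambda>v. \<Prod>i\<in>A. f i v"] by simp
qed (simp_all add: polynomial_maps.const)

lemma polynomial_ring_simps:
  "\<zero>\<^bsub>polynomial_ring G V\<^esub> = (\<lambda>v\<in>V. 0)" "\<one>\<^bsub>polynomial_ring G V\<^esub> = (\<lambda>v\<in>V. 1)"
  "f \<oplus>\<^bsub>polynomial_ring G V\<^esub> g = (\<lambda>v\<in>V. f v + g v)"
  "f \<otimes>\<^bsub>polynomial_ring G V\<^esub> g = (\<lambda>v\<in>V. f v * g v)"
  by (simp_all add: polynomial_ring_def)

lemma polynomial_ring_closed: "f \<in> polynomial_maps G \<Longrightarrow> restrict f V \<in> carrier (polynomial_ring G V)"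
  by (simp add: polynomial_ring_def)

lemma polynomial_ring_cases:
  assumes "f \<in> carrier (polynomial_ring G V)"
  obtains p where "p \<in> polynomial_maps G" "f = restrict p V"
  using assms by (auto simp: polynomial_ring_def)

lemma polynomial_ring_eqI:
  assumes "f \<in> carrier (polynomial_ring G V)" "g \<in> carrier (polynomial_ring G V)"
    and "\<And>v. v \<in> V \<Longrightarrow> f v = g v"
  shows "f = g"
  using assms by (metis polynomial_ring_cases restrict_ext restrict_apply')

lemma polynomial_ring_cring: "cring (polynomial_ring G V)"
proof -
  let ?R = "polynomial_ring G V"
  have add: "f \<oplus>\<^bsub>?R\<^esub> g \<in> carrier ?R" and mult: "f \<otimes>\<^bsub>?R\<^esub> g \<in> carrier ?R"
    if fg: "f \<in> carrier ?R" "g \<in> carrier ?R" for f g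
  proof -
    obtain p q where pq: "p \<in> polynomial_maps G" "f = restrict p V"
        "q \<in> polynomial_maps G" "g = restrict q V"
      using fg by (metis polynomial_ring_cases)
    have "f \<oplus>\<^bsub>?R\<^esub> g = (\<lambda>v\<in>V. p v + q v)" "f \<otimes>\<^bsub>?R\<^esub> g = (\<lambda>v\<in>V. p v * q v)"
      using pq by (auto simp: polynomial_ring_simps)
    then show "f \<oplus>\<^bsub>?R\<^esub> g \<in> carrier ?R" "f \<otimes>\<^bsub>?R\<^esub> g \<in> carrier ?R"
      using pq by (auto intro!: polynomial_ring_closed polynomial_maps.add polynomial_maps.mult)
  qed
  have const: "(\<lambda>v\<in>V. c) \<in> carrier ?R" for c
    by (intro polynomial_ring_closed polynomial_maps.const)
  have ext: "(\<lambda>v\<in>V. f v) = f" if "f \<in> carrier ?R" for f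
    using that by (elim polynomial_ring_cases) auto
  have neg: "\<exists>g\<in>carrier ?R. g \<oplus>\<^bsub>?R\<^esub> f = \<zero>\<^bsub>?R\<^esub>" if "f \<in> carrier ?R" for f
    by (rule bexI[of _ "(\<lambda>v\<in>V. -1) \<otimes>\<^bsub>?R\<^esub> f"])
      (use mult[OF const that] in \<open>auto simp: polynomial_ring_simps\<close>)
  show ?thesis
  proof (rule cringI)
    show "abelian_group ?R"
    proof (rule abelian_groupI)
      fix f g assume "f \<in> carrier ?R" "g \<in> carrier ?R"
      then show "f \<oplus>\<^bsub>?R\<^esub> g \<in> carrier ?R"
        by (rule add)
    next
      fix f assume "f \<in> carrier ?R"
      then show "\<exists>g\<in>carrier ?R. g \<oplus>\<^bsub>?R\<^esub> f = \<zero>\<^bsub>?R\<^esub>"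
        by (rule neg)
      have "\<zero>\<^bsub>?R\<^esub> \<oplus>\<^bsub>?R\<^esub> f = (\<lambda>v\<in>V. f v)"
        by (auto simp: polynomial_ring_simps)
      then show "\<zero>\<^bsub>?R\<^esub> \<oplus>\<^bsub>?R\<^esub> f = f"
        using \<open>f \<in> carrier ?R\<close> by (simp add: ext)
    qed (use const in \<open>auto simp: polynomial_ring_simps add_ac intro!: restrict_ext\<close>)
    show "comm_monoid ?R"
    proof (rule comm_monoidI)
      fix f g assume "f \<in> carrier ?R" "g \<in> carrier ?R"
      then show "f \<otimes>\<^bsub>?R\<^esub> g \<in> carrier ?R"
        by (rule mult)
    next
      fix f assume "f \<in> carrier ?R"
      moreover have "\<one>\<^bsub>?R\<^esub> \<otimes>\<^bsub>?R\<^esub> f = (\<lambda>v\<in>V. f v)"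
        by (auto simp: polynomial_ring_simps)
      ultimately show "\<one>\<^bsub>?R\<^esub> \<otimes>\<^bsub>?R\<^esub> f = f"
        by (simp add: ext)
    qed (use const in \<open>auto simp: polynomial_ring_simps mult_ac intro!: restrict_ext\<close>)
  qed (auto simp: polynomial_ring_simps ring_distribs intro!: restrict_ext)
qed

text \<open>A map between the underlying sets induces a ring homomorphism if it pulls the coordinate
  functions back to polynomial functions. Both the localization \<open>\<phi>\<^sub>w\<close>, along \<open>h \<mapsto> (h, w \<cdot> h)\<close>, and
  the inclusion of \<open>\<complex>[s]\<close>, along the projection to the first factor, arise in this way.\<close>

lemma polynomial_ring_pullback:
  assumes F: "\<And>v. v \<in> V' \<Longrightarrow> F v \<in> V"
    and gen: "\<And>f. f \<in> G \<Longrightarrow> \<exists>f'\<in>polynomial_maps G'. \<forall>v\<in>V'. f (F v) = f' v"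
  shows "(\<lambda>f. \<lambda>v\<in>V'. f (F v)) \<in> ring_hom (polynomial_ring G V) (polynomial_ring G' V')"
proof -
  have "\<exists>f'\<in>polynomial_maps G'. \<forall>v\<in>V'. f (F v) = f' v" if "f \<in> polynomial_maps G" for f
    using that
  proof (induction f rule: polynomial_maps.induct)
    case (const c)
    then show ?case
      by (intro bexI[OF _ polynomial_maps.const[of c]]) simp
  next
    case (coord f)
    then show ?case
      by (rule gen)
  next
    case (add f g)
    then obtain f' g' where "f' \<in> polynomial_maps G'" "\<forall>v\<in>V'. f (F v) = f' v"
        "g' \<in> polynomial_maps G'" "\<forall>v\<in>V'. g (F v) = g' v"
      by blast
    then show ?case
      by (intro bexI[OF _ polynomial_maps.add[of f' G' g']]) simp_all
  next
    case (mult f g)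
    then obtain f' g' where "f' \<in> polynomial_maps G'" "\<forall>v\<in>V'. f (F v) = f' v"
        "g' \<in> polynomial_maps G'" "\<forall>v\<in>V'. g (F v) = g' v"
      by blast
    then show ?case
      by (intro bexI[OF _ polynomial_maps.mult[of f' G' g']]) simp_all
  qed
  then have "(\<lambda>v\<in>V'. f (F v)) \<in> carrier (polynomial_ring G' V')"
    if "f \<in> carrier (polynomial_ring G V)" for f
  proof -
    obtain p where p: "p \<in> polynomial_maps G" "f = restrict p V"
      using \<open>f \<in> carrier _\<close> by (rule polynomial_ring_cases)
    then obtain p' where "p' \<in> polynomial_maps G'" "\<forall>v\<in>V'. p (F v) = p' v"
      using \<open>\<And>f. f \<in> polynomial_maps G \<Longrightarrow> _\<close> by blast
    moreover from this p F have "(\<lambda>v\<in>V'. f (F v)) = restrict p' V'"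
      by auto
    ultimately show ?thesis
      by (simp add: polynomial_ring_closed)
  qed
  then show ?thesis
    by (intro ring_hom_memI) (auto simp: polynomial_ring_simps F intro!: restrict_ext)
qed

text \<open>Two nonzero polynomial functions are nonzero at points \<open>u\<close> and \<open>v\<close>. On the line through \<open>u\<close> and
  \<open>v\<close> they become nonzero polynomials in one variable, whose product is not identically \<open>0\<close>.\<close>

lemma polynomial_ring_domain:
  fixes V :: "'v set"
  assumes "V \<noteq> {}"
    and lines: "\<And>u v. u \<in> V \<Longrightarrow> v \<in> V \<Longrightarrow> \<exists>L :: complex \<Rightarrow> 'v. L 0 = u \<and> L 1 = v \<and> range L \<subseteq> V \<and>
      (\<forall>f\<in>G. \<exists>p. \<forall>c. f (L c) = poly p c)"
  shows "domain (polynomial_ring G V)"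
proof -
  let ?R = "polynomial_ring G V"
  interpret cring ?R
    by (rule polynomial_ring_cring)
  show ?thesis
  proof
    show "\<one>\<^bsub>?R\<^esub> \<noteq> \<zero>\<^bsub>?R\<^esub>"
      using \<open>V \<noteq> {}\<close> by (metis all_not_in_conv one_neq_zero polynomial_ring_simps(1,2) restrict_apply')
    fix f g
    assume fg: "f \<otimes>\<^bsub>?R\<^esub> g = \<zero>\<^bsub>?R\<^esub>" "f \<in> carrier ?R" "g \<in> carrier ?R"
    have prod0: "f v * g v = 0" if "v \<in> V" for v
      using fun_cong[OF fg(1), of v] that by (simp add: polynomial_ring_simps)
    show "f = \<zero>\<^bsub>?R\<^esub> \<or> g = \<zero>\<^bsub>?R\<^esub>"
    proof (rule ccontr)
      assume nz: "\<not> (f = \<zero>\<^bsub>?R\<^esub> \<or> g = \<zero>\<^bsub>?R\<^esub>)"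
      have nz_at: "\<exists>v\<in>V. k v \<noteq> 0" if "k \<in> carrier ?R" "k \<noteq> \<zero>\<^bsub>?R\<^esub>" for k
        using polynomial_ring_eqI[OF that(1) zero_closed] that(2) by (auto simp: polynomial_ring_simps)
      obtain u where u: "u \<in> V" "f u \<noteq> 0"
        using nz_at[OF fg(2)] nz by auto
      obtain v where v: "v \<in> V" "g v \<noteq> 0"
        using nz_at[OF fg(3)] nz by auto
      obtain L :: "complex \<Rightarrow> 'v" where L: "L 0 = u" "L 1 = v" "range L \<subseteq> V"
          and gens: "\<And>f. f \<in> G \<Longrightarrow> \<exists>p. \<forall>c. f (L c) = poly p c"
        using lines[OF u(1) v(1)] by blast
      have LV: "L c \<in> V" for c
        using L(3) by blast
      have on_line: "\<exists>p. \<forall>c. k (L c) = poly p c" if "k \<in> polynomial_maps G" for k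
        using that
      proof (induction k rule: polynomial_maps.induct)
        case (const c)
        show ?case
          by (intro exI[of _ "[:c:]"]) simp
      next
        case (add f g)
        then show ?case
          by (metis poly_add)
      next
        case (mult f g)
        then show ?case
          by (metis poly_mult)
      qed (rule gens)
      have "\<exists>p. \<forall>c. k (L c) = poly p c" if k: "k \<in> carrier ?R" for k
      proof -
        obtain k' where "k' \<in> polynomial_maps G" "k = restrict k' V"
          using k by (rule polynomial_ring_cases)
        with on_line[of k'] LV show ?thesis
          by simp
      qed
      from this[OF fg(2)] this[OF fg(3)] obtain p q
        where p: "\<And>c. f (L c) = poly p c" and q: "\<And>c. g (L c) = poly q c"
        by blast
      have "poly (p * q) c = 0" for c
        using prod0[OF LV] by (simp add: p q)
      then have "p * q = 0"
        using poly_all_0_iff_0 by blast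
      then show False
        using p[of 0] q[of 1] u(2) v(2) L(1,2) by auto
    qed
  qed
qed

section \<open>Blocks of a composition and generic points\<close>

lemma sum_list_take_mono: "a \<le> b \<Longrightarrow> sum_list (take a \<alpha>) \<le> sum_list (take b (\<alpha> :: nat list))"
  using take_add[of a "b - a" \<alpha>] by simp

lemma block_subset: "block \<alpha> j \<subseteq> {1..sum_list \<alpha>}"
proof -
  have "sum_list (take j \<alpha>) \<le> sum_list \<alpha>"
    using sum_list_take_mono[of j "max j (length \<alpha>)" \<alpha>] by simp
  then show ?thesis
    by (auto simp: block_def)
qed

lemma block_unique:
  assumes "k \<in> block \<alpha> i" "k \<in> block \<alpha> j" "1 \<le> i" "1 \<le> j"
  shows "i = j"
proof (rule ccontr)
  assume "i \<noteq> j"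
  then consider "i \<le> j - 1" | "j \<le> i - 1"
    by linarith
  then show False
    by cases (use assms sum_list_take_mono[of i "j - 1" \<alpha>] sum_list_take_mono[of j "i - 1" \<alpha>]
      in \<open>auto simp: block_def\<close>)
qed

lemma block_exists:
  assumes "k \<in> {1..sum_list \<alpha>}"
  obtains j where "j \<in> {1..length \<alpha>}" "k \<in> block \<alpha> j"
proof -
  let ?P = "\<lambda>j. k \<le> sum_list (take j \<alpha>)"
  define j where "j = (LEAST j. ?P j)"
  have "?P (length \<alpha>)"
    using assms by simp
  then have j: "?P j" "j \<le> length \<alpha>"
    unfolding j_def by (rule LeastI, rule Least_le)
  moreover have "j \<noteq> 0"
    using j assms by (intro notI) simp
  moreover from this have "\<not> ?P (j - 1)"
    using not_less_Least[of "j - 1" ?P] by (simp add: j_def)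
  ultimately show ?thesis
    by (intro that[of j]) (auto simp: block_def)
qed

lemma first_in_block:
  assumes "strong_composition n \<alpha>" "j \<in> {1..length \<alpha>}"
  shows "Suc (sum_list (take (j - 1) \<alpha>)) \<in> block \<alpha> j"
proof -
  have "take j \<alpha> = take (j - 1) \<alpha> @ [\<alpha> ! (j - 1)]"
    using assms(2) take_Suc_conv_app_nth[of "j - 1" \<alpha>] by auto
  moreover have "0 < \<alpha> ! (j - 1)"
    using assms nth_mem[of "j - 1" \<alpha>] by (auto simp: strong_composition_def)
  ultimately show ?thesis
    by (simp add: block_def)
qed

lemma s_space_on_block:
  assumes "strong_composition n \<alpha>" "h \<in> s_space \<alpha>" "j \<in> {1..length \<alpha>}" "k \<in> block \<alpha> j"
  shows "h k = z_coord \<alpha> j h"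
proof -
  obtain z where "\<forall>j\<in>{1..length \<alpha>}. \<forall>i\<in>block \<alpha> j. h i = z j"
    using assms(2) by (auto simp: s_space_def)
  then show ?thesis
    using first_in_block[OF assms(1,3)] assms(3,4) by (simp add: z_coord_def)
qed

text \<open>The values \<open>1, \<dots>, r\<close> on the blocks, shifted by their mean so that the coordinates sum to zero.\<close>

lemma s_space_generic:
  assumes "strong_composition n \<alpha>"
  obtains h where "h \<in> s_space \<alpha>" "inj_on (\<lambda>j. z_coord \<alpha> j h) {1..length \<alpha>}"
proof -
  define b where "b k = (THE j. j \<in> {1..length \<alpha>} \<and> k \<in> block \<alpha> j)" for k
  have b: "b k = j" if "j \<in> {1..length \<alpha>}" "k \<in> block \<alpha> j" for k j
    unfolding b_def by (rule the_equality) (use that block_unique in auto)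
  \<comment> \<open>The mean of the block numbers; for \<open>n = 0\<close> it is \<open>0 / 0 = 0\<close> and no coordinate is left to shift.\<close>
  define c :: complex where "c = (\<Sum>k=1..n. of_nat (b k)) / of_nat n"
  define h where "h = (\<lambda>k\<in>{1..n}. of_nat (b k) - c)"
  have n: "sum_list \<alpha> = n"
    using assms by (simp add: strong_composition_def)
  have "(\<Sum>k=1..n. h k) = 0"
    by (cases "n = 0") (simp_all add: h_def sum_subtractf c_def)
  then have "h \<in> t_space (sum_list \<alpha>)"
    by (simp add: t_space_def h_def n)
  moreover have hb: "h k = of_nat j - c" if "j \<in> {1..length \<alpha>}" "k \<in> block \<alpha> j" for k j
    using that b block_subset[of \<alpha> j] n by (auto simp: h_def)
  ultimately have "h \<in> s_space \<alpha>"
    unfolding s_space_def by (intro CollectI conjI exI[of _ "\<lambda>j. of_nat j - c"]) simp_all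
  moreover have "inj_on (\<lambda>j. z_coord \<alpha> j h) {1..length \<alpha>}"
    using hb first_in_block[OF assms] by (auto simp: inj_on_def z_coord_def)
  ultimately show ?thesis
    by (rule that)
qed

lemma domain_S_ring:
  assumes "strong_composition n \<alpha>"
  shows "domain (S_ring \<alpha>)"
  unfolding S_ring_def
proof (rule polynomial_ring_domain)
  show "s_space \<alpha> \<noteq> {}"
    using s_space_generic[OF assms] by blast
  fix u v
  assume uv: "u \<in> s_space \<alpha>" "v \<in> s_space \<alpha>"
  define L where "L c = (\<lambda>i. u i + c * (v i - u i))" for c
  have "L c \<in> s_space \<alpha>" for c
  proof -
    obtain y z where "\<forall>j\<in>{1..length \<alpha>}. \<forall>i\<in>block \<alpha> j. u i = y j"
        "\<forall>j\<in>{1..length \<alpha>}. \<forall>i\<in>block \<alpha> j. v i = z j"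
      using uv by (auto simp: s_space_def)
    then have "\<forall>j\<in>{1..length \<alpha>}. \<forall>i\<in>block \<alpha> j. L c i = y j + c * (z j - y j)"
      by (simp add: L_def)
    moreover have "L c \<in> t_space (sum_list \<alpha>)"
    proof -
      \<comment> \<open>Off \<open>{1..n}\<close> both points have the same default value, hence so has the line.\<close>
      have "L c i = undefined" if "i \<notin> {1..sum_list \<alpha>}" for i
        using uv that by (auto simp: L_def s_space_def t_space_def PiE_def extensional_def)
      moreover have "(\<Sum>i = 1..sum_list \<alpha>. L c i) = 0"
        using uv
        by (simp add: L_def s_space_def t_space_def sum.distrib sum_subtractf flip: sum_distrib_left)
      ultimately show ?thesis
        by (auto simp: t_space_def PiE_def extensional_def)
    qed
    ultimately show ?thesis
      unfolding s_space_def by (intro CollectI conjI exI[of _ "\<lambda>j. y j + c * (z j - y j)"])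
  qed
  moreover have "\<exists>p. \<forall>c. f (L c) = poly p c" if f: "f \<in> {z_coord \<alpha> j | j. j \<in> {1..length \<alpha>}}" for f
  proof -
    obtain j where j: "f = z_coord \<alpha> j"
      using f by blast
    define k where "k = Suc (sum_list (take (j - 1) \<alpha>))"
    have "f = (\<lambda>h. h k)"
      by (simp add: j k_def z_coord_def fun_eq_iff)
    then show ?thesis
      by (intro exI[of _ "[:u k, v k - u k:]"]) (simp add: L_def)
  qed
  ultimately show "\<exists>L :: complex \<Rightarrow> _. L 0 = u \<and> L 1 = v \<and> range L \<subseteq> s_space \<alpha> \<and>
      (\<forall>f\<in>{z_coord \<alpha> j | j. j \<in> {1..length \<alpha>}}. \<exists>p. \<forall>c. f (L c) = poly p c)"
    by (intro exI[of _ L]) (auto simp: L_def)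
qed

section \<open>The coordinate ring and its localizations\<close>

lemma perm_act_t_space:
  assumes w: "w permutes {1..n}" and t: "t \<in> t_space n"
  shows "perm_act w t \<in> t_space n"
proof -
  have inv: "inv_into UNIV w permutes {1..n}"
    using w by (rule permutes_inv)
  then have "(\<Sum>i=1..n. t (inv_into UNIV w i)) = (\<Sum>i=1..n. t i)"
    using sum.permute[OF inv, of t] by (simp add: comp_def)
  then show ?thesis
    using t permutes_not_in[OF inv] by (auto simp: t_space_def perm_act_def PiE_def extensional_def)
qed

locale springer_composition =
  fixes n :: nat and \<alpha> :: "nat list"
  assumes strong: "strong_composition n \<alpha>"
begin

lemma sum_\<alpha>: "sum_list \<alpha> = n"
  using strong by (simp add: strong_composition_def)

sublocale S: "domain" "S_ring \<alpha>"
  by (rule domain_S_ring[OF strong])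

sublocale ST: cring "ST_ring \<alpha>"
  unfolding ST_ring_def by (rule polynomial_ring_cring)

sublocale Q: field "Q_field \<alpha>"
  unfolding Q_field_def by (rule S.field_frac_field)

sublocale base: ring_hom_cring "S_ring \<alpha>" "Q_field \<alpha>" "of_base (S_ring \<alpha>)"
  using S.of_base_ring_hom
  by (intro ring_hom_cring.intro ring_hom_cring_axioms.intro S.is_cring Q.is_cring)
    (simp add: Q_field_def)

lemma phi_ring_hom:
  assumes w: "w permutes {1..n}"
  shows "phi \<alpha> w \<in> ring_hom (ST_ring \<alpha>) (S_ring \<alpha>)"
proof -
  have "(\<lambda>F. \<lambda>h\<in>s_space \<alpha>. F (h, perm_act w h)) \<in> ring_hom (ST_ring \<alpha>) (S_ring \<alpha>)"
    unfolding ST_ring_def S_ring_def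
  proof (rule polynomial_ring_pullback)
    fix h assume "h \<in> s_space \<alpha>"
    then show "(h, perm_act w h) \<in> s_space \<alpha> \<times> t_space (sum_list \<alpha>)"
      using perm_act_t_space[OF w] by (auto simp: s_space_def sum_\<alpha>)
  next
    let ?G = "{z_coord \<alpha> j | j. j \<in> {1..length \<alpha>}}"
    fix f
    assume "f \<in> {\<lambda>(h, t). z_coord \<alpha> j h | j. j \<in> {1..length \<alpha>}} \<union>
      {\<lambda>(h, t). t i | i. i \<in> {1..sum_list \<alpha>}}"
    then consider j where "j \<in> {1..length \<alpha>}" "f = (\<lambda>(h, t). z_coord \<alpha> j h)"
      | i where "i \<in> {1..n}" "f = (\<lambda>(h, t). t i)"
      using sum_\<alpha> by blast
    then show "\<exists>f'\<in>polynomial_maps ?G. \<forall>h\<in>s_space \<alpha>. f (h, perm_act w h) = f' h"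
    proof cases
      case (1 j)
      then show ?thesis
        by (intro bexI[of _ "z_coord \<alpha> j"] polynomial_maps.coord) auto
    next
      case (2 i)
      have "inv_into UNIV w i \<in> {1..sum_list \<alpha>}"
        using 2 permutes_in_image[OF permutes_inv[OF w]] by (simp add: sum_\<alpha>)
      then obtain j where "j \<in> {1..length \<alpha>}" "inv_into UNIV w i \<in> block \<alpha> j"
        by (rule block_exists)
      then show ?thesis
        using 2 s_space_on_block[OF strong]
        by (intro bexI[of _ "z_coord \<alpha> j"] polynomial_maps.coord) (auto simp: perm_act_def)
    qed
  qed
  then show ?thesis
    by (simp add: phi_def[abs_def])
qed

lemma phi_hom_cring:
  assumes "w permutes {1..n}"
  shows "ring_hom_cring (ST_ring \<alpha>) (S_ring \<alpha>) (phi \<alpha> w)"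
  by (intro ring_hom_cring.intro ring_hom_cring_axioms.intro ST.is_cring S.is_cring phi_ring_hom assms)

text \<open>The variety is the union of the graphs of the permutations, so a function vanishes on it iff all
  its localizations vanish. The vanishing ideal is thus an intersection of kernels.\<close>

lemma vanishing_ideal_eq:
  "vanishing_ideal \<alpha> = (\<Inter>w\<in>{w. w permutes {1..n}}. a_kernel (ST_ring \<alpha>) (S_ring \<alpha>) (phi \<alpha> w))"
proof -
  have "(\<forall>p\<in>Z_variety \<alpha>. F p = 0) \<longleftrightarrow> (\<forall>w. w permutes {1..n} \<longrightarrow> phi \<alpha> w F = \<zero>\<^bsub>S_ring \<alpha>\<^esub>)" for F
  proof -
    have "phi \<alpha> w F = \<zero>\<^bsub>S_ring \<alpha>\<^esub> \<longleftrightarrow> (\<forall>h\<in>s_space \<alpha>. F (h, perm_act w h) = 0)" for w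
      by (auto simp: phi_def S_ring_def polynomial_ring_simps restrict_def fun_eq_iff)
    then show ?thesis
      by (auto simp: Z_variety_def sum_\<alpha>)
  qed
  then have "vanishing_ideal \<alpha> =
      {F \<in> carrier (ST_ring \<alpha>). \<forall>w. w permutes {1..n} \<longrightarrow> phi \<alpha> w F = \<zero>\<^bsub>S_ring \<alpha>\<^esub>}"
    by (simp add: vanishing_ideal_def)
  also have "\<dots> = (\<Inter>w\<in>{w. w permutes {1..n}}. a_kernel (ST_ring \<alpha>) (S_ring \<alpha>) (phi \<alpha> w))"
    using permutes_id[of "{1..n}"] unfolding a_kernel_def' by blast
  finally show ?thesis .
qed

sublocale I: ideal "vanishing_ideal \<alpha>" "ST_ring \<alpha>"
proof -
  have "ideal (a_kernel (ST_ring \<alpha>) (S_ring \<alpha>) (phi \<alpha> w)) (ST_ring \<alpha>)" if "w permutes {1..n}" for w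
    by (intro ring_hom_ring.kernel_is_ideal ring_hom_ringI2 ST.ring_axioms S.ring_axioms phi_ring_hom that)
  then show "ideal (vanishing_ideal \<alpha>) (ST_ring \<alpha>)"
    unfolding vanishing_ideal_eq by (intro ST.i_Intersect) (auto intro: permutes_id)
qed

lemma A_class_ring_hom: "A_class \<alpha> \<in> ring_hom (ST_ring \<alpha>) (ST_ring \<alpha> Quot vanishing_ideal \<alpha>)"
  using I.rcos_ring_hom by (simp add: A_class_def[abs_def])

lemma A_algebra_carrier: "carrier (A_algebra \<alpha>) = A_class \<alpha> ` carrier (ST_ring \<alpha>)"
  by (auto simp: A_algebra_def algebra_of_hom_def FactRing_def A_RCOSETS_def' A_class_def)

lemma base_pullback_hom:
  "(\<lambda>f. \<lambda>(h, t)\<in>s_space \<alpha> \<times> t_space (sum_list \<alpha>). f h) \<in> ring_hom (S_ring \<alpha>) (ST_ring \<alpha>)"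
proof -
  have "(\<lambda>f. \<lambda>v\<in>s_space \<alpha> \<times> t_space (sum_list \<alpha>). f (fst v)) \<in> ring_hom (S_ring \<alpha>) (ST_ring \<alpha>)"
    unfolding ST_ring_def S_ring_def
  proof (rule polynomial_ring_pullback)
    fix f assume "f \<in> {z_coord \<alpha> j | j. j \<in> {1..length \<alpha>}}"
    then obtain j where j: "j \<in> {1..length \<alpha>}" "f = z_coord \<alpha> j"
      by blast
    then show "\<exists>f'\<in>polynomial_maps ({\<lambda>(h, t). z_coord \<alpha> j h | j. j \<in> {1..length \<alpha>}} \<union>
        {\<lambda>(h, t). t i | i. i \<in> {1..sum_list \<alpha>}}).
        \<forall>v\<in>s_space \<alpha> \<times> t_space (sum_list \<alpha>). f (fst v) = f' v"
      by (intro bexI[of _ "\<lambda>(h, t). z_coord \<alpha> j h"] polynomial_maps.coord) auto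
  qed auto
  then show ?thesis
    by (simp add: case_prod_unfold)
qed

lemma module_A_algebra: "module (S_ring \<alpha>) (A_algebra \<alpha>)"
  unfolding A_algebra_def
proof (rule module_algebra_of_hom)
  have "A_class \<alpha> \<circ> (\<lambda>f. \<lambda>(h, t)\<in>s_space \<alpha> \<times> t_space (sum_list \<alpha>). f h)
      \<in> ring_hom (S_ring \<alpha>) (ST_ring \<alpha> Quot vanishing_ideal \<alpha>)"
    by (rule ring_hom_trans[OF base_pullback_hom A_class_ring_hom])
  then show "ring_hom_cring (S_ring \<alpha>) (ST_ring \<alpha> Quot vanishing_ideal \<alpha>)
      (\<lambda>f. A_class \<alpha> (\<lambda>(h, t)\<in>s_space \<alpha> \<times> t_space (sum_list \<alpha>). f h))"
    by (intro ring_hom_cring.intro ring_hom_cring_axioms.intro S.is_cring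
        I.quotient_is_cring ST.is_cring) (simp add: comp_def)
qed

text \<open>A coset is mapped to a single value because the ideal lies in the kernel of every \<open>\<phi>\<^sub>w\<close>.\<close>

lemma phi_A_class:
  assumes w: "w permutes {1..n}" and F: "F \<in> carrier (ST_ring \<alpha>)"
  shows "phi_A \<alpha> w (A_class \<alpha> F) = phi \<alpha> w F"
proof -
  interpret phi: ring_hom_cring "ST_ring \<alpha>" "S_ring \<alpha>" "phi \<alpha> w"
    by (rule phi_hom_cring[OF w])
  have ker: "phi \<alpha> w v = \<zero>\<^bsub>S_ring \<alpha>\<^esub>" if "v \<in> vanishing_ideal \<alpha>" for v
    using that w unfolding vanishing_ideal_eq a_kernel_def' by blast
  have "phi \<alpha> w G = phi \<alpha> w F" if G: "G \<in> A_class \<alpha> F" for G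
  proof -
    obtain v where v: "v \<in> vanishing_ideal \<alpha>" "G = v \<oplus>\<^bsub>ST_ring \<alpha>\<^esub> F"
      using G unfolding A_class_def a_r_coset_def' by blast
    then show ?thesis
      using F ker[OF v(1)] I.a_Hcarr[OF v(1)] by simp
  qed
  moreover have "F \<in> A_class \<alpha> F"
    unfolding A_class_def by (rule I.a_rcos_self[OF F])
  ultimately have "phi \<alpha> w ` A_class \<alpha> F = {phi \<alpha> w F}"
    by blast
  then show ?thesis
    by (simp add: phi_A_def)
qed

text \<open>The localization is \<open>S(s\<^sup>*)\<close>-linear on the coordinate ring, since functions pulled back from the
  first factor are fixed by \<open>\<phi>\<^sub>w\<close>; it therefore extends to the tensor product with \<open>Q(s\<^sup>*)\<close>.\<close>

lemma base_change_map_phi: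
  assumes w: "w permutes {1..n}"
  shows "base_change_map (S_ring \<alpha>) (Q_field \<alpha>) (of_base (S_ring \<alpha>)) (A_algebra \<alpha>)
    (\<lambda>X. of_base (S_ring \<alpha>) (phi_A \<alpha> w X))"
proof -
  interpret A: module "S_ring \<alpha>" "A_algebra \<alpha>"
    by (rule module_A_algebra)
  interpret phi: ring_hom_cring "ST_ring \<alpha>" "S_ring \<alpha>" "phi \<alpha> w"
    by (rule phi_hom_cring[OF w])
  interpret cls: ring_hom_ring "ST_ring \<alpha>" "ST_ring \<alpha> Quot vanishing_ideal \<alpha>" "A_class \<alpha>"
    by (intro ring_hom_ringI2 ST.ring_axioms I.quotient_is_ring A_class_ring_hom)
  have cases: "\<exists>F\<in>carrier (ST_ring \<alpha>). x = A_class \<alpha> F" if "x \<in> carrier (A_algebra \<alpha>)" for x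
    using that unfolding A_algebra_carrier by blast
  have add: "phi_A \<alpha> w (x \<oplus>\<^bsub>A_algebra \<alpha>\<^esub> y) = phi_A \<alpha> w x \<oplus>\<^bsub>S_ring \<alpha>\<^esub> phi_A \<alpha> w y"
    if xy: "x \<in> carrier (A_algebra \<alpha>)" "y \<in> carrier (A_algebra \<alpha>)" for x y
  proof -
    obtain F G where F: "F \<in> carrier (ST_ring \<alpha>)" "x = A_class \<alpha> F"
        and G: "G \<in> carrier (ST_ring \<alpha>)" "y = A_class \<alpha> G"
      using cases[OF xy(1)] cases[OF xy(2)] by blast
    have "x \<oplus>\<^bsub>A_algebra \<alpha>\<^esub> y = A_class \<alpha> (F \<oplus>\<^bsub>ST_ring \<alpha>\<^esub> G)"
      using F G by (simp add: A_algebra_def algebra_of_hom_def)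
    then have "phi_A \<alpha> w (x \<oplus>\<^bsub>A_algebra \<alpha>\<^esub> y) = phi \<alpha> w (F \<oplus>\<^bsub>ST_ring \<alpha>\<^esub> G)"
      using phi_A_class[OF w ST.a_closed[OF F(1) G(1)]] by (simp only:)
    then show ?thesis
      using F G by (simp add: phi_A_class[OF w])
  qed
  have smult: "phi_A \<alpha> w (r \<odot>\<^bsub>A_algebra \<alpha>\<^esub> x) = r \<otimes>\<^bsub>S_ring \<alpha>\<^esub> phi_A \<alpha> w x"
    if r: "r \<in> carrier (S_ring \<alpha>)" and x: "x \<in> carrier (A_algebra \<alpha>)" for r x
  proof -
    obtain F where F: "F \<in> carrier (ST_ring \<alpha>)" "x = A_class \<alpha> F"
      using cases[OF x] by blast
    define r' where "r' = (\<lambda>(h, t)\<in>s_space \<alpha> \<times> t_space (sum_list \<alpha>). r h)"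
    have r': "r' \<in> carrier (ST_ring \<alpha>)"
      using ring_hom_closed[OF base_pullback_hom r] by (simp add: r'_def)
    have "r \<odot>\<^bsub>A_algebra \<alpha>\<^esub> x = A_class \<alpha> (r' \<otimes>\<^bsub>ST_ring \<alpha>\<^esub> F)"
      using F r' by (simp add: A_algebra_def algebra_of_hom_def r'_def)
    then have "phi_A \<alpha> w (r \<odot>\<^bsub>A_algebra \<alpha>\<^esub> x) = phi \<alpha> w (r' \<otimes>\<^bsub>ST_ring \<alpha>\<^esub> F)"
      using phi_A_class[OF w ST.m_closed[OF r' F(1)]] by (simp only:)
    moreover have "phi \<alpha> w r' = r"
    proof -
      have "r' (h, perm_act w h) = r h" if "h \<in> s_space \<alpha>" for h
        using that perm_act_t_space[OF w, of h] by (simp add: r'_def s_space_def sum_\<alpha>)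
      then have "phi \<alpha> w r' = (\<lambda>h\<in>s_space \<alpha>. r h)"
        unfolding phi_def by (intro restrict_ext)
      also have "\<dots> = r"
        using r unfolding S_ring_def by (elim polynomial_ring_cases) auto
      finally show ?thesis .
    qed
    ultimately show ?thesis
      using F r' by (simp add: phi_A_class[OF w])
  qed
  have closed: "phi_A \<alpha> w x \<in> carrier (S_ring \<alpha>)" if "x \<in> carrier (A_algebra \<alpha>)" for x
    using cases[OF that] phi_A_class[OF w] by auto
  show ?thesis
    by unfold_locales (simp_all add: closed add smult)
qed

end

section \<open>Springer inversions and the order on tableaux\<close>

lemma concat_row_unique:
  assumes "distinct (concat T)" "a < length T" "b < length T" "x \<in> set (T ! a)" "x \<in> set (T ! b)"
  shows "a = b"
proof -
  have "a = b" if "a < length T" "b < length T" "a \<le> b" "x \<in> set (T ! a)" "x \<in> set (T ! b)" for a b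
    using assms(1) that
  proof (induction T arbitrary: a b)
    case (Cons R T)
    show ?case
    proof (cases a)
      case 0
      have "x \<in> set (concat T)" if "b = Suc c" for c
        using that Cons.prems by (auto intro: nth_mem)
      then show ?thesis
        using 0 Cons.prems by (cases b) auto
    next
      case (Suc a')
      then obtain b' where "b = Suc b'"
        using Cons.prems by (cases b) auto
      then show ?thesis
        using Suc Cons.IH[of a' b'] Cons.prems by simp
    qed
  qed simp
  then show ?thesis
    using assms(2-) by (metis nat_le_linear)
qed

lemma RSCT_D:
  assumes "T \<in> RSCT n \<beta>"
  shows "length T = length \<beta>" "sum_list \<beta> \<le> n" "distinct (concat T)"
    "set (concat T) = {n - sum_list \<beta> + 1..n}" "R \<in> set T \<Longrightarrow> sorted_wrt (>) R"
    "map length T = \<beta>"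
  using assms by (auto simp: RSCT_def)

lemma has_entry_in_row: "has_entry T j c i \<Longrightarrow> j \<in> {1..length T} \<and> i \<in> set (T ! (j - 1))"
  by (auto simp: has_entry_def)

lemma has_entry_in_concat: "has_entry T j c i \<Longrightarrow> i \<in> set (concat T)"
  using has_entry_in_row[of T j c i] by (auto intro!: bexI[of _ "T ! (j - 1)"])

lemma RSCT_has_entry_iff:
  assumes "T \<in> RSCT n \<beta>"
  shows "(\<exists>j c. has_entry T j c i) \<longleftrightarrow> i \<in> {n - sum_list \<beta> + 1..n}"
proof
  assume "\<exists>j c. has_entry T j c i"
  then show "i \<in> {n - sum_list \<beta> + 1..n}"
    using has_entry_in_concat RSCT_D(4)[OF assms] by blast
next
  assume "i \<in> {n - sum_list \<beta> + 1..n}"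
  then have "i \<in> set (concat T)"
    using RSCT_D(4)[OF assms] by blast
  then obtain R where "R \<in> set T" "i \<in> set R"
    by auto
  then obtain a c where "a < length T" "c < length (T ! a)" "T ! a ! c = i"
    by (metis in_set_conv_nth)
  then have "has_entry T (Suc a) (Suc c) i"
    by (simp add: has_entry_def)
  then show "\<exists>j c. has_entry T j c i"
    by blast
qed

lemma row_of_eq:
  assumes T: "T \<in> RSCT n \<beta>" and e: "has_entry T j c i"
  shows "row_of T i = j"
  unfolding row_of_def
proof (rule the_equality)
  show "\<exists>c. has_entry T j c i"
    using e by blast
  fix j' assume "\<exists>c. has_entry T j' c i"
  then have "j' \<in> {1..length T}" "i \<in> set (T ! (j' - 1))"
    using has_entry_in_row by blast+
  moreover have "j \<in> {1..length T}" "i \<in> set (T ! (j - 1))"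
    using has_entry_in_row[OF e] by blast+
  moreover from calculation have "j' - 1 = j - 1"
    by (intro concat_row_unique[OF RSCT_D(3)[OF T], of _ _ i]) auto
  ultimately show "j' = j"
    by auto
qed

lemma springer_Inv_ranges:
  assumes T: "T \<in> RSCT n \<beta>" and "(i, j) \<in> springer_Inv T"
  shows "i \<in> {n - sum_list \<beta> + 1..n}" "j \<in> {1..length \<beta>}"
proof -
  obtain r c j' c' where "has_entry T r c i" "has_entry T j c' j'"
    using assms(2) by (auto simp: springer_Inv_def)
  then show "i \<in> {n - sum_list \<beta> + 1..n}" "j \<in> {1..length \<beta>}"
    using RSCT_has_entry_iff[OF T] RSCT_D(1)[OF T] by (auto simp: has_entry_def)
qed

text \<open>An inversion \<open>(i, j)\<close> is witnessed by an entry \<open>j' > i\<close> of row \<open>j\<close>. If \<open>i\<close> were in that row too, then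
  \<open>j'\<close> would be strictly to its right, against the decrease along rows.\<close>

lemma springer_Inv_row_neq:
  assumes T: "T \<in> RSCT n \<beta>" and ij: "(i, j) \<in> springer_Inv T"
  shows "row_of T i \<noteq> j"
proof
  assume row: "row_of T i = j"
  obtain r c j' c' where e: "has_entry T r c i" "has_entry T j c' j'" and lt: "i < j'"
      and pos: "c' = c \<and> j < r \<or> c < c'"
    using ij by (auto simp: springer_Inv_def)
  have r: "r = j"
    using row_of_eq[OF T e(1)] row by simp
  then have "c < c'"
    using pos by blast
  let ?R = "T ! (j - 1)"
  have "?R \<in> set T"
    using e(2) by (auto simp: has_entry_def)
  then have "sorted_wrt (>) ?R"
    by (rule RSCT_D(5)[OF T])
  then have "?R ! (c - 1) > ?R ! (c' - 1)"
    using e r \<open>c < c'\<close> by (intro sorted_wrt_nth_less[of "(>)"]) (auto simp: has_entry_def)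
  then show False
    using e r lt by (simp add: has_entry_def)
qed

text \<open>If the minimal entry occurs in a row, it ends the row, so deleting it moves no other entry.\<close>

lemma removeAll_min_decreasing:
  assumes "sorted_wrt (>) R" "\<forall>x\<in>set R. (m :: nat) \<le> x"
  shows "\<exists>k. removeAll m R = take k R"
  using assms
proof (induction R)
  case (Cons x R)
  show ?case
  proof (cases "x = m")
    case True
    then have "R = []"
      using Cons.prems by (cases R) force+
    then show ?thesis
      using True by (auto intro: exI[of _ 0])
  next
    case False
    obtain k where "removeAll m R = take k R"
      using Cons by auto
    then show ?thesis
      using False by (intro exI[of _ "Suc k"]) simp
  qed
qed simp

lemma has_entry_eta:
  assumes T: "T \<in> RSCT n \<beta>" and e: "has_entry (eta n T) j c i"
  shows "has_entry T j c i"
proof -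
  let ?m = "min_entry n (map length T)"
  have j: "j \<in> {1..length T}"
    using e by (simp add: has_entry_def eta_def)
  let ?R = "T ! (j - 1)"
  have R: "?R \<in> set T"
    using j by auto
  have "\<forall>x\<in>set ?R. ?m \<le> x"
    using R RSCT_D(4,6)[OF T] unfolding min_entry_def by (auto simp: set_concat)
  then obtain k where k: "removeAll ?m ?R = take k ?R"
    using removeAll_min_decreasing[OF RSCT_D(5)[OF T R]] by blast
  have "j - 1 < length T"
    using j by auto
  then have "eta n T ! (j - 1) = take k ?R"
    using k by (simp add: eta_def)
  then show ?thesis
    using e j by (auto simp: has_entry_def)
qed

lemma springer_Inv_eta:
  assumes "T \<in> RSCT n \<beta>"
  shows "springer_Inv (eta n T) \<subseteq> springer_Inv T"
  using has_entry_eta[OF assms] unfolding springer_Inv_def by blast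

text \<open>If the minimal entries lie in different rows, the order provides the inversion directly.
  Otherwise deleting the minimal entry keeps the columns of all other entries, so an inversion found
  for the smaller tableaux persists. The statement asks for a position of \<open>i\<close> in \<open>U\<close>, and not for
  \<open>row_of U i = j\<close>, because positions pass from \<open>eta n U\<close> to \<open>U\<close> unchanged.\<close>

lemma rsct_less_inversion:
  assumes "rsct_less n \<beta> U T"
  shows "\<exists>i j c. (i, j) \<in> springer_Inv T \<and> has_entry U j c i"
  using assms
proof (induction rule: rsct_less.induct)
  case (diff_row T \<beta> U)
  let ?m = "min_entry n \<beta>"
  have "?m \<in> {n - sum_list \<beta> + 1..n}"
    using diff_row.hyps(3) RSCT_D(2)[OF diff_row.hyps(1)] by (auto simp: min_entry_def)
  then obtain j c where "has_entry U j c ?m"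
    using RSCT_has_entry_iff[OF diff_row.hyps(2)] by blast
  then show ?case
    using diff_row.hyps(5) row_of_eq[OF diff_row.hyps(2)] by metis
next
  case (same_row T \<beta> U)
  then show ?case
    using springer_Inv_eta has_entry_eta by (metis subsetD)
qed

section \<open>Minimal coset representatives of tableaux\<close>

text \<open>Relabelling positions by the transposition embeds the inversions of the new permutation into
  those of \<open>w\<close>, and misses the descent \<open>(k, k + 1)\<close> itself.\<close>

lemma perm_length_swap_descent:
  assumes w: "w permutes {1..n}" and k: "k \<in> {1..n}" "Suc k \<in> {1..n}" and desc: "w (Suc k) < w k"
  shows "perm_length n (w \<circ> transpose k (Suc k)) < perm_length n w"
proof -
  define s where "s = transpose k (Suc k)"
  define I where "I u = {(i, j). i \<in> {1..n} \<and> j \<in> {1..n} \<and> i < j \<and> u j < u i}" for u :: "nat \<Rightarrow> nat"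
  have fin: "finite (I u)" for u
    by (rule finite_subset[of _ "{1..n} \<times> {1..n}"]) (auto simp: I_def)
  have ss: "s (s i) = i" for i
    by (simp add: s_def)
  have sn: "s i \<in> {1..n}" if "i \<in> {1..n}" for i
    using that k by (auto simp: s_def transpose_def)
  have "map_prod s s ` I (w \<circ> s) \<subseteq> I w - {(k, Suc k)}"
  proof (rule image_subsetI)
    fix p assume "p \<in> I (w \<circ> s)"
    then obtain a b where p: "p = (a, b)"
        and ab: "a \<in> {1..n}" "b \<in> {1..n}" "a < b" "w (s b) < w (s a)"
      by (auto simp: I_def)
    have "\<not> (a = k \<and> b = Suc k)"
      using ab(4) desc by (auto simp: s_def)
    then have "s a < s b"
      using ab(3) by (auto simp: s_def transpose_def)
    moreover have "(s a, s b) \<noteq> (k, Suc k)"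
      using ab(3) by (auto simp: s_def transpose_def split: if_splits)
    ultimately show "map_prod s s p \<in> I w - {(k, Suc k)}"
      using ab(4) sn[OF ab(1)] sn[OF ab(2)] by (simp add: I_def p)
  qed
  moreover have "(k, Suc k) \<in> I w"
    using k desc by (simp add: I_def)
  ultimately have "card (map_prod s s ` I (w \<circ> s)) < card (I w)"
    using fin by (intro psubset_card_mono) auto
  moreover have "inj_on (map_prod s s) (I (w \<circ> s))"
    by (rule inj_onI) (metis ss map_prod_simp prod.collapse prod.inject)
  ultimately have "card (I (w \<circ> s)) < card (I w)"
    by (simp add: card_image)
  then show ?thesis
    by (simp add: perm_length_def I_def s_def)
qed

text \<open>The combinatorial form of \<open>w \<cdot> h = h\<^sub>T\<close>: every position \<open>k\<close> in block \<open>j\<close> is sent to an entry of row \<open>j\<close>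
  of \<open>T\<close>.\<close>

definition row_adapted :: "nat list \<Rightarrow> tableau \<Rightarrow> (nat \<Rightarrow> nat) \<Rightarrow> bool" where
  "row_adapted \<alpha> T w \<longleftrightarrow> w permutes {1..sum_list \<alpha>} \<and>
     (\<forall>k\<in>{1..sum_list \<alpha>}. k \<in> block \<alpha> (row_of T (w k)))"

lemma concat_nth_row:
  assumes "a < length T" "c < length (T ! a)"
  shows "sum_list (map length (take a T)) + c < length (concat T)"
    and "concat T ! (sum_list (map length (take a T)) + c) = T ! a ! c"
proof -
  have "concat T = concat (take a T) @ (T ! a) @ concat (drop (Suc a) T)"
    using id_take_nth_drop[OF assms(1)] by (metis concat.simps(2) concat_append)
  moreover have "length (concat (take a T)) = sum_list (map length (take a T))"
    by (simp add: length_concat)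
  ultimately show "sum_list (map length (take a T)) + c < length (concat T)"
    and "concat T ! (sum_list (map length (take a T)) + c) = T ! a ! c"
    using assms(2) by (simp_all add: nth_append)
qed

context springer_composition
begin

lemma row_of_range:
  assumes T: "T \<in> RSCT n \<alpha>" and i: "i \<in> {1..n}"
  obtains c where "has_entry T (row_of T i) c i" "row_of T i \<in> {1..length \<alpha>}"
proof -
  have "\<exists>j c. has_entry T j c i"
    using RSCT_has_entry_iff[OF T] i by (simp add: sum_\<alpha>)
  then obtain j c where e: "has_entry T j c i"
    by blast
  then have "row_of T i = j"
    by (rule row_of_eq[OF T])
  then show ?thesis
    using e RSCT_D(1)[OF T] by (intro that[of c]) (auto simp: has_entry_def)
qed

text \<open>The word obtained by reading the rows from top to bottom, viewed as a permutation in one-line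
  notation, sends the positions of block \<open>j\<close> to the entries of row \<open>j\<close>.\<close>

lemma row_adapted_exists:
  assumes T: "T \<in> RSCT n \<alpha>"
  shows "\<exists>w. row_adapted \<alpha> T w"
proof -
  define w where "w k = (if k \<in> {1..n} then concat T ! (k - 1) else k)" for k
  have len: "length (concat T) = n"
    using RSCT_D(6)[OF T] by (simp add: length_concat sum_\<alpha>)
  have "bij_betw (\<lambda>k. k - 1) {1..n} {..<n}"
    by (rule bij_betw_byWitness[where f' = Suc]) auto
  moreover have "bij_betw ((!) (concat T)) {..<n} {1..n}"
    using RSCT_D(3,4)[OF T] bij_betw_nth[of "concat T" "{..<n}" "{1..n}"] len by (simp add: sum_\<alpha>)
  ultimately have "bij_betw ((!) (concat T) \<circ> (\<lambda>k. k - 1)) {1..n} {1..n}"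
    by (rule bij_betw_trans)
  then have "bij_betw w {1..n} {1..n}"
    by (rule iffD1[OF bij_betw_cong, rotated]) (simp add: w_def)
  then have w: "w permutes {1..n}"
    by (rule bij_imp_permutes) (auto simp: w_def)
  moreover have "k \<in> block \<alpha> (row_of T (w k))" if k: "k \<in> {1..n}" for k
  proof -
    obtain c where e: "has_entry T (row_of T (w k)) c (w k)" and row: "row_of T (w k) \<in> {1..length \<alpha>}"
      using row_of_range[OF T] permutes_in_image[OF w] k by blast
    define a where "a = row_of T (w k) - 1"
    have a: "a < length T" "row_of T (w k) = Suc a" "c - 1 < length (T ! a)" "T ! a ! (c - 1) = w k" "1 \<le> c"
      using e row RSCT_D(1)[OF T] by (auto simp: has_entry_def a_def)
    \<comment> \<open>The position of the \<open>c\<close>-th entry of row \<open>a + 1\<close> in the reading word, counted from \<open>1\<close>.\<close>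
    define k' where "k' = Suc (sum_list (take a \<alpha>) + (c - 1))"
    have "sum_list (map length (take a T)) = sum_list (take a \<alpha>)"
      using RSCT_D(6)[OF T] by (metis take_map)
    then have "k' \<in> {1..n}" "w k' = w k"
      using concat_nth_row[OF a(1,3)] a(4) len by (auto simp: k'_def w_def)
    then have "k' = k"
      using permutes_inj[OF w] by (metis injD)
    moreover have "take (Suc a) \<alpha> = take a \<alpha> @ [length (T ! a)]"
      using RSCT_D(6)[OF T] a(1) by (metis length_map nth_map take_Suc_conv_app_nth)
    ultimately show ?thesis
      using a by (auto simp: block_def k'_def)
  qed
  ultimately show ?thesis
    unfolding row_adapted_def sum_\<alpha> by blast
qed

lemma row_adapted_moves:
  assumes T: "T \<in> RSCT n \<alpha>" and w: "row_adapted \<alpha> T w" and h: "h \<in> s_space \<alpha>"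
  shows "perm_act w h = h_tab \<alpha> T h"
proof
  fix i
  have perm: "w permutes {1..n}"
    using w by (simp add: row_adapted_def sum_\<alpha>)
  show "perm_act w h i = h_tab \<alpha> T h i"
  proof (cases "i \<in> {1..n}")
    case True
    define k where "k = inv_into UNIV w i"
    have "w k = i"
      unfolding k_def by (rule permutes_inverses(1)[OF perm])
    moreover have "k \<in> {1..n}"
      using permutes_in_image[OF permutes_inv[OF perm]] True by (simp add: k_def)
    ultimately have "k \<in> block \<alpha> (row_of T i)"
      using w by (auto simp: row_adapted_def sum_\<alpha>)
    then have "h k = z_coord \<alpha> (row_of T i) h"
      using row_of_range[OF T True] s_space_on_block[OF strong h] by metis
    then show ?thesis
      using True by (simp add: perm_act_def h_tab_def sum_\<alpha> k_def)
  next
    case False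
    then have "inv_into UNIV w i = i"
      by (rule permutes_not_in[OF permutes_inv[OF perm]])
    then show ?thesis
      using False h
      by (auto simp: perm_act_def h_tab_def sum_\<alpha> s_space_def t_space_def PiE_def extensional_def)
  qed
qed

text \<open>The equation \<open>w \<cdot> h = h\<^sub>T\<close> at a single point with distinct coordinates already determines the row
  of every \<open>w k\<close>.\<close>

lemma row_adapted_iff_moves:
  assumes T: "T \<in> RSCT n \<alpha>" and w: "w permutes {1..n}"
  shows "row_adapted \<alpha> T w \<longleftrightarrow>
    (\<forall>h\<in>s_space \<alpha>. inj_on (\<lambda>j. z_coord \<alpha> j h) {1..length \<alpha>} \<longrightarrow> perm_act w h = h_tab \<alpha> T h)"
    (is "_ \<longleftrightarrow> ?moves")
proof
  assume "row_adapted \<alpha> T w"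
  then show ?moves
    using row_adapted_moves[OF T] by blast
next
  assume ?moves
  obtain h where h: "h \<in> s_space \<alpha>" and inj: "inj_on (\<lambda>j. z_coord \<alpha> j h) {1..length \<alpha>}"
    using s_space_generic[OF strong] by blast
  have eq: "perm_act w h = h_tab \<alpha> T h"
    using \<open>?moves\<close> h inj by blast
  have "k \<in> block \<alpha> (row_of T (w k))" if k: "k \<in> {1..n}" for k
  proof -
    obtain j where j: "j \<in> {1..length \<alpha>}" "k \<in> block \<alpha> j"
      using block_exists[of k \<alpha>] k by (auto simp: sum_\<alpha>)
    have wk: "w k \<in> {1..n}"
      using permutes_in_image[OF w] k by blast
    have "z_coord \<alpha> j h = h k"
      using s_space_on_block[OF strong h j] by simp
    also have "\<dots> = perm_act w h (w k)"
      using permutes_inverses(2)[OF w] by (simp add: perm_act_def)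
    also have "\<dots> = z_coord \<alpha> (row_of T (w k)) h"
      using eq wk by (simp add: h_tab_def sum_\<alpha>)
    finally have "j = row_of T (w k)"
      using row_of_range[OF T wk] inj j(1) by (metis inj_onD)
    then show ?thesis
      using j(2) by simp
  qed
  then show "row_adapted \<alpha> T w"
    using w by (simp add: row_adapted_def sum_\<alpha>)
qed

text \<open>A descent inside a block could be removed by a transposition from the Young subgroup, which would
  shorten \<open>w\<close>.\<close>

lemma min_coset_rep_increasing:
  assumes w: "min_coset_rep \<alpha> w" and j: "j \<in> {1..length \<alpha>}"
    and ab: "a \<in> block \<alpha> j" "b \<in> block \<alpha> j" "a < b"
  shows "w a < w b"
proof -
  have perm: "w permutes {1..n}"
    using w by (simp add: min_coset_rep_def sum_\<alpha>)
  have step: "w k < w (Suc k)" if k: "k \<in> block \<alpha> j" "Suc k \<in> block \<alpha> j" for k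
  proof (rule ccontr)
    assume "\<not> w k < w (Suc k)"
    moreover have "w k \<noteq> w (Suc k)"
      using permutes_inj[OF perm] by (metis injD n_not_Suc_n)
    ultimately have desc: "w (Suc k) < w k"
      by simp
    have kn: "k \<in> {1..n}" "Suc k \<in> {1..n}"
      using k block_subset[of \<alpha> j] by (auto simp: sum_\<alpha>)
    have "transpose k (Suc k) ` block \<alpha> i = block \<alpha> i" if i: "i \<in> {1..length \<alpha>}" for i
    proof (cases "i = j")
      case True
      then show ?thesis
        using k by (intro permutes_image permutes_swap_id) auto
    next
      case False
      then have "k \<notin> block \<alpha> i" "Suc k \<notin> block \<alpha> i"
        using block_unique[of _ \<alpha> i j] i j k by auto
      then have "transpose k (Suc k) x = x" if "x \<in> block \<alpha> i" for x
        using that by (auto simp: transpose_def)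
      then show ?thesis
        by simp
    qed
    then have "transpose k (Suc k) \<in> young_subgroup \<alpha>"
      using kn by (auto simp: young_subgroup_def sum_\<alpha> intro!: permutes_swap_id)
    then have "perm_length n w \<le> perm_length n (w \<circ> transpose k (Suc k))"
      using w unfolding min_coset_rep_def sum_\<alpha> by blast
    then show False
      using perm_length_swap_descent[OF perm kn desc] by simp
  qed
  have "w a < w (a + Suc d)" if "a + Suc d \<in> block \<alpha> j" for d
    using that
  proof (induction d)
    case 0
    then show ?case
      using step ab(1) by simp
  next
    case (Suc d)
    then have "a + Suc d \<in> block \<alpha> j"
      using ab(1) by (auto simp: block_def)
    then show ?case
      using Suc.IH step[of "a + Suc d"] Suc.prems by auto
  qed
  from this[of "b - a - 1"] show ?thesis
    using ab by simp
qed

lemma row_adapted_comp_young: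
  assumes T: "T \<in> RSCT n \<alpha>" and w: "row_adapted \<alpha> T w" and v: "v \<in> young_subgroup \<alpha>"
  shows "row_adapted \<alpha> T (w \<circ> v)"
proof -
  have perm: "w permutes {1..n}" "v permutes {1..n}"
    using w v by (simp_all add: row_adapted_def young_subgroup_def sum_\<alpha>)
  have "k \<in> block \<alpha> (row_of T (w (v k)))" if k: "k \<in> {1..n}" for k
  proof -
    obtain j where j: "j \<in> {1..length \<alpha>}" "k \<in> block \<alpha> j"
      using block_exists[of k \<alpha>] k by (auto simp: sum_\<alpha>)
    then have "v k \<in> block \<alpha> j"
      using v unfolding young_subgroup_def by blast
    moreover have vk: "v k \<in> {1..n}" "w (v k) \<in> {1..n}"
      using permutes_in_image[OF perm(2)] permutes_in_image[OF perm(1)] k by blast+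
    then have "v k \<in> block \<alpha> (row_of T (w (v k)))" "row_of T (w (v k)) \<in> {1..length \<alpha>}"
      using w row_of_range[OF T] by (auto simp: row_adapted_def sum_\<alpha>)
    ultimately have "row_of T (w (v k)) = j"
      using j(1) by (intro block_unique[of "v k" \<alpha>]) simp_all
    then show ?thesis
      using j(2) by simp
  qed
  then show ?thesis
    using perm by (simp add: row_adapted_def sum_\<alpha> permutes_compose)
qed

text \<open>Both permutations map each block onto the entries of the same row, and increasingly so; two
  increasing enumerations of one finite set agree. The proof compares the values at the first
  position of a block where the two could differ.\<close>

lemma row_adapted_increasing_unique:
  assumes T: "T \<in> RSCT n \<alpha>" and u: "row_adapted \<alpha> T u" "min_coset_rep \<alpha> u"
    and w: "row_adapted \<alpha> T w" "min_coset_rep \<alpha> w"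
  shows "u = w"
proof -
  have perm: "u permutes {1..n}" "w permutes {1..n}"
    using u(1) w(1) by (simp_all add: row_adapted_def sum_\<alpha>)
  have block_row: "v k \<in> {1..n}" "row_of T (v k) = j"
    if v: "row_adapted \<alpha> T v" and k: "j \<in> {1..length \<alpha>}" "k \<in> block \<alpha> j" for v j k
  proof -
    have kn: "k \<in> {1..n}"
      using k block_subset[of \<alpha> j] by (auto simp: sum_\<alpha>)
    have "v permutes {1..n}"
      using v by (simp add: row_adapted_def sum_\<alpha>)
    from permutes_in_image[OF this] kn show vk: "v k \<in> {1..n}"
      by blast
    have "k \<in> block \<alpha> (row_of T (v k))" "row_of T (v k) \<in> {1..length \<alpha>}"
      using v kn row_of_range[OF T vk] by (auto simp: row_adapted_def sum_\<alpha>)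
    then show "row_of T (v k) = j"
      using k by (intro block_unique[of k \<alpha>]) simp_all
  qed
  have le: "b k \<le> a k"
    if a: "row_adapted \<alpha> T a" and b: "row_adapted \<alpha> T b" "min_coset_rep \<alpha> b"
      and eq: "\<And>i. i \<in> block \<alpha> j \<Longrightarrow> i < k \<Longrightarrow> a i = b i"
      and k: "j \<in> {1..length \<alpha>}" "k \<in> block \<alpha> j" for a b j k
  proof -
    have permb: "b permutes {1..n}" and perma: "a permutes {1..n}"
      using a b by (simp_all add: row_adapted_def sum_\<alpha>)
    define i where "i = inv_into UNIV b (a k)"
    have bi: "b i = a k"
      unfolding i_def by (rule permutes_inverses(1)[OF permb])
    have "i \<in> {1..n}"
      using permutes_in_image[OF permutes_inv[OF permb]] block_row[OF a k] by (auto simp: i_def)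
    then have "i \<in> block \<alpha> (row_of T (b i))"
      using b(1) unfolding row_adapted_def sum_\<alpha> by blast
    then have i: "i \<in> block \<alpha> j"
      using bi block_row(2)[OF a k] by simp
    \<comment> \<open>A smaller \<open>i\<close> would give \<open>a i = b i = a k\<close>, against injectivity of \<open>a\<close>.\<close>
    have "\<not> i < k"
    proof
      assume "i < k"
      then have "a i = a k"
        using eq[OF i] bi by simp
      then show False
        using permutes_inj[OF perma] \<open>i < k\<close> by (metis injD less_irrefl)
    qed
    then show ?thesis
      using min_coset_rep_increasing[OF b(2) k(1) k(2) i] bi by (cases "i = k") auto
  qed
  have on_block: "u k = w k" if "j \<in> {1..length \<alpha>}" "k \<in> block \<alpha> j" for j k
    using that
  proof (induction k rule: less_induct)
    case (less k)
    then show ?case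
      using le[OF u(1) w, of j k] le[OF w(1) u, of j k] by force
  qed
  have "u k = w k" for k
  proof (cases "k \<in> {1..n}")
    case True
    then show ?thesis
      using block_exists[of k \<alpha>] on_block by (metis sum_\<alpha>)
  next
    case False
    then show ?thesis
      using permutes_not_in[OF perm(1)] permutes_not_in[OF perm(2)] by metis
  qed
  then show ?thesis
    by blast
qed

text \<open>A shortest adapted permutation is a minimal coset representative, because the adapted
  permutations are closed under the Young subgroup, and it is the only one. Hence the description
  defining \<open>w_tab\<close> is satisfied.\<close>

lemma w_tab_adapted:
  assumes T: "T \<in> RSCT n \<alpha>"
  shows "row_adapted \<alpha> T (w_tab \<alpha> T)"
proof -
  let ?moves = "\<lambda>w. \<forall>h\<in>s_space \<alpha>. inj_on (\<lambda>j. z_coord \<alpha> j h) {1..length \<alpha>} \<longrightarrow>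
    perm_act w h = h_tab \<alpha> T h"
  have iff: "min_coset_rep \<alpha> w \<and> ?moves w \<longleftrightarrow> min_coset_rep \<alpha> w \<and> row_adapted \<alpha> T w" for w
    using row_adapted_iff_moves[OF T] by (auto simp: min_coset_rep_def sum_\<alpha>)
  obtain w where w: "row_adapted \<alpha> T w"
      and least: "\<And>w'. row_adapted \<alpha> T w' \<Longrightarrow> perm_length n w \<le> perm_length n w'"
    using row_adapted_exists[OF T] ex_has_least_nat[of "row_adapted \<alpha> T" _ "perm_length n"] by blast
  have min: "min_coset_rep \<alpha> w"
    unfolding min_coset_rep_def sum_\<alpha>
    using w least row_adapted_comp_young[OF T w] by (auto simp: row_adapted_def sum_\<alpha>)
  have "w_tab \<alpha> T = w"
    unfolding w_tab_def iff
    by (rule the_equality) (use w min row_adapted_increasing_unique[OF T] in auto)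
  then show ?thesis
    using w by simp
qed

lemma w_tab_permutes: "T \<in> RSCT n \<alpha> \<Longrightarrow> w_tab \<alpha> T permutes {1..n}"
  using w_tab_adapted by (simp add: row_adapted_def sum_\<alpha>)

lemma w_tab_moves:
  "T \<in> RSCT n \<alpha> \<Longrightarrow> h \<in> s_space \<alpha> \<Longrightarrow> perm_act (w_tab \<alpha> T) h = h_tab \<alpha> T h"
  by (rule row_adapted_moves[OF _ w_tab_adapted])

end

section \<open>Localizations of the Springer basis and the coefficient formula\<close>

context springer_composition
begin

definition P_fun :: "tableau \<Rightarrow> (nat \<Rightarrow> complex) \<times> (nat \<Rightarrow> complex) \<Rightarrow> complex" where
  "P_fun T = (\<lambda>(h, t)\<in>s_space \<alpha> \<times> t_space (sum_list \<alpha>).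
     \<Prod>(i, j)\<in>springer_Inv T. t i - z_coord \<alpha> j h)"

lemma P_elt_eq: "P_elt \<alpha> T = A_class \<alpha> (P_fun T)"
  by (simp add: P_elt_def P_fun_def)

lemma P_fun_closed:
  assumes T: "T \<in> RSCT n \<alpha>"
  shows "P_fun T \<in> carrier (ST_ring \<alpha>)"
proof -
  let ?G = "{\<lambda>(h, t). z_coord \<alpha> j h | j. j \<in> {1..length \<alpha>}} \<union> {\<lambda>(h, t). t i | i. i \<in> {1..sum_list \<alpha>}}"
  let ?f = "\<lambda>p v. snd v (fst p) - z_coord \<alpha> (snd p) (fst v)"
  have "?f p \<in> polynomial_maps ?G" if p: "p \<in> springer_Inv T" for p
  proof (rule polynomial_maps_diff)
    obtain i j where ij: "p = (i, j)" "(i, j) \<in> springer_Inv T"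
      using p by (cases p) auto
    have "i \<in> {1..sum_list \<alpha>}" "j \<in> {1..length \<alpha>}"
      using springer_Inv_ranges[OF T ij(2)] by (simp_all add: sum_\<alpha>)
    then show "(\<lambda>v. snd v (fst p)) \<in> polynomial_maps ?G"
        "(\<lambda>v. z_coord \<alpha> (snd p) (fst v)) \<in> polynomial_maps ?G"
      using ij(1) by (auto simp: case_prod_unfold intro!: polynomial_maps.coord)
  qed
  then have "(\<lambda>v. \<Prod>p\<in>springer_Inv T. ?f p v) \<in> polynomial_maps ?G"
    by (rule polynomial_maps_prod)
  then show ?thesis
    unfolding ST_ring_def P_fun_def
    using polynomial_ring_closed[of "\<lambda>v. \<Prod>p\<in>springer_Inv T. ?f p v" ?G]
    by (simp add: case_prod_unfold)
qed

lemma P_elt_closed: "T \<in> RSCT n \<alpha> \<Longrightarrow> P_elt \<alpha> T \<in> carrier (A_algebra \<alpha>)"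
  by (simp add: P_elt_eq A_algebra_carrier P_fun_closed)

lemma finite_springer_Inv:
  assumes "T \<in> RSCT n \<alpha>"
  shows "finite (springer_Inv T)"
  by (rule finite_subset[of _ "{1..n} \<times> {1..length \<alpha>}"])
    (use springer_Inv_ranges[OF assms] in \<open>auto simp: sum_\<alpha>\<close>)

lemma phi_P:
  assumes U: "U \<in> RSCT n \<alpha>" and T: "T \<in> RSCT n \<alpha>"
  shows "phi_A \<alpha> (w_tab \<alpha> U) (P_elt \<alpha> T) =
    (\<lambda>h\<in>s_space \<alpha>. \<Prod>(i, j)\<in>springer_Inv T. z_coord \<alpha> (row_of U i) h - z_coord \<alpha> j h)"
proof -
  have "P_fun T (h, perm_act (w_tab \<alpha> U) h) =
      (\<Prod>(i, j)\<in>springer_Inv T. z_coord \<alpha> (row_of U i) h - z_coord \<alpha> j h)" if h: "h \<in> s_space \<alpha>" for h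
  proof -
    have "perm_act (w_tab \<alpha> U) h \<in> t_space (sum_list \<alpha>)"
      using perm_act_t_space[OF w_tab_permutes[OF U]] h by (simp add: s_space_def sum_\<alpha>)
    then have "P_fun T (h, perm_act (w_tab \<alpha> U) h) =
        (\<Prod>(i, j)\<in>springer_Inv T. h_tab \<alpha> U h i - z_coord \<alpha> j h)"
      using h w_tab_moves[OF U h] by (simp add: P_fun_def)
    also have "\<dots> = (\<Prod>(i, j)\<in>springer_Inv T. z_coord \<alpha> (row_of U i) h - z_coord \<alpha> j h)"
      using springer_Inv_ranges(1)[OF T]
      by (intro prod.cong) (auto simp: h_tab_def sum_\<alpha>)
    finally show ?thesis .
  qed
  then show ?thesis
    unfolding P_elt_eq phi_A_class[OF w_tab_permutes[OF U] P_fun_closed[OF T]] phi_def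
    by (intro restrict_ext)
qed

text \<open>The inversion from \<open>rsct_less_inversion\<close> contributes the factor \<open>z\<^sub>j - z\<^sub>j = 0\<close>.\<close>

lemma phi_P_smaller:
  assumes less: "rsct_less n \<alpha> U T" and U: "U \<in> RSCT n \<alpha>" and T: "T \<in> RSCT n \<alpha>"
  shows "phi_A \<alpha> (w_tab \<alpha> U) (P_elt \<alpha> T) = \<zero>\<^bsub>S_ring \<alpha>\<^esub>"
proof -
  obtain i j c where ij: "(i, j) \<in> springer_Inv T" "has_entry U j c i"
    using rsct_less_inversion[OF less] by blast
  have "row_of U i = j"
    by (rule row_of_eq[OF U ij(2)])
  then have "(\<Prod>(i, j)\<in>springer_Inv T. z_coord \<alpha> (row_of U i) h - z_coord \<alpha> j h) = 0" for h
    using ij(1) by (intro prod_zero[OF finite_springer_Inv[OF T]]) (auto intro!: bexI[of _ "(i, j)"])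
  then show ?thesis
    unfolding phi_P[OF U T] by (simp add: S_ring_def polynomial_ring_simps)
qed

text \<open>No factor vanishes at a point with distinct coordinates, by \<open>springer_Inv_row_neq\<close>.\<close>

lemma phi_P_self:
  assumes T: "T \<in> RSCT n \<alpha>"
  shows "phi_A \<alpha> (w_tab \<alpha> T) (P_elt \<alpha> T) \<noteq> \<zero>\<^bsub>S_ring \<alpha>\<^esub>"
proof
  assume zero: "phi_A \<alpha> (w_tab \<alpha> T) (P_elt \<alpha> T) = \<zero>\<^bsub>S_ring \<alpha>\<^esub>"
  obtain h where h: "h \<in> s_space \<alpha>" and inj: "inj_on (\<lambda>j. z_coord \<alpha> j h) {1..length \<alpha>}"
    using s_space_generic[OF strong] by blast
  have "(\<Prod>(i, j)\<in>springer_Inv T. z_coord \<alpha> (row_of T i) h - z_coord \<alpha> j h) = 0"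
    using fun_cong[OF zero, of h] h
    by (simp add: phi_P[OF T T] S_ring_def polynomial_ring_simps)
  then obtain i j where ij: "(i, j) \<in> springer_Inv T" "z_coord \<alpha> (row_of T i) h = z_coord \<alpha> j h"
    using finite_springer_Inv[OF T] by auto
  have "i \<in> {1..n}" "j \<in> {1..length \<alpha>}"
    using springer_Inv_ranges[OF T ij(1)] by (simp_all add: sum_\<alpha>)
  then have "row_of T i = j"
    using row_of_range[OF T] inj_onD[OF inj ij(2)] by metis
  then show False
    using springer_Inv_row_neq[OF T ij(1)] by simp
qed

definition localized_P :: "tableau \<Rightarrow> tableau \<Rightarrow> q_elt" where
  "localized_P T U = of_base (S_ring \<alpha>) (phi_A \<alpha> (w_tab \<alpha> U) (P_elt \<alpha> T))"

lemma Q_tensor_algebra: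
  "QA_algebra \<alpha> = tensor_algebra (S_ring \<alpha>) (algebra_of_hom (of_base (S_ring \<alpha>)) (Q_field \<alpha>)) (A_algebra \<alpha>)"
  "A_to_QA \<alpha> X = pure_tensor (S_ring \<alpha>) (algebra_of_hom (of_base (S_ring \<alpha>)) (Q_field \<alpha>)) (A_algebra \<alpha>)
     \<one>\<^bsub>Q_field \<alpha>\<^esub> X"
  by (simp_all add: QA_algebra_def A_to_QA_def Q_algebra_def)

lemma localized_P_closed:
  assumes "U \<in> RSCT n \<alpha>" "T \<in> RSCT n \<alpha>"
  shows "localized_P T U \<in> carrier (Q_field \<alpha>)"
proof -
  interpret L: base_change_map "S_ring \<alpha>" "Q_field \<alpha>" "of_base (S_ring \<alpha>)" "A_algebra \<alpha>"
      "\<lambda>X. of_base (S_ring \<alpha>) (phi_A \<alpha> (w_tab \<alpha> U) X)"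
    by (rule base_change_map_phi[OF w_tab_permutes[OF assms(1)]])
  show ?thesis
    unfolding localized_P_def by (rule L.g_closed[OF P_elt_closed[OF assms(2)]])
qed

lemma phi_A_P_closed:
  assumes "U \<in> RSCT n \<alpha>" "T \<in> RSCT n \<alpha>"
  shows "phi_A \<alpha> (w_tab \<alpha> U) (P_elt \<alpha> T) \<in> carrier (S_ring \<alpha>)"
  unfolding P_elt_eq phi_A_class[OF w_tab_permutes[OF assms(1)] P_fun_closed[OF assms(2)]]
  by (rule ring_hom_closed[OF phi_ring_hom[OF w_tab_permutes[OF assms(1)]] P_fun_closed[OF assms(2)]])

lemma localized_P_self_unit:
  assumes T: "T \<in> RSCT n \<alpha>"
  shows "m_inv (Q_field \<alpha>) (localized_P T T) \<in> carrier (Q_field \<alpha>)"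
    and "m_inv (Q_field \<alpha>) (localized_P T T) \<otimes>\<^bsub>Q_field \<alpha>\<^esub> localized_P T T = \<one>\<^bsub>Q_field \<alpha>\<^esub>"
proof -
  have "localized_P T T \<noteq> \<zero>\<^bsub>Q_field \<alpha>\<^esub>"
    using phi_P_self[OF T] phi_A_P_closed[OF T T]
    unfolding localized_P_def Q_field_def by (simp add: S.of_base_eq_zero_iff)
  then have "localized_P T T \<in> Units (Q_field \<alpha>)"
    using localized_P_closed[OF T T] Q.field_Units by blast
  then show "m_inv (Q_field \<alpha>) (localized_P T T) \<in> carrier (Q_field \<alpha>)"
    and "m_inv (Q_field \<alpha>) (localized_P T T) \<otimes>\<^bsub>Q_field \<alpha>\<^esub> localized_P T T = \<one>\<^bsub>Q_field \<alpha>\<^esub>"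
    by simp_all
qed

lemma phi_QA_Q_elt:
  assumes U: "U \<in> RSCT n \<alpha>" and T: "T \<in> RSCT n \<alpha>"
  shows "Q_elt \<alpha> T \<in> carrier (QA_algebra \<alpha>)"
    and "phi_QA \<alpha> (w_tab \<alpha> U) (Q_elt \<alpha> T) = m_inv (Q_field \<alpha>) (localized_P T T) \<otimes>\<^bsub>Q_field \<alpha>\<^esub> localized_P T U"
proof -
  interpret L: base_change_map "S_ring \<alpha>" "Q_field \<alpha>" "of_base (S_ring \<alpha>)" "A_algebra \<alpha>"
      "\<lambda>X. of_base (S_ring \<alpha>) (phi_A \<alpha> (w_tab \<alpha> U) X)"
    by (rule base_change_map_phi[OF w_tab_permutes[OF U]])
  have Q: "Q_elt \<alpha> T = m_inv (Q_field \<alpha>) (localized_P T T) \<odot>\<^bsub>QA_algebra \<alpha>\<^esub> A_to_QA \<alpha> (P_elt \<alpha> T)"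
    by (simp add: Q_elt_def localized_P_def)
  show "Q_elt \<alpha> T \<in> carrier (QA_algebra \<alpha>)"
    unfolding Q Q_tensor_algebra
    by (intro L.smult_closed L.pure_tensor_closed localized_P_self_unit T P_elt_closed Q.one_closed)
  show "phi_QA \<alpha> (w_tab \<alpha> U) (Q_elt \<alpha> T) = m_inv (Q_field \<alpha>) (localized_P T T) \<otimes>\<^bsub>Q_field \<alpha>\<^esub> localized_P T U"
    unfolding Q Q_tensor_algebra phi_QA_def
    using localized_P_closed[OF U T]
    by (simp add: L.linear_extension_smult L.linear_extension_pure_tensor L.pure_tensor_closed
        localized_P_self_unit T P_elt_closed flip: localized_P_def)
qed

end

locale ordered_tableaux = springer_composition +
  fixes N :: nat and \<Upsilon> :: "nat \<Rightarrow> tableau"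
  assumes tableau: "i \<in> {1..N} \<Longrightarrow> \<Upsilon> i \<in> RSCT n \<alpha>"
    and increasing: "1 \<le> i \<Longrightarrow> i < j \<Longrightarrow> j \<le> N \<Longrightarrow> rsct_less n \<alpha> (\<Upsilon> i) (\<Upsilon> j)"
begin

lemma a_mat_Q_row:
  assumes "i \<in> {1..N}" "j \<in> {1..N}"
  shows "a_mat \<alpha> \<Upsilon> F i j = m_inv (Q_field \<alpha>) (localized_P (\<Upsilon> i) (\<Upsilon> i)) \<otimes>\<^bsub>Q_field \<alpha>\<^esub> localized_P (\<Upsilon> i) (\<Upsilon> j)"
  using assms phi_QA_Q_elt(2)[OF tableau tableau] by (simp add: a_mat_def)

lemma a_mat_closed:
  assumes F: "F \<in> carrier (A_algebra \<alpha>)" and i: "i \<le> N" and j: "j \<in> {1..N}"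
  shows "a_mat \<alpha> \<Upsilon> F i j \<in> carrier (Q_field \<alpha>)"
proof (cases "i = 0")
  case True
  interpret L: base_change_map "S_ring \<alpha>" "Q_field \<alpha>" "of_base (S_ring \<alpha>)" "A_algebra \<alpha>"
      "\<lambda>X. of_base (S_ring \<alpha>) (phi_A \<alpha> (w_tab \<alpha> (\<Upsilon> j)) X)"
    by (rule base_change_map_phi[OF w_tab_permutes[OF tableau[OF j]]])
  show ?thesis
    using True L.g_closed[OF F] by (simp add: a_mat_def)
next
  case False
  then have "i \<in> {1..N}"
    using i by simp
  then show ?thesis
    using a_mat_Q_row[OF _ j] localized_P_self_unit(1)[OF tableau] localized_P_closed[OF tableau[OF j] tableau]
    by simp
qed

text \<open>The localizations of \<open>F\<close> alone determine the coefficients. Both expansions of \<open>F\<close>, in the tensor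
  product and in the coordinate ring itself, reduce to this system of equations in \<open>Q(s\<^sup>*)\<close>.\<close>

lemma coefficient_from_localizations:
  assumes k: "k \<in> {1..N}" and D: "D \<in> {1..N} \<rightarrow> carrier (Q_field \<alpha>)"
    and F: "\<And>j. j \<in> {1..N} \<Longrightarrow> of_base (S_ring \<alpha>) (phi_A \<alpha> (w_tab \<alpha> (\<Upsilon> j)) F) =
      (\<Oplus>\<^bsub>Q_field \<alpha>\<^esub>m\<in>{1..N}. D m \<otimes>\<^bsub>Q_field \<alpha>\<^esub> phi_QA \<alpha> (w_tab \<alpha> (\<Upsilon> j)) (Q_elt \<alpha> (\<Upsilon> m)))"
  shows "D k = (\<ominus>\<^bsub>Q_field \<alpha>\<^esub> \<one>\<^bsub>Q_field \<alpha>\<^esub>) [^]\<^bsub>Q_field \<alpha>\<^esub> (k - 1)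
    \<otimes>\<^bsub>Q_field \<alpha>\<^esub> ring_det (Q_field \<alpha>) k (\<lambda>i j. a_mat \<alpha> \<Upsilon> F i (j + 1))"
proof (rule Q.triangular_expansion_coefficient[OF k D])
  fix i j :: nat
  assume i: "i \<in> {1..N}"
  show "a_mat \<alpha> \<Upsilon> F i i = \<one>\<^bsub>Q_field \<alpha>\<^esub>"
    using a_mat_Q_row[OF i i] localized_P_self_unit(2)[OF tableau[OF i]] by simp
  assume j: "j \<in> {1..N}"
  note closed = localized_P_self_unit(1)[OF tableau[OF i]] localized_P_closed[OF tableau[OF j] tableau[OF i]]
  show "a_mat \<alpha> \<Upsilon> F i j \<in> carrier (Q_field \<alpha>)"
    using a_mat_Q_row[OF i j] closed by simp
  assume "j < i"
  then have "rsct_less n \<alpha> (\<Upsilon> j) (\<Upsilon> i)"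
    using i j by (intro increasing) auto
  then have "localized_P (\<Upsilon> i) (\<Upsilon> j) = \<zero>\<^bsub>Q_field \<alpha>\<^esub>"
    using phi_P_smaller[OF _ tableau[OF j] tableau[OF i]] by (simp add: localized_P_def)
  then show "a_mat \<alpha> \<Upsilon> F i j = \<zero>\<^bsub>Q_field \<alpha>\<^esub>"
    using a_mat_Q_row[OF i j] closed by simp
next
  fix j assume j: "j \<in> {1..N}"
  have "(\<Oplus>\<^bsub>Q_field \<alpha>\<^esub>m\<in>{1..N}. D m \<otimes>\<^bsub>Q_field \<alpha>\<^esub> phi_QA \<alpha> (w_tab \<alpha> (\<Upsilon> j)) (Q_elt \<alpha> (\<Upsilon> m)))
      = (\<Oplus>\<^bsub>Q_field \<alpha>\<^esub>m\<in>{1..N}. D m \<otimes>\<^bsub>Q_field \<alpha>\<^esub> a_mat \<alpha> \<Upsilon> F m j)"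
  proof (rule Q.finsum_cong')
    show "(\<lambda>m. D m \<otimes>\<^bsub>Q_field \<alpha>\<^esub> a_mat \<alpha> \<Upsilon> F m j) \<in> {1..N} \<rightarrow> carrier (Q_field \<alpha>)"
    proof
      fix m assume m: "m \<in> {1..N}"
      then have "a_mat \<alpha> \<Upsilon> F m j = phi_QA \<alpha> (w_tab \<alpha> (\<Upsilon> j)) (Q_elt \<alpha> (\<Upsilon> m))"
        by (simp add: a_mat_def)
      then show "D m \<otimes>\<^bsub>Q_field \<alpha>\<^esub> a_mat \<alpha> \<Upsilon> F m j \<in> carrier (Q_field \<alpha>)"
        using D m localized_P_self_unit(1)[OF tableau[OF m]]
          localized_P_closed[OF tableau[OF j] tableau[OF m]]
        by (simp add: phi_QA_Q_elt(2)[OF tableau[OF j] tableau[OF m]] Pi_def)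
    qed
  qed (auto simp: a_mat_def)
  then show "a_mat \<alpha> \<Upsilon> F 0 j = (\<Oplus>\<^bsub>Q_field \<alpha>\<^esub>m\<in>{1..N}. D m \<otimes>\<^bsub>Q_field \<alpha>\<^esub> a_mat \<alpha> \<Upsilon> F m j)"
    using F[OF j] by (simp add: a_mat_def)
qed

theorem coefficient_normalized:
  assumes FA: "F \<in> carrier (A_algebra \<alpha>)"
    and D: "D \<in> {1..N} \<rightarrow> carrier (Q_field \<alpha>)"
    and F: "A_to_QA \<alpha> F = (\<Oplus>\<^bsub>QA_algebra \<alpha>\<^esub>m\<in>{1..N}. D m \<odot>\<^bsub>QA_algebra \<alpha>\<^esub> Q_elt \<alpha> (\<Upsilon> m))"
    and k: "k \<in> {1..N}"
  shows "D k = (\<ominus>\<^bsub>Q_field \<alpha>\<^esub> \<one>\<^bsub>Q_field \<alpha>\<^esub>) [^]\<^bsub>Q_field \<alpha>\<^esub> (k - 1)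
    \<otimes>\<^bsub>Q_field \<alpha>\<^esub> ring_det (Q_field \<alpha>) k (\<lambda>i j. a_mat \<alpha> \<Upsilon> F i (j + 1))"
proof (rule coefficient_from_localizations[OF k D])
  fix j assume j: "j \<in> {1..N}"
  let ?\<phi> = "\<lambda>X. of_base (S_ring \<alpha>) (phi_A \<alpha> (w_tab \<alpha> (\<Upsilon> j)) X)"
  interpret L: base_change_map "S_ring \<alpha>" "Q_field \<alpha>" "of_base (S_ring \<alpha>)" "A_algebra \<alpha>" ?\<phi>
    by (rule base_change_map_phi[OF w_tab_permutes[OF tableau[OF j]]])
  have Dm: "D m \<in> carrier (Q_field \<alpha>)" if "m \<in> {1..N}" for m
    using D that by blast
  have Qm: "Q_elt \<alpha> (\<Upsilon> m) \<in> carrier L.T" if "m \<in> {1..N}" for m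
    using phi_QA_Q_elt(1)[OF tableau[OF that] tableau[OF that]] by (simp add: Q_tensor_algebra)
  have "?\<phi> F = linear_extension (Q_field \<alpha>) ?\<phi> (A_to_QA \<alpha> F)"
    using FA L.g_closed[OF FA] by (simp add: Q_tensor_algebra L.linear_extension_pure_tensor)
  also have "\<dots> = (\<Oplus>\<^bsub>Q_field \<alpha>\<^esub>m\<in>{1..N}. linear_extension (Q_field \<alpha>) ?\<phi> (D m \<odot>\<^bsub>L.T\<^esub> Q_elt \<alpha> (\<Upsilon> m)))"
    unfolding F Q_tensor_algebra(1)
    by (rule L.linear_extension_finsum) (use Dm Qm L.smult_closed in auto)
  also have "\<dots> = (\<Oplus>\<^bsub>Q_field \<alpha>\<^esub>m\<in>{1..N}.
      D m \<otimes>\<^bsub>Q_field \<alpha>\<^esub> phi_QA \<alpha> (w_tab \<alpha> (\<Upsilon> j)) (Q_elt \<alpha> (\<Upsilon> m)))"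
    unfolding phi_QA_def
    by (rule Q.finsum_cong') (use Dm Qm L.linear_extension_closed in \<open>auto simp: L.linear_extension_smult\<close>)
  finally show "?\<phi> F = \<dots>" .
qed

text \<open>Localizing \<open>F = \<Sum>\<^sub>m C\<^sub>m P\<^sub>m\<close> directly in the coordinate ring gives the system for
  \<open>D\<^sub>m = C\<^sub>m \<phi>\<^bsub>w\<^sub>m\<^esub>(P\<^sub>m)\<close>, without rewriting the expansion in the tensor product.\<close>

theorem coefficient_unnormalized:
  assumes FA: "F \<in> carrier (A_algebra \<alpha>)"
    and C: "C \<in> {1..N} \<rightarrow> carrier (S_ring \<alpha>)"
    and F: "F = (\<Oplus>\<^bsub>A_algebra \<alpha>\<^esub>m\<in>{1..N}. C m \<odot>\<^bsub>A_algebra \<alpha>\<^esub> P_elt \<alpha> (\<Upsilon> m))"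
    and k: "k \<in> {1..N}"
  shows "of_base (S_ring \<alpha>) (C k) = (\<ominus>\<^bsub>Q_field \<alpha>\<^esub> \<one>\<^bsub>Q_field \<alpha>\<^esub>) [^]\<^bsub>Q_field \<alpha>\<^esub> (k - 1)
    \<otimes>\<^bsub>Q_field \<alpha>\<^esub> m_inv (Q_field \<alpha>) (localized_P (\<Upsilon> k) (\<Upsilon> k))
    \<otimes>\<^bsub>Q_field \<alpha>\<^esub> ring_det (Q_field \<alpha>) k (\<lambda>i j. a_mat \<alpha> \<Upsilon> F i (j + 1))"
proof -
  let ?c = "\<lambda>m. of_base (S_ring \<alpha>) (C m)"
  define D where "D m = ?c m \<otimes>\<^bsub>Q_field \<alpha>\<^esub> localized_P (\<Upsilon> m) (\<Upsilon> m)" for m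
  have c: "?c m \<in> carrier (Q_field \<alpha>)" if "m \<in> {1..N}" for m
    using C that by auto
  have pc: "localized_P (\<Upsilon> m) (\<Upsilon> j) \<in> carrier (Q_field \<alpha>)" if "m \<in> {1..N}" "j \<in> {1..N}" for m j
    using localized_P_closed tableau that by blast
  have Dc: "D \<in> {1..N} \<rightarrow> carrier (Q_field \<alpha>)"
    using c pc by (auto simp: D_def)
  have Dk: "D k = (\<ominus>\<^bsub>Q_field \<alpha>\<^esub> \<one>\<^bsub>Q_field \<alpha>\<^esub>) [^]\<^bsub>Q_field \<alpha>\<^esub> (k - 1)
    \<otimes>\<^bsub>Q_field \<alpha>\<^esub> ring_det (Q_field \<alpha>) k (\<lambda>i j. a_mat \<alpha> \<Upsilon> F i (j + 1))"
  proof (rule coefficient_from_localizations[OF k Dc])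
    fix j assume j: "j \<in> {1..N}"
    let ?\<phi> = "\<lambda>X. of_base (S_ring \<alpha>) (phi_A \<alpha> (w_tab \<alpha> (\<Upsilon> j)) X)"
    interpret L: base_change_map "S_ring \<alpha>" "Q_field \<alpha>" "of_base (S_ring \<alpha>)" "A_algebra \<alpha>" ?\<phi>
      by (rule base_change_map_phi[OF w_tab_permutes[OF tableau[OF j]]])
    have "?\<phi> F = (\<Oplus>\<^bsub>Q_field \<alpha>\<^esub>m\<in>{1..N}. ?c m \<otimes>\<^bsub>Q_field \<alpha>\<^esub> localized_P (\<Upsilon> m) (\<Upsilon> j))"
      unfolding F localized_P_def using C P_elt_closed[OF tableau] by (intro L.g_finsum) auto
    also have "\<dots> = (\<Oplus>\<^bsub>Q_field \<alpha>\<^esub>m\<in>{1..N}.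
        D m \<otimes>\<^bsub>Q_field \<alpha>\<^esub> phi_QA \<alpha> (w_tab \<alpha> (\<Upsilon> j)) (Q_elt \<alpha> (\<Upsilon> m)))"
    proof (rule Q.finsum_cong')
      fix m assume m: "m \<in> {1..N}"
      note unit = localized_P_self_unit[OF tableau[OF m]]
      have "D m \<otimes>\<^bsub>Q_field \<alpha>\<^esub> phi_QA \<alpha> (w_tab \<alpha> (\<Upsilon> j)) (Q_elt \<alpha> (\<Upsilon> m))
        = ?c m \<otimes>\<^bsub>Q_field \<alpha>\<^esub> ((m_inv (Q_field \<alpha>) (localized_P (\<Upsilon> m) (\<Upsilon> m)) \<otimes>\<^bsub>Q_field \<alpha>\<^esub> localized_P (\<Upsilon> m) (\<Upsilon> m))
            \<otimes>\<^bsub>Q_field \<alpha>\<^esub> localized_P (\<Upsilon> m) (\<Upsilon> j))"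
        unfolding D_def phi_QA_Q_elt(2)[OF tableau[OF j] tableau[OF m]]
        using c[OF m] pc[OF m m] pc[OF m j] unit(1) by (simp add: Q.m_ac)
      also have "\<dots> = ?c m \<otimes>\<^bsub>Q_field \<alpha>\<^esub> localized_P (\<Upsilon> m) (\<Upsilon> j)"
        using pc[OF m j] unit(2) by simp
      finally show "?c m \<otimes>\<^bsub>Q_field \<alpha>\<^esub> localized_P (\<Upsilon> m) (\<Upsilon> j) =
          D m \<otimes>\<^bsub>Q_field \<alpha>\<^esub> phi_QA \<alpha> (w_tab \<alpha> (\<Upsilon> j)) (Q_elt \<alpha> (\<Upsilon> m))" ..
    next
      show "(\<lambda>m. D m \<otimes>\<^bsub>Q_field \<alpha>\<^esub> phi_QA \<alpha> (w_tab \<alpha> (\<Upsilon> j)) (Q_elt \<alpha> (\<Upsilon> m)))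
          \<in> {1..N} \<rightarrow> carrier (Q_field \<alpha>)"
        using Dc localized_P_self_unit(1)[OF tableau] pc[OF _ j]
        by (auto simp: phi_QA_Q_elt(2)[OF tableau[OF j] tableau] simp del: atLeastAtMost_iff)
    qed simp
    finally show "?\<phi> F = \<dots>" .
  qed
  note unit = localized_P_self_unit[OF tableau[OF k]]
  have det: "ring_det (Q_field \<alpha>) k (\<lambda>i j. a_mat \<alpha> \<Upsilon> F i (j + 1)) \<in> carrier (Q_field \<alpha>)" (is "?det \<in> _")
    using k by (intro Q.ring_det_closed a_mat_closed[OF FA]) auto
  have "?c k = m_inv (Q_field \<alpha>) (localized_P (\<Upsilon> k) (\<Upsilon> k)) \<otimes>\<^bsub>Q_field \<alpha>\<^esub> D k"
  proof -
    have "m_inv (Q_field \<alpha>) (localized_P (\<Upsilon> k) (\<Upsilon> k)) \<otimes>\<^bsub>Q_field \<alpha>\<^esub> D k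
      = ?c k \<otimes>\<^bsub>Q_field \<alpha>\<^esub> (m_inv (Q_field \<alpha>) (localized_P (\<Upsilon> k) (\<Upsilon> k)) \<otimes>\<^bsub>Q_field \<alpha>\<^esub> localized_P (\<Upsilon> k) (\<Upsilon> k))"
      unfolding D_def using c[OF k] pc[OF k k] unit(1) by (simp add: Q.m_ac)
    then show ?thesis
      using c[OF k] unit(2) by simp
  qed
  also have "\<dots> = (\<ominus>\<^bsub>Q_field \<alpha>\<^esub> \<one>\<^bsub>Q_field \<alpha>\<^esub>) [^]\<^bsub>Q_field \<alpha>\<^esub> (k - 1)
      \<otimes>\<^bsub>Q_field \<alpha>\<^esub> m_inv (Q_field \<alpha>) (localized_P (\<Upsilon> k) (\<Upsilon> k)) \<otimes>\<^bsub>Q_field \<alpha>\<^esub> ?det"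
    unfolding Dk using unit(1) det by (simp add: Q.m_ac)
  finally show ?thesis .
qed

end

theorem theorem4p5:
  fixes \<alpha> :: "nat list" and n N :: nat and \<Upsilon> :: "nat \<Rightarrow> tableau" and F :: a_elt
  assumes "strong_composition n \<alpha>"
    and "bij_betw \<Upsilon> {1..N} (RSCT n \<alpha>)"
    and "\<And>i j. 1 \<le> i \<Longrightarrow> i < j \<Longrightarrow> j \<le> N \<Longrightarrow> rsct_less n \<alpha> (\<Upsilon> i) (\<Upsilon> j)"
    and "F \<in> carrier (A_algebra \<alpha>)"
  shows
    "(\<forall>D. D \<in> {1..N} \<rightarrow> carrier (Q_field \<alpha>) \<and>
          A_to_QA \<alpha> F = (\<Oplus>\<^bsub>QA_algebra \<alpha>\<^esub>k\<in>{1..N}. D k \<odot>\<^bsub>QA_algebra \<alpha>\<^esub> Q_elt \<alpha> (\<Upsilon> k)) \<longrightarrow>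
        (\<forall>k\<in>{1..N}. D k =
           (\<ominus>\<^bsub>Q_field \<alpha>\<^esub> \<one>\<^bsub>Q_field \<alpha>\<^esub>) [^]\<^bsub>Q_field \<alpha>\<^esub> (k - 1)
             \<otimes>\<^bsub>Q_field \<alpha>\<^esub> ring_det (Q_field \<alpha>) k (\<lambda>i j. a_mat \<alpha> \<Upsilon> F i (j + 1)))) \<and>
     (\<forall>C. C \<in> {1..N} \<rightarrow> carrier (S_ring \<alpha>) \<and>
          F = (\<Oplus>\<^bsub>A_algebra \<alpha>\<^esub>k\<in>{1..N}. C k \<odot>\<^bsub>A_algebra \<alpha>\<^esub> P_elt \<alpha> (\<Upsilon> k)) \<longrightarrow>
        (\<forall>k\<in>{1..N}. of_base (S_ring \<alpha>) (C k) =
           (\<ominus>\<^bsub>Q_field \<alpha>\<^esub> \<one>\<^bsub>Q_field \<alpha>\<^esub>) [^]\<^bsub>Q_field \<alpha>\<^esub> (k - 1)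
             \<otimes>\<^bsub>Q_field \<alpha>\<^esub> m_inv (Q_field \<alpha>)
                 (of_base (S_ring \<alpha>) (phi_A \<alpha> (w_tab \<alpha> (\<Upsilon> k)) (P_elt \<alpha> (\<Upsilon> k))))
             \<otimes>\<^bsub>Q_field \<alpha>\<^esub> ring_det (Q_field \<alpha>) k (\<lambda>i j. a_mat \<alpha> \<Upsilon> F i (j + 1))))"
proof -
  interpret ordered_tableaux n \<alpha> N \<Upsilon>
    by unfold_locales (use assms bij_betwE in blast)+
  show ?thesis
    using coefficient_normalized[OF assms(4)] coefficient_unnormalized[OF assms(4)] unfolding localized_P_def by blast
qed

end
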